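(* Let $\mathcal P = \{A_m\}_{m=0}^\infty$ be a formal orbit portrait of valence $N\ge 2$ with associated degrees $d_{m+1}$, $m\ge 0$, which is realized by a bounded polynomial sequence $\{P_m\}_{m=1}^\infty$ with connected iterated Julia sets and associated orbit $\{p_m\}_{m=0}^\infty$. Then, for each $m \ge 0$, the following hold: (1) A sector $S_m$ at time $m$ is a critical sector if and only if the associated complementary arc $I_m$ is a critical arc. Thus any critical sector at time $m$ has angular width strictly greater than $\tfrac{1}{d_{m+1}}$, while all non-critical sectors at time $m$ have combined angular width strictly less than $\tfrac{1}{d_{m+1}}$. (2) The polynomial $P_{m+1}$ maps a small neighbourhood of $p_m$ diffeomorphically to a small neighbourhood of $p_{m+1} = P_{m+1}(p_m)$, carrying each sector based at $p_m$ locally onto a sector based at $p_{m+1}$ and preserving the cyclic order of these sectors around their base point. (3) If $S_m$ is a non-critical sector at $p_m$, then $P_{m+1}$ maps $S_m$ homeomorphically onto a sector $S_{m+1}$ at $p_{m+1}$. If $S_m$ is a critical sector, then $P_{m+1}$ maps $S_m$ onto the whole complex plane. (4) If $S_m$ is a critical sector with associated (critical) complementary arc $I_m$, then the critical value arc $I_{m+1}$ for $A_{m+1}$ associated with $I_m$ is associated with a critical value sector $S_{m+1}$ which contains a critical value $v_{m+1}$ which is the image under $P_{m+1}$ of a critical point $c_m$ lying inside $S_m$. Further, if $2 \le k \le d_{m+1}$ is such that the image of $I_m$ under $\theta \mapsto d_{m+1}\theta \pmod 1$ covers $I_{m+1}$ $k$ times, then the image of $S_m$ under $P_{m+1}$ covers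 $S_{m+1}$ $k$ times and the rest of the complex plane $k-1$ times.
   Context: Bounded sequences. A bounded polynomial sequence (with bounds $d\ge 2$, $K\ge 1$, $M\ge 0$) is a sequence $\{P_m\}_{m=1}^\infty$ of polynomials $P_m(z)=\sum_{k=0}^{d_m} a_{k,m}z^k$ with $2\le d_m\le d$, $1/K\le |a_{d_m,m}|\le K$ and $|a_{k,m}|\le M$ for $0\le k\le d_m-1$, for all $m\ge1$. For $0\le m\le n$ put $Q_{m,n}=P_n\circ\cdots\circ P_{m+1}$ ($Q_{m,m}=\mathrm{id}$). Put $\mathcal K_m=\{z\in\mathbb C:\limsup_{n}|Q_{m,n}(z)|<\infty\}$ (iterated filled Julia set), $\mathcal A_{\infty,m}=\{z\in\mathbb C:\lim_n|Q_{m,n}(z)|=\infty\}$ (iterated basin of infinity; $\infty$ is added to it when regarded as a domain in $\overline{\mathbb C}$), $\mathcal J_m=\partial\mathcal K_m=\partial\mathcal A_{\infty,m}$ (iterated Julia set). An orbit is a sequence $\{z_m\}_{m=0}^\infty$ with $P_{m+1}(z_m)=z_{m+1}$ for all $m\ge0$. External rays. If all $\mathcal J_m$ are connected, there are Böttcher maps $\phi_m$, $m\ge 0$: conformal bijections $\phi_m:\mathcal A_{\infty,m}\to\overline{\mathbb C}\setminus\overline{\mathbb D}$ fixing $\infty$ with $\phi_{m+1}\circ P_{m+1}\circ\phi_m^{-1}(z)=z^{d_{m+1}}$. (If all $P_m$ are monic they are made unique by requiring derivative $1$ at $\infty$.) The external ray of angle $\theta\in\mathbb R/\mathbb Z$ at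 time $m$ is $R_{\theta;m}=\phi_m^{-1}(\{Re^{2\pi i\theta}:R>1\})$; it lands at $p\in\mathcal J_m$ if $\lim_{R\to1^+}\phi_m^{-1}(Re^{2\pi i\theta})=p$. Formal portraits. Let $2\le d\le\infty$, $N\ge1$, and let $d_m$, $m\ge1$, be integers with $2\le d_m\le d$. A formal orbit portrait of valence $N$ (and degree bound $d$) is a sequence $\mathcal P=\{A_m\}_{m=0}^\infty$, where each $A_m$ is a set of $N$ distinct angles in $\mathbb R/\mathbb Z$ and $\theta\mapsto d_{m+1}\theta\pmod 1$ maps $A_m$ bijectively onto $A_{m+1}$ preserving cyclic ordering (a vacuous condition when $N=2$). The integers $d_{m+1}$ are the degrees of $\mathcal P$. The complementary arcs of $A_m$ are the components of $(\mathbb R/\mathbb Z)\setminus A_m$; $\mathbb R/\mathbb Z$ has total length $1$. A complementary arc $I_m$ of $A_m$ is critical if it has length $>1/d_{m+1}$ and $\theta\mapsto d_{m+1}\theta\pmod1$ is not injective on it. In that case there is $2\le k\le d_{m+1}$ such that the image of $I_m$ covers exactly one complementary arc of $A_{m+1}$ $k$ times and all other complementary arcs $k-1$ times; the arc covered $k$ times is the critical value arc for $A_{m+1}$ associated with $I_m$. Realization. $\mathcal P$ is realized by a bounded sequence $\{P_m\}$ with orbit $\{p_m\}_{m=0}^\infty$ if $\deg P_m=d_m$ for all $m\ge1$, all $\mathcal J_m$ are connected, $p_m\in\mathcal J_m$ for all $m\ge 0$, and for each $m\ge 0$ the rays $R_{\theta;m}$ with $\theta\in A_m$, and no others, land at $p_m$.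 Sectors. If $\mathcal P$ is realized, the rays $R_{\theta;m}$, $\theta\in A_m$, together with $p_m$, divide $\mathbb C$ into $N$ simply connected regions, the sectors at time $m$ (based at $p_m$). Each sector $S_m$ corresponds to exactly one complementary arc $I_m$ of $A_m$ (the arc associated with $S_m$), namely the arc of external angles of the points of $S_m\cap\mathcal A_{\infty,m}$; the angular width of $S_m$ is the length of $I_m$. A sector at time $m$ is a critical sector if it contains a critical point of $P_{m+1}$; a sector at time $m+1$ is a critical value sector if it contains a critical value of $P_{m+1}$. That the image of $S_m$ covers a point $z_0$ $k$ times means that $P_{m+1}(z)=z_0$ has $k$ solutions in $S_m$, counted with multiplicity. *)

theory Defs
  imports "HOL-Complex_Analysis.Complex_Analysis"
begin

section \<open>Bounded polynomial sequences\<close>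

text \<open>Sequences of polynomials are indexed from 1 on; the entry at index 0 is never used.\<close>

definition bounded_poly_seq :: "nat \<Rightarrow> real \<Rightarrow> real \<Rightarrow> (nat \<Rightarrow> complex poly) \<Rightarrow> bool" where
  "bounded_poly_seq d K M P \<longleftrightarrow>
     2 \<le> d \<and> 1 \<le> K \<and> 0 \<le> M \<and>
     (\<forall>m\<ge>1. 2 \<le> degree (P m) \<and> degree (P m) \<le> d \<and>
        1 / K \<le> norm (lead_coeff (P m)) \<and> norm (lead_coeff (P m)) \<le> K \<and>
        (\<forall>k<degree (P m). norm (coeff (P m) k) \<le> M))"

text \<open>\<open>iterate P m n\<close> is the composition of \<open>P (m + 1), \<dots>, P n\<close>; it is only meaningful for
  \<open>m \<le> n\<close>, and is the identity for \<open>n \<le> m\<close>.\<close>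

primrec iterate :: "(nat \<Rightarrow> complex poly) \<Rightarrow> nat \<Rightarrow> nat \<Rightarrow> complex \<Rightarrow> complex" where
  "iterate P m 0 = id"
| "iterate P m (Suc n) = (if m \<le> n then poly (P (Suc n)) \<circ> iterate P m n else id)"

definition filled_julia :: "(nat \<Rightarrow> complex poly) \<Rightarrow> nat \<Rightarrow> complex set" where
  "filled_julia P m = {z. limsup (\<lambda>n. ereal (norm (iterate P m n z))) < \<infinity>}"

definition basin_infinity :: "(nat \<Rightarrow> complex poly) \<Rightarrow> nat \<Rightarrow> complex set" where
  "basin_infinity P m = {z. filterlim (\<lambda>n. norm (iterate P m n z)) at_top sequentially}"

definition julia :: "(nat \<Rightarrow> complex poly) \<Rightarrow> nat \<Rightarrow> complex set" where
  "julia P m = frontier (filled_julia P m)"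

definition is_orbit :: "(nat \<Rightarrow> complex poly) \<Rightarrow> (nat \<Rightarrow> complex) \<Rightarrow> bool" where
  "is_orbit P z \<longleftrightarrow> (\<forall>m. poly (P (Suc m)) (z m) = z (Suc m))"

definition critical_point :: "complex poly \<Rightarrow> complex \<Rightarrow> bool" where
  "critical_point f c \<longleftrightarrow> poly (pderiv f) c = 0"


section \<open>Boettcher maps and external rays\<close>

text \<open>The point at infinity is left out of the domains: \<open>\<phi> m\<close> is a conformal bijection between
  the finite parts, and fixing infinity is expressed by the limit at infinity. If the polynomials
  are not all monic, the Boettcher maps, and with them the labelling of the rays by angles, are not
  unique, so they are passed on as a parameter.\<close>

definition boettcher_maps :: "(nat \<Rightarrow> complex poly) \<Rightarrow> (nat \<Rightarrow> complex \<Rightarrow> complex) \<Rightarrow> bool" where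
  "boettcher_maps P \<phi> \<longleftrightarrow>
     (\<forall>m. \<phi> m holomorphic_on basin_infinity P m \<and>
          bij_betw (\<phi> m) (basin_infinity P m) {w. norm w > 1} \<and>
          filterlim (\<phi> m) at_infinity at_infinity \<and>
          (\<forall>z\<in>basin_infinity P m.
             \<phi> (Suc m) (poly (P (Suc m)) z) = \<phi> m z ^ degree (P (Suc m)))) \<and>
     ((\<forall>m\<ge>1. lead_coeff (P m) = 1) \<longrightarrow> (\<forall>m. ((\<lambda>z. \<phi> m z / z) \<longlongrightarrow> 1) at_infinity))"

definition circle_exp :: "real \<Rightarrow> complex" where
  "circle_exp \<theta> = cis (2 * pi * \<theta>)"

definition ray_param ::
  "(nat \<Rightarrow> complex poly) \<Rightarrow> (nat \<Rightarrow> complex \<Rightarrow> complex) \<Rightarrow> nat \<Rightarrow> real \<Rightarrow> real \<Rightarrow> complex" where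
  "ray_param P \<phi> m \<theta> R = inv_into (basin_infinity P m) (\<phi> m) (of_real R * circle_exp \<theta>)"

definition external_ray ::
  "(nat \<Rightarrow> complex poly) \<Rightarrow> (nat \<Rightarrow> complex \<Rightarrow> complex) \<Rightarrow> nat \<Rightarrow> real \<Rightarrow> complex set" where
  "external_ray P \<phi> m \<theta> = ray_param P \<phi> m \<theta> ` {1<..}"

definition ray_lands_at ::
  "(nat \<Rightarrow> complex poly) \<Rightarrow> (nat \<Rightarrow> complex \<Rightarrow> complex) \<Rightarrow> nat \<Rightarrow> real \<Rightarrow> complex \<Rightarrow> bool" where
  "ray_lands_at P \<phi> m \<theta> q \<longleftrightarrow>
     q \<in> julia P m \<and> (ray_param P \<phi> m \<theta> \<longlongrightarrow> q) (at_right 1)"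


section \<open>Formal orbit portraits\<close>

text \<open>The circle of angles, the reals modulo 1, is represented by \<open>{0..<1}\<close>. Its topology is that
  of the unit circle, transported along \<open>circle_exp\<close>; in particular an arc through the angle 0 is
  not an interval of \<open>{0..<1}\<close>.\<close>

definition angle_mult :: "nat \<Rightarrow> real \<Rightarrow> real" where
  "angle_mult k \<theta> = frac (real k * \<theta>)"

definition angle_ccw :: "real \<Rightarrow> real \<Rightarrow> real \<Rightarrow> bool" where
  "angle_ccw a b c \<longleftrightarrow> a < b \<and> b < c \<or> b < c \<and> c < a \<or> c < a \<and> a < b"

definition formal_orbit_portrait ::
  "enat \<Rightarrow> nat \<Rightarrow> (nat \<Rightarrow> nat) \<Rightarrow> (nat \<Rightarrow> real set) \<Rightarrow> bool" where
  "formal_orbit_portrait d N deg A \<longleftrightarrow>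
     2 \<le> d \<and> 1 \<le> N \<and>
     (\<forall>m\<ge>1. 2 \<le> deg m \<and> enat (deg m) \<le> d) \<and>
     (\<forall>m. A m \<subseteq> {0..<1} \<and> finite (A m) \<and> card (A m) = N \<and>
          bij_betw (angle_mult (deg (Suc m))) (A m) (A (Suc m)) \<and>
          (\<forall>a\<in>A m. \<forall>b\<in>A m. \<forall>c\<in>A m. angle_ccw a b c \<longrightarrow>
             angle_ccw (angle_mult (deg (Suc m)) a) (angle_mult (deg (Suc m)) b)
                       (angle_mult (deg (Suc m)) c)))"

definition complementary_arcs :: "real set \<Rightarrow> real set set" where
  "complementary_arcs A =
     {I. I \<subseteq> {0..<1} \<and> circle_exp ` I \<in> components (sphere 0 1 - circle_exp ` A)}"

definition arc_length :: "real set \<Rightarrow> real" where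
  "arc_length I = measure lborel I"

definition critical_arc :: "(nat \<Rightarrow> nat) \<Rightarrow> (nat \<Rightarrow> real set) \<Rightarrow> nat \<Rightarrow> real set \<Rightarrow> bool" where
  "critical_arc deg A m I \<longleftrightarrow>
     I \<in> complementary_arcs (A m) \<and> arc_length I > 1 / real (deg (Suc m)) \<and>
     \<not> inj_on (angle_mult (deg (Suc m))) I"

definition arc_covers :: "nat \<Rightarrow> real set \<Rightarrow> real set \<Rightarrow> nat \<Rightarrow> bool" where
  "arc_covers n I J k \<longleftrightarrow>
     (\<forall>\<theta>\<in>J. finite {t \<in> I. angle_mult n t = \<theta>} \<and> card {t \<in> I. angle_mult n t = \<theta>} = k)"

definition critical_value_arc ::
  "(nat \<Rightarrow> nat) \<Rightarrow> (nat \<Rightarrow> real set) \<Rightarrow> nat \<Rightarrow> real set \<Rightarrow> real set \<Rightarrow> bool" where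
  "critical_value_arc deg A m I J \<longleftrightarrow>
     critical_arc deg A m I \<and> J \<in> complementary_arcs (A (Suc m)) \<and>
     (\<exists>k. 2 \<le> k \<and> k \<le> deg (Suc m) \<and> arc_covers (deg (Suc m)) I J k \<and>
        (\<forall>J'\<in>complementary_arcs (A (Suc m)) - {J}. arc_covers (deg (Suc m)) I J' (k - 1)))"

definition realizes ::
  "(nat \<Rightarrow> complex poly) \<Rightarrow> (nat \<Rightarrow> complex \<Rightarrow> complex) \<Rightarrow> (nat \<Rightarrow> complex) \<Rightarrow>
   (nat \<Rightarrow> nat) \<Rightarrow> (nat \<Rightarrow> real set) \<Rightarrow> bool" where
  "realizes P \<phi> p deg A \<longleftrightarrow>
     (\<forall>m\<ge>1. degree (P m) = deg m) \<and>
     (\<forall>m. connected (julia P m)) \<and>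
     boettcher_maps P \<phi> \<and>
     is_orbit P p \<and> (\<forall>m. p m \<in> julia P m) \<and>
     (\<forall>m. \<forall>\<theta>\<in>{0..<1}. \<theta> \<in> A m \<longleftrightarrow> ray_lands_at P \<phi> m \<theta> (p m))"


section \<open>Sectors\<close>

definition sectors ::
  "(nat \<Rightarrow> complex poly) \<Rightarrow> (nat \<Rightarrow> complex \<Rightarrow> complex) \<Rightarrow> (nat \<Rightarrow> complex) \<Rightarrow>
   (nat \<Rightarrow> real set) \<Rightarrow> nat \<Rightarrow> complex set set" where
  "sectors P \<phi> p A m = components (- (insert (p m) (\<Union>\<theta>\<in>A m. external_ray P \<phi> m \<theta>)))"

definition sector_arc ::
  "(nat \<Rightarrow> complex poly) \<Rightarrow> (nat \<Rightarrow> complex \<Rightarrow> complex) \<Rightarrow> nat \<Rightarrow> complex set \<Rightarrow> real set" where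
  "sector_arc P \<phi> m S =
     {\<theta> \<in> {0..<1}. \<exists>z \<in> S \<inter> basin_infinity P m. z \<in> external_ray P \<phi> m \<theta>}"

definition angular_width ::
  "(nat \<Rightarrow> complex poly) \<Rightarrow> (nat \<Rightarrow> complex \<Rightarrow> complex) \<Rightarrow> nat \<Rightarrow> complex set \<Rightarrow> real" where
  "angular_width P \<phi> m S = arc_length (sector_arc P \<phi> m S)"

text \<open>The next two notions are for a sector \<open>S\<close> at time \<open>m\<close> with \<open>f = P (m + 1)\<close>, and for a sector
  \<open>S\<close> at time \<open>m + 1\<close> with \<open>f = P (m + 1)\<close>, respectively.\<close>

definition critical_sector :: "complex poly \<Rightarrow> complex set \<Rightarrow> bool" where
  "critical_sector f S \<longleftrightarrow> (\<exists>c\<in>S. critical_point f c)"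

definition critical_value_sector :: "complex poly \<Rightarrow> complex set \<Rightarrow> bool" where
  "critical_value_sector f S \<longleftrightarrow> (\<exists>c. critical_point f c \<and> poly f c \<in> S)"

definition covers_point :: "complex poly \<Rightarrow> complex set \<Rightarrow> complex \<Rightarrow> nat \<Rightarrow> bool" where
  "covers_point f S w k \<longleftrightarrow>
     finite {z \<in> S. poly f z = w} \<and> (\<Sum>z\<in>{z \<in> S. poly f z = w}. order z (f - [:w:])) = k"

text \<open>Cyclic order of three distinct sectors around their common boundary point \<open>q\<close>: on arbitrarily small
  positively oriented Jordan curves around \<open>q\<close> one finds points of \<open>S1\<close>, \<open>S2\<close>, \<open>S3\<close>, in this
  order, which are joined to \<open>q\<close> by arcs that lie inside the curve and inside the respective
  sector. The arcs are essential, since a sector may meet the curve in many pieces. Cyclic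
  permutations are accounted for by moving the base point of the curve.\<close>

definition accesses :: "(real \<Rightarrow> complex) \<Rightarrow> complex \<Rightarrow> complex set \<Rightarrow> complex \<Rightarrow> bool" where
  "accesses \<gamma> q S x \<longleftrightarrow>
     (\<exists>\<beta>. arc \<beta> \<and> pathstart \<beta> = q \<and> pathfinish \<beta> = x \<and>
        path_image \<beta> - {q} \<subseteq> S \<and> path_image \<beta> - {x} \<subseteq> inside (path_image \<gamma>))"

definition ccw_around :: "complex \<Rightarrow> complex set \<Rightarrow> complex set \<Rightarrow> complex set \<Rightarrow> bool" where
  "ccw_around q S1 S2 S3 \<longleftrightarrow>
     S1 \<noteq> S2 \<and> S2 \<noteq> S3 \<and> S1 \<noteq> S3 \<and>
     (\<forall>\<epsilon>>0. \<exists>\<gamma> t1 t2 t3.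
        simple_path \<gamma> \<and> pathfinish \<gamma> = pathstart \<gamma> \<and> path_image \<gamma> \<subseteq> ball q \<epsilon> \<and>
        q \<in> inside (path_image \<gamma>) \<and> winding_number \<gamma> q = 1 \<and>
        0 \<le> t1 \<and> t1 < t2 \<and> t2 < t3 \<and> t3 < 1 \<and>
        accesses \<gamma> q S1 (\<gamma> t1) \<and> accesses \<gamma> q S2 (\<gamma> t2) \<and> accesses \<gamma> q S3 (\<gamma> t3))"

end

theory Submission
  imports Defs "HOL-Computational_Algebra.Fundamental_Theorem_Algebra"
begin

text \<open>Two rays landing at the same point form, together with infinity, a Jordan curve, and every component
  of the complement of finitely many rays meets the basin; hence the sectors correspond to the complementary
  arcs. Let \<open>n S w\<close> be the number of preimages of \<open>w\<close> in the sector \<open>S\<close>, with multiplicity. It is lower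
  semicontinuous in \<open>w\<close>, and the sum over all sectors is the degree off the rays, so that \<open>n S\<close> is
  constant on every sector at the next time, where it can be read off from the angles of points of the basin.
  On the rays it is again given by angles. The base point \<open>p\<close> is not critical, since the rays landing
  at its image have only one preimage each that lands at \<open>p\<close>; then semicontinuity and the sum rule also
  give \<open>n S\<close> at the image of \<open>p\<close>. All covering statements, and the local statement at \<open>p\<close>, are read off from \<open>n S\<close>.
  A critical point over the critical value sector exists because otherwise a component of the preimage of
  this simply connected sector would be mapped bijectively, but it would be bounded by two rays with distinct landing
  points, which do not separate the plane.\<close>

section \<open>Roots of polynomials in open sets\<close>

text \<open>Sectors are unbounded, and near \<open>p\<close> the shape of their boundary rays is not
  controlled, so no contour argument on a sector is at hand. Openness of holomorphic maps yields
  only that roots do not disappear from an open set; the reverse inequality always comes from a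
  fixed total, the degree. The combinatorics has the same shape: d times the length of an arc is a
  number \<open>extra\<close> of full turns plus the length of an arc at the next time. Both
  families of lengths add up to 1, so the numbers \<open>extra\<close> add up to d - 1. This is also
  the number of roots over \<open>p'\<close> apart from the simple root \<open>p\<close>, and the
  agreement of the two totals fixes every count there. Theorems on arcs and Jordan curves concern
  compact sets. Rays are therefore moved by an inversion 1/(z - z0) about a point off them, which
  turns infinity into the point 0. In the search for a critical point, the boundary of the region
  considered may contain preimages of \<open>p'\<close> whose position is unknown. There are
  finitely many, and they are deleted in advance, which does not disconnect an open connected
  set.\<close>

definition root_count :: "complex poly \<Rightarrow> complex set \<Rightarrow> complex \<Rightarrow> nat" where
  "root_count f T w = (\<Sum>z\<in>{z\<in>T. poly f z = w}. order z (f - [:w:]))"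

lemma diff_const_nonzero:
  fixes f :: "complex poly"
  assumes "degree f > 0"
  shows "f - [:w:] \<noteq> 0"
  using assms by (metis degree_pCons_0 eq_iff_diff_eq_0 less_irrefl)

lemma finite_poly_fibre:
  fixes f :: "complex poly"
  assumes "degree f > 0"
  shows "finite {z. poly f z = w}"
  using poly_roots_finite[OF diff_const_nonzero[OF assms], of w] by simp

lemma finite_poly_fibre_on:
  fixes f :: "complex poly"
  assumes "degree f > 0"
  shows "finite {z\<in>T. poly f z = w}"
  by (rule finite_subset[OF _ finite_poly_fibre[OF assms, of w]]) auto

lemma covers_point_iff_root_count:
  assumes "degree f > 0"
  shows "covers_point f S w k \<longleftrightarrow> root_count f S w = k"
  using finite_poly_fibre_on[OF assms] by (auto simp: covers_point_def root_count_def)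

lemma order_fibre_pos:
  fixes f :: "complex poly"
  assumes "degree f > 0" "poly f z = w"
  shows "order z (f - [:w:]) > 0"
  using assms diff_const_nonzero[OF assms(1), of w] order_root[of "f - [:w:]" z] by auto

lemma order_fibre_simple:
  fixes f :: "complex poly"
  assumes "degree f > 0" "poly f z = w" "poly (pderiv f) z \<noteq> 0"
  shows "order z (f - [:w:]) = 1"
proof -
  have pd: "pderiv (f - [:w:]) = pderiv f"
    by (simp add: pderiv_diff)
  have "order z (f - [:w:]) = Suc (order z (pderiv (f - [:w:])))"
    using assms by (intro order_pderiv diff_const_nonzero) auto
  also have "order z (pderiv (f - [:w:])) = 0"
    using assms(3) pd by (simp add: order_0I)
  finally show ?thesis by simp
qed

lemma critical_point_iff_order:
  fixes f :: "complex poly"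
  assumes "degree f > 0"
  shows "critical_point f z \<longleftrightarrow> order z (f - [:poly f z:]) \<noteq> 1"
proof
  assume "critical_point f z"
  hence pz: "poly (pderiv f) z = 0" by (simp add: critical_point_def)
  have pd: "pderiv (f - [:poly f z:]) = pderiv f" by (simp add: pderiv_diff)
  have nz: "pderiv f \<noteq> 0" using assms by (simp add: pderiv_eq_0_iff)
  have "order z (f - [:poly f z:]) = Suc (order z (pderiv f))"
    using order_pderiv[OF diff_const_nonzero[OF assms], of "poly f z" z] pd by simp
  moreover have "order z (pderiv f) \<noteq> 0" using pz nz by (simp add: order_root)
  ultimately show "order z (f - [:poly f z:]) \<noteq> 1" by simp
qed (use order_fibre_simple[OF assms refl] in \<open>auto simp: critical_point_def\<close>)

lemma root_count_UNIV:
  assumes "degree f > 0"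
  shows "root_count f UNIV w = degree f"
proof -
  have nz: "f - [:w:] \<noteq> 0" by (rule diff_const_nonzero[OF assms])
  have "degree f = degree (f - [:w:])"
    using assms by (metis degree_add_eq_left degree_minus degree_pCons_0 diff_conv_add_uminus)
  also have "\<dots> = size (proots (f - [:w:]))"
    by (simp add: size_proots_complex)
  also have "\<dots> = (\<Sum>z\<in>{z. poly f z = w}. order z (f - [:w:]))"
    using nz by (simp add: size_multiset_overloaded_eq)
  finally show ?thesis by (simp add: root_count_def)
qed

lemma root_count_mono:
  assumes "degree f > 0" "S \<subseteq> T"
  shows "root_count f S w \<le> root_count f T w"
  unfolding root_count_def using assms finite_poly_fibre_on[OF assms(1)]
  by (intro sum_mono2) auto

lemma root_count_UNION:
  assumes "degree f > 0" "finite I" "\<And>i j. i \<in> I \<Longrightarrow> j \<in> I \<Longrightarrow> i \<noteq> j \<Longrightarrow> T i \<inter> T j = {}"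
  shows "root_count f (\<Union>i\<in>I. T i) w = (\<Sum>i\<in>I. root_count f (T i) w)"
proof -
  have "{z\<in>(\<Union>i\<in>I. T i). poly f z = w} = (\<Union>i\<in>I. {z\<in>T i. poly f z = w})" by auto
  thus ?thesis
    unfolding root_count_def
    by (simp, intro sum.UNION_disjoint) (use assms finite_poly_fibre_on[OF assms(1)] in \<open>auto; blast\<close>)+
qed

lemma root_count_Un:
  assumes "degree f > 0" "S \<inter> T = {}"
  shows "root_count f (S \<union> T) w = root_count f S w + root_count f T w"
proof -
  have "{z\<in>S \<union> T. poly f z = w} = {z\<in>S. poly f z = w} \<union> {z\<in>T. poly f z = w}" by auto
  thus ?thesis
    unfolding root_count_def
    by (simp, intro sum.union_disjoint) (use assms finite_poly_fibre_on[OF assms(1)] in auto)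
qed

lemma root_count_eq_0_iff:
  assumes "degree f > 0"
  shows "root_count f S w = 0 \<longleftrightarrow> w \<notin> poly f ` S"
proof -
  have "root_count f S w = 0 \<longleftrightarrow> (\<forall>z\<in>{z\<in>S. poly f z = w}. order z (f - [:w:]) = 0)"
    unfolding root_count_def by (rule sum_eq_0_iff[OF finite_poly_fibre_on[OF assms]])
  also have "\<dots> \<longleftrightarrow> {z\<in>S. poly f z = w} = {}"
    using order_fibre_pos[OF assms, of _ w] by fastforce
  finally show ?thesis by auto
qed

lemma card_fibre_le_root_count:
  assumes "degree f > 0"
  shows "card {z\<in>S. poly f z = w} \<le> root_count f S w"
  unfolding root_count_def card_eq_sum
  using order_fibre_pos[OF assms] by (intro sum_mono) (auto simp: Suc_le_eq)

lemma root_count_eq_card: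
  assumes "degree f > 0" "\<And>z. z \<in> S \<Longrightarrow> poly f z = w \<Longrightarrow> \<not> critical_point f z"
  shows "root_count f S w = card {z\<in>S. poly f z = w}"
  unfolding root_count_def card_eq_sum
  using order_fibre_simple[OF assms(1)] assms(2) by (intro sum.cong) (auto simp: critical_point_def)

text \<open>Near \<open>z0\<close> the function \<open>f - w0\<close> is the e-th power of a
  holomorphic map \<open>u\<close> that vanishes at \<open>z0\<close>. Since \<open>u\<close> is
  open, all e distinct e-th roots of a small nonzero \<open>w - w0\<close> are values of
  \<open>u\<close>, and each yields another root over \<open>w\<close>.\<close>

lemma order_le_root_count_ball:
  assumes deg: "degree f > 0" and w0: "poly f z0 = w0" and "r > 0"
  shows "\<forall>\<^sub>F w in nhds w0. order z0 (f - [:w0:]) \<le> root_count f (ball z0 r) w"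
proof -
  define e where "e = order z0 (f - [:w0:])"
  have e: "e > 0" unfolding e_def by (rule order_fibre_pos[OF deg w0])
  obtain q where q: "f - [:w0:] = [:- z0, 1:] ^ e * q" and q0: "\<not> [:- z0, 1:] dvd q"
    using order_decomp[OF diff_const_nonzero[OF deg], of w0 z0] unfolding e_def by blast
  have qz: "poly q z0 \<noteq> 0" using q0 by (simp add: poly_eq_0_iff_dvd)
  have fz: "poly f z - w0 = (z - z0) ^ e * poly q z" for z
    using arg_cong[OF q, of "\<lambda>p. poly p z"] by (simp add: algebra_simps)
  have "\<forall>\<^sub>F z in nhds z0. poly q z \<noteq> 0"
    using qz by (intro eventually_nhds_in_open[of "{z. poly q z \<noteq> 0}", simplified]) 
      (auto intro!: open_Collect_neq continuous_intros)
  then obtain r1 where r1: "r1 > 0" "\<And>z. dist z z0 < r1 \<Longrightarrow> poly q z \<noteq> 0"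
    by (auto simp: eventually_nhds_metric)
  define s where "s = min r r1"
  have s: "s > 0" "\<And>z. z \<in> ball z0 s \<Longrightarrow> poly q z \<noteq> 0"
    using r1 \<open>r > 0\<close> by (auto simp: s_def dist_commute)
  obtain g where g: "g holomorphic_on ball z0 s" "\<And>z. z \<in> ball z0 s \<Longrightarrow> poly q z = exp (g z)"
    using holomorphic_logarithm_exists[of "ball z0 s" "poly q" z0] s
      poly_holomorphic_on[OF holomorphic_on_ident, of q "ball z0 s"] by (metis centre_in_ball convex_ball open_ball)
  \<comment> \<open>The cofactor \<open>q\<close> has no zero on the disc, hence a logarithm
    \<open>g\<close>; so \<open>u\<close> is an e-th root of \<open>f - w0\<close>.\<close>
  define u where "u z = (z - z0) * exp (g z / of_nat e)" for z
  have uh: "u holomorphic_on ball z0 s"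
    unfolding u_def by (intro holomorphic_intros g) (use e in auto)
  have ue: "u z ^ e = poly f z - w0" if "z \<in> ball z0 s" for z
    using g(2)[OF that] e by (simp add: u_def fz power_mult_distrib flip: exp_of_nat_mult)
  have "\<not> u constant_on ball z0 s"
  proof
    assume "u constant_on ball z0 s"
    moreover have "z0 + of_real (s/2) \<in> ball z0 s" "z0 \<in> ball z0 s"
      using s(1) by (auto simp: dist_norm)
    ultimately have "u (z0 + of_real (s/2)) = u z0"
      unfolding constant_on_def by metis
    thus False using s(1) by (simp add: u_def)
  qed
  then have "open (u ` ball z0 s)"
    by (intro open_mapping_thm[OF uh]) auto
  moreover have "0 \<in> u ` ball z0 s"
    using s(1) by (intro image_eqI[of _ _ z0]) (auto simp: u_def)
  ultimately obtain h where h: "h > 0" "ball 0 h \<subseteq> u ` ball z0 s"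
    by (meson openE)
  have *: "e \<le> root_count f (ball z0 r) w" if w: "dist w w0 < h ^ e" for w
  proof (cases "w = w0")
    case True
    have "e = (\<Sum>z\<in>{z0}. order z (f - [:w0:]))" by (simp add: e_def)
    also have "\<dots> \<le> root_count f (ball z0 r) w0"
      unfolding root_count_def using finite_poly_fibre_on[OF deg, of "ball z0 r" w0] w0 \<open>r > 0\<close>
      by (intro sum_mono2) auto
    finally show ?thesis using True by simp
  next
    case False
    define Z where "Z = {\<zeta>. \<zeta> ^ e = w - w0}"
    have cZ: "card Z = e" unfolding Z_def using False e by (intro card_nth_roots) auto
    have "Z \<subseteq> u ` {z\<in>ball z0 r. poly f z = w}"
    proof
      fix \<zeta> assume \<zeta>: "\<zeta> \<in> Z"
      hence "norm \<zeta> ^ e < h ^ e" using w by (simp add: Z_def dist_norm flip: norm_power)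
      hence "norm \<zeta> < h" using h(1) by (simp add: power_less_imp_less_base)
      hence "\<zeta> \<in> u ` ball z0 s" using h(2) by auto
      then obtain z where z: "z \<in> ball z0 s" "\<zeta> = u z" by auto
      hence "poly f z = w" using ue[OF z(1)] \<zeta> by (simp add: Z_def)
      with z show "\<zeta> \<in> u ` {z\<in>ball z0 r. poly f z = w}" by (auto simp: s_def)
    qed
    hence "card Z \<le> card {z\<in>ball z0 r. poly f z = w}"
      by (rule surj_card_le[OF finite_poly_fibre_on[OF deg]])
    also have "\<dots> \<le> root_count f (ball z0 r) w" by (rule card_fibre_le_root_count[OF deg])
    finally show ?thesis using cZ by simp
  qed
  show ?thesis
    unfolding e_def[symmetric] eventually_nhds_metric
    using * h(1) by (intro exI[of _ "h ^ e"]) auto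
qed

lemma finite_disjoint_balls:
  fixes Z :: "'a::metric_space set"
  assumes "finite Z"
  obtains r where "r > 0" "\<And>x y. x \<in> Z \<Longrightarrow> y \<in> Z \<Longrightarrow> x \<noteq> y \<Longrightarrow> ball x r \<inter> ball y r = {}"
proof -
  have "\<exists>r>0. \<forall>x\<in>Z. \<forall>y\<in>Z. x \<noteq> y \<longrightarrow> r \<le> dist x y"
    using assms
  proof (induction Z rule: finite_induct)
    case empty
    show ?case by (intro exI[of _ 1]) auto
  next
    case (insert a Z)
    then obtain r where r: "r > 0" "\<forall>x\<in>Z. \<forall>y\<in>Z. x \<noteq> y \<longrightarrow> r \<le> dist x y" by blast
    obtain t where t: "t > 0" "\<And>x. x \<in> Z \<Longrightarrow> x \<noteq> a \<Longrightarrow> t \<le> dist a x"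
      using finite_set_avoid[OF insert.hyps(1), of a] by (metis dist_commute)
    show ?case
      using r t insert.hyps by (intro exI[of _ "min r t"]) (force simp: dist_commute min_def)
  qed
  then obtain r where r: "r > 0" "\<forall>x\<in>Z. \<forall>y\<in>Z. x \<noteq> y \<longrightarrow> r \<le> dist x y" by blast
  show thesis
  proof (rule that[of "r/2"])
    fix x y assume "x \<in> Z" "y \<in> Z" "x \<noteq> y"
    hence "r \<le> dist x y" using r by auto
    show "ball x (r/2) \<inter> ball y (r/2) = {}"
      by (rule disjoint_ballI) (use \<open>r \<le> dist x y\<close> in auto)
  qed (use r in auto)
qed

text \<open>The roots over \<open>w0\<close> get disjoint discs inside \<open>T\<close>, each of
  which keeps at least its multiplicity. The inequality can be strict: roots on the boundary of
  \<open>T\<close> may move into \<open>T\<close>.\<close>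

lemma root_count_lsc:
  assumes deg: "degree f > 0" and "open T"
  shows "\<forall>\<^sub>F w in nhds w0. root_count f T w0 \<le> root_count f T w"
proof -
  define Z where "Z = {z\<in>T. poly f z = w0}"
  have fin: "finite Z" unfolding Z_def by (rule finite_poly_fibre_on[OF deg])
  obtain r1 where r1: "r1 > 0" "\<And>x y. x \<in> Z \<Longrightarrow> y \<in> Z \<Longrightarrow> x \<noteq> y \<Longrightarrow> ball x r1 \<inter> ball y r1 = {}"
    using finite_disjoint_balls[OF fin] by metis
  have "\<forall>z\<in>Z. \<exists>r>0. ball z r \<subseteq> T"
    using \<open>open T\<close> by (auto simp: Z_def elim: openE)
  then obtain rr where rr: "\<And>z. z \<in> Z \<Longrightarrow> rr z > 0 \<and> ball z (rr z) \<subseteq> T" by metis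
  define b where "b z = ball z (min r1 (rr z))" for z
  have "\<forall>\<^sub>F w in nhds w0. \<forall>z\<in>Z. order z (f - [:w0:]) \<le> root_count f (b z) w"
    unfolding b_def
    by (intro eventually_ball_finite[OF fin] ballI order_le_root_count_ball[OF deg])
      (use r1 rr in \<open>auto simp: Z_def\<close>)
  thus ?thesis
  proof eventually_elim
    case (elim w)
    have "root_count f T w0 = (\<Sum>z\<in>Z. order z (f - [:w0:]))" by (simp add: root_count_def Z_def)
    also have "\<dots> \<le> (\<Sum>z\<in>Z. root_count f (b z) w)" using elim by (intro sum_mono) auto
    also have "\<dots> = root_count f (\<Union>z\<in>Z. b z) w"
    proof (rule root_count_UNION[OF deg fin, symmetric])
      fix i j assume "i \<in> Z" "j \<in> Z" "i \<noteq> j"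
      thus "b i \<inter> b j = {}" using r1(2)[of i j] unfolding b_def by auto
    qed
    also have "\<dots> \<le> root_count f T w"
      using rr by (intro root_count_mono[OF deg]) (fastforce simp: b_def)
    finally show ?case .
  qed
qed

section \<open>Half-open arcs going to infinity\<close>

lemma connected_open_puncture_iff:
  fixes S :: "'a::euclidean_space set"
  assumes "open S" "2 \<le> DIM('a)"
  shows "connected (S - {a}) \<longleftrightarrow> connected S"
proof
  assume c: "connected (S - {a})"
  show "connected S"
  proof (cases "a \<in> S")
    case True
    hence "a islimpt S" using assms(1) by (simp add: interior_limit_point interior_open)
    hence "a \<in> closure (S - {a})" by (simp add: islimpt_in_closure)
    hence "S \<subseteq> closure (S - {a})" using closure_subset[of "S - {a}"] by blast
    thus ?thesis using connected_intermediate_closure[OF c] by blast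
  qed (use c in simp)
qed (use connected_open_delete assms in blast)

text \<open>Inversion exchanges \<open>z0\<close> with infinity. Infinity reappears as the added
  point 0, while \<open>z0\<close> is removed from the complement of \<open>Y\<close>, which does
  not affect connectedness of this open set. For a ray the inverted set is compact, so theorems on
  plane arcs and Jordan curves apply.\<close>

lemma connected_complement_inversion:
  fixes Y :: "complex set"
  assumes "closed Y" "z0 \<notin> Y"
  shows "connected (- Y) \<longleftrightarrow> connected (- insert 0 ((\<lambda>z. inverse (z - z0)) ` Y))"
proof -
  define h where "h z = inverse (z - z0)" for z
  define k where "k u = z0 + inverse u" for u
  have hk: "h (k u) = u" for u by (simp add: h_def k_def)
  have kh: "k (h z) = z" for z by (simp add: h_def k_def)
  have im: "h ` (- Y - {z0}) = - insert 0 (h ` Y)"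
  proof (intro equalityI subsetI)
    fix u assume "u \<in> h ` (- Y - {z0})"
    then obtain z where z: "z \<notin> Y" "z \<noteq> z0" "u = h z" by auto
    hence "u \<noteq> 0" by (simp add: h_def)
    moreover have "u \<notin> h ` Y" using z kh by (metis imageE)
    ultimately show "u \<in> - insert 0 (h ` Y)" by simp
  next
    fix u assume u: "u \<in> - insert 0 (h ` Y)"
    have "k u \<noteq> z0" using u by (auto simp: k_def)
    moreover have "k u \<notin> Y" using u hk by (metis ComplD imageI insertI2)
    ultimately show "u \<in> h ` (- Y - {z0})" using hk by (intro image_eqI[of _ _ "k u"]) auto
  qed
  have im': "k ` (- insert 0 (h ` Y)) = - Y - {z0}"
    unfolding im[symmetric] image_image kh by simp
  have "continuous_on (- Y - {z0}) h"
    unfolding h_def by (intro continuous_intros) auto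
  hence 1: "connected (- Y - {z0}) \<Longrightarrow> connected (- insert 0 (h ` Y))"
    using connected_continuous_image im by metis
  have "continuous_on (- insert 0 (h ` Y)) k"
    unfolding k_def by (intro continuous_intros) auto
  hence 2: "connected (- insert 0 (h ` Y)) \<Longrightarrow> connected (- Y - {z0})"
    using connected_continuous_image im' by metis
  have "connected (- Y - {z0}) \<longleftrightarrow> connected (- Y)"
    using assms by (intro connected_open_puncture_iff) auto
  with 1 2 show ?thesis unfolding h_def by blast
qed

text \<open>The parameter models the radius R of an external ray: the end at 1 lands, the other end
  escapes. With infinity added, ray and landing point form an arc in the sphere.\<close>

definition landing_ray :: "(real \<Rightarrow> complex) \<Rightarrow> complex \<Rightarrow> bool" where
  "landing_ray r p \<longleftrightarrow> continuous_on {1<..} r \<and> inj_on r {1<..} \<and> p \<notin> r ` {1<..} \<and>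
     (r \<longlongrightarrow> p) (at_right 1) \<and> filterlim r at_infinity at_top"

lemma landing_ray_inverted_arc:
  assumes r: "landing_ray r p" and z0: "z0 \<notin> insert p (r ` {1<..})"
  obtains c where "arc c" "pathstart c = 0" "pathfinish c = inverse (p - z0)"
    "path_image c = insert 0 ((\<lambda>z. inverse (z - z0)) ` insert p (r ` {1<..}))"
proof -
  define h where "h z = inverse (z - z0)" for z
  have hinj: "inj h" by (auto simp: inj_def h_def)
  \<comment> \<open>The inverse of the radius runs through the unit interval; the values at 0 and 1
    are the limits there, the images of infinity and of \<open>p\<close>.\<close>
  define c where "c t = (if t = 0 then 0 else if t = 1 then h p else h (r (inverse t)))" for t :: real
  have cont: "continuous_on {0<..<1} c"
  proof -
    have "continuous_on {0<..<1} (\<lambda>t. h (r (inverse t)))"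
    proof -
      have inv: "inverse t \<in> {1<..}" if "t \<in> {0<..<1}" for t :: real
        using that by (simp add: one_less_inverse_iff)
      have "continuous_on {0<..<1} (\<lambda>t::real. inverse t)" by (intro continuous_intros) auto
      hence "continuous_on {0<..<1} (\<lambda>t. r (inverse t))"
        by (rule continuous_on_compose2[rotated, of _ _ "{1<..}" r]) (use r inv in \<open>auto simp: landing_ray_def\<close>)
      moreover have "r (inverse t) - z0 \<noteq> 0" if "t \<in> {0<..<1}" for t
        using inv[OF that] z0 by auto
      ultimately show ?thesis unfolding h_def by (intro continuous_intros) auto
    qed
    thus ?thesis by (rule continuous_on_eq) (auto simp: c_def)
  qed
  have at0: "(c \<longlongrightarrow> c 0) (at_right 0)"
  proof -
    have "filterlim (\<lambda>t. r (inverse t)) at_infinity (at_right (0::real))"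
      by (rule filterlim_compose[OF _ filterlim_inverse_at_top_right]) (use r in \<open>simp add: landing_ray_def\<close>)
    hence "filterlim (\<lambda>t. - z0 + r (inverse t)) at_infinity (at_right (0::real))"
      by (intro tendsto_add_filterlim_at_infinity[of _ "-z0"]) auto
    hence "((\<lambda>t. h (r (inverse t))) \<longlongrightarrow> 0) (at_right 0)"
      unfolding h_def using filterlim_compose[OF tendsto_inverse_0] by (simp add: algebra_simps)
    moreover have "\<forall>\<^sub>F t in at_right (0::real). c t = h (r (inverse t))"
      using eventually_at_right_real[of 0 1]
      by (auto elim!: eventually_mono simp: c_def)
    ultimately show ?thesis by (simp add: c_def tendsto_cong)
  qed
  have at1: "(c \<longlongrightarrow> c 1) (at_left 1)"
  proof -
    have "filterlim inverse (at_right 1) (at_left (1::real))"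
      unfolding filterlim_at
    proof
      have "(inverse \<longlongrightarrow> inverse 1) (at_left (1::real))" by (intro tendsto_intros) auto
      thus "(inverse \<longlongrightarrow> 1) (at_left (1::real))" by simp
      show "\<forall>\<^sub>F t in at_left (1::real). inverse t \<in> {1<..} \<and> inverse t \<noteq> 1"
        using eventually_at_left_real[of 0 1]
        by (auto elim!: eventually_mono simp: one_less_inverse_iff)
    qed
    hence "((\<lambda>t. r (inverse t)) \<longlongrightarrow> p) (at_left 1)"
      by (rule filterlim_compose[rotated]) (use r in \<open>simp add: landing_ray_def\<close>)
    hence "((\<lambda>t. h (r (inverse t))) \<longlongrightarrow> h p) (at_left 1)"
      unfolding h_def using z0 by (intro tendsto_intros) auto
    moreover have "\<forall>\<^sub>F t in at_left (1::real). c t = h (r (inverse t))"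
      using eventually_at_left_real[of 0 1]
      by (auto elim!: eventually_mono simp: c_def)
    ultimately show ?thesis by (simp add: c_def tendsto_cong)
  qed
  have path: "path c"
    unfolding path_def
  proof (rule continuous_on_IccI[OF at0 at1])
    fix x :: real assume "0 < x" "x < 1"
    thus "c \<midarrow>x\<rightarrow> c x" using cont by (simp add: continuous_on_eq_continuous_at isContD)
  qed simp
  have rimg: "(\<lambda>t. r (inverse t)) ` {0<..<1} = r ` {1<..}"
  proof -
    have "inverse ` {0<..<1::real} = {1<..}"
    proof (intro equalityI subsetI)
      fix x :: real assume "x \<in> {1<..}"
      thus "x \<in> inverse ` {0<..<1}" by (intro image_eqI[of _ _ "inverse x"]) (auto simp: inverse_less_1_iff)
    qed (auto simp: one_less_inverse_iff)
    thus ?thesis by (metis image_image)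
  qed
  have img: "path_image c = insert 0 (h ` insert p (r ` {1<..}))"
  proof -
    have "{0..1} = insert 0 (insert 1 {0<..<1::real})" by auto
    hence "path_image c = insert (c 0) (insert (c 1) (c ` {0<..<1}))"
      by (simp add: path_image_def)
    also have "c ` {0<..<1} = h ` (\<lambda>t. r (inverse t)) ` {0<..<1}"
      unfolding image_image by (intro image_cong) (auto simp: c_def)
    also have "c 0 = 0" by (simp add: c_def)
    also have "c 1 = h p" by (simp add: c_def)
    finally show ?thesis unfolding rimg by simp
  qed
  have inj: "inj_on c {0..1}"
  proof (rule inj_onI)
    fix s t :: real assume st: "s \<in> {0..1}" "t \<in> {0..1}" "c s = c t"
    have nz: "h p \<noteq> 0" "\<And>u. u \<in> r ` {1<..} \<Longrightarrow> h u \<noteq> 0" using z0 by (auto simp: h_def)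
    have ri: "r (inverse u) \<in> r ` {1<..}" if "u \<in> {0..1}" "u \<noteq> 0" "u \<noteq> 1" for u :: real
      using that by (auto simp: one_less_inverse_iff)
    have pr: "h p \<noteq> h (r (inverse u))" if "u \<in> {0..1}" "u \<noteq> 0" "u \<noteq> 1" for u :: real
      using ri[OF that] r hinj unfolding landing_ray_def by (metis injD)
    consider "s = 0" | "s = 1" | "s \<noteq> 0" "s \<noteq> 1" by blast
    thus "s = t"
    proof cases
      case 1
      thus ?thesis using st nz ri by (auto simp: c_def split: if_splits)
    next
      case 2
      thus ?thesis using st nz pr[of t] by (auto simp: c_def split: if_splits)
    next
      case 3
      have tn: "t \<noteq> 0" "t \<noteq> 1" using 3 st nz(2)[OF ri[of s]] pr[of s] nz by (auto simp: c_def split: if_splits)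
      hence "r (inverse s) = r (inverse t)" using 3 st hinj by (simp add: c_def inj_eq)
      moreover have "inverse s \<in> {1<..}" "inverse t \<in> {1<..}"
        using 3 tn st by (auto simp: one_less_inverse_iff)
      ultimately have "inverse s = inverse t" using r unfolding landing_ray_def by (meson inj_onD)
      thus ?thesis by simp
    qed
  qed
  show thesis
    by (rule that[of c]) (use path inj img in \<open>auto simp: arc_def pathstart_def pathfinish_def c_def h_def\<close>)
qed

text \<open>The inverted arc is bounded by some \<open>B\<close>, so no point of the ray is closer
  to \<open>z0\<close> than 1/B.\<close>

lemma closed_landing_ray:
  assumes r: "landing_ray r p"
  shows "closed (insert p (r ` {1<..}))"
  unfolding closed_def
proof (rule openI)
  fix z0 assume "z0 \<in> - insert p (r ` {1<..})"
  hence z0: "z0 \<notin> insert p (r ` {1<..})" by blast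
  obtain c where c: "arc c" "path_image c = insert 0 ((\<lambda>z. inverse (z - z0)) ` insert p (r ` {1<..}))"
    using landing_ray_inverted_arc[OF r z0] by metis
  obtain B where B: "B > 0" "\<And>x. x \<in> path_image c \<Longrightarrow> norm x \<le> B"
    using bounded_arc_image[OF c(1)] by (meson bounded_pos)
  have "inverse B \<le> dist z0 y" if y: "y \<in> insert p (r ` {1<..})" for y
  proof -
    have "y \<noteq> z0" using y z0 by blast
    moreover have "norm (inverse (y - z0)) \<le> B" using y by (intro B(2)) (auto simp: c(2))
    ultimately show ?thesis
      using B(1) by (simp add: norm_inverse dist_norm norm_minus_commute divide_simps norm_divide mult.commute split: if_splits)
  qed
  hence "ball z0 (inverse B) \<subseteq> - insert p (r ` {1<..})" by (metis ComplI mem_ball not_less subsetI)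
  thus "\<exists>e>0. ball z0 e \<subseteq> - insert p (r ` {1<..})"
    using B(1) by (intro exI[of _ "inverse B"]) auto
qed

lemma connected_landing_ray:
  assumes "landing_ray r q"
  shows "connected (insert q (r ` {1<..}))"
proof (rule connected_intermediate_closure)
  show "connected (r ` {1<..})"
    using assms by (intro connected_continuous_image) (auto simp: landing_ray_def)
  have "q \<in> closure (r ` {1<..})"
  proof (rule Lim_in_closed_set[OF closed_closure])
    show "(r \<longlongrightarrow> q) (at_right 1)" using assms by (simp add: landing_ray_def)
    have "\<forall>\<^sub>F t in at_right (1::real). t \<in> {1<..<2}" by (intro eventually_at_right_real) simp
    thus "\<forall>\<^sub>F t in at_right 1. r t \<in> closure (r ` {1<..})"
      by eventually_elim (intro subsetD[OF closure_subset], auto)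
  qed simp
  thus "insert q (r ` {1<..}) \<subseteq> closure (r ` {1<..})" by (simp add: closure_subset)
qed auto

lemma landing_rays_same_point_separate:
  assumes r: "landing_ray r p" and s: "landing_ray s p"
    and disj: "r ` {1<..} \<inter> s ` {1<..} = {}" and z0: "z0 \<notin> insert p (r ` {1<..} \<union> s ` {1<..})"
  shows "\<not> connected (- insert p (r ` {1<..} \<union> s ` {1<..}))"
proof -
  let ?R = "insert p (r ` {1<..})" and ?S = "insert p (s ` {1<..})"
  define h where "h z = inverse (z - z0)" for z
  have hinj: "inj h" by (auto simp: inj_def h_def)
  obtain c where c: "arc c" "pathstart c = 0" "pathfinish c = h p" "path_image c = insert 0 (h ` ?R)"
    using landing_ray_inverted_arc[OF r, of z0] z0 unfolding h_def by blast
  obtain e where e: "arc e" "pathstart e = 0" "pathfinish e = h p" "path_image e = insert 0 (h ` ?S)"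
    using landing_ray_inverted_arc[OF s, of z0] z0 unfolding h_def by blast
  have "h ` ?R \<inter> h ` ?S = h ` (?R \<inter> ?S)" by (rule image_Int[OF hinj, symmetric])
  also have "?R \<inter> ?S = {p}" using disj r s by (auto simp: landing_ray_def)
  finally have int: "path_image c \<inter> path_image e \<subseteq> {0, h p}" unfolding c e by auto
  have "simple_path (c +++ reversepath e)"
    using int by (intro simple_path_join_loop) (use c e in \<open>auto simp: arc_reversepath\<close>)
  hence "\<not> connected (- path_image (c +++ reversepath e))"
    by (rule Jordan_disconnected) (simp add: c e)
  also have "path_image (c +++ reversepath e) = insert 0 (h ` ?R) \<union> insert 0 (h ` ?S)"
    using c e by (subst path_image_join) auto
  also have "\<dots> = insert 0 (h ` insert p (r ` {1<..} \<union> s ` {1<..}))" by auto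
  finally show ?thesis
    using connected_complement_inversion[of "insert p (r ` {1<..} \<union> s ` {1<..})" z0] z0
      closed_Un[OF closed_landing_ray[OF r] closed_landing_ray[OF s]]
    unfolding h_def by (simp add: Un_insert_left Un_insert_right)
qed

text \<open>After inversion the two arcs meet only in 0, the image of infinity. Reversing one and
  joining gives a single arc, which does not separate the plane.\<close>

lemma landing_rays_distinct_points_connected:
  assumes r: "landing_ray r p" and s: "landing_ray s q"
    and disj: "insert p (r ` {1<..}) \<inter> insert q (s ` {1<..}) = {}"
    and z0: "z0 \<notin> insert p (r ` {1<..}) \<union> insert q (s ` {1<..})"
  shows "connected (- (insert p (r ` {1<..}) \<union> insert q (s ` {1<..})))"
proof -
  let ?R = "insert p (r ` {1<..})" and ?S = "insert q (s ` {1<..})"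
  define h where "h z = inverse (z - z0)" for z
  have hinj: "inj h" by (auto simp: inj_def h_def)
  obtain c where c: "arc c" "pathstart c = 0" "pathfinish c = h p" "path_image c = insert 0 (h ` ?R)"
    using landing_ray_inverted_arc[OF r, of z0] z0 unfolding h_def by blast
  obtain e where e: "arc e" "pathstart e = 0" "pathfinish e = h q" "path_image e = insert 0 (h ` ?S)"
    using landing_ray_inverted_arc[OF s, of z0] z0 unfolding h_def by blast
  have "h ` ?R \<inter> h ` ?S = h ` (?R \<inter> ?S)" by (rule image_Int[OF hinj, symmetric])
  also have "\<dots> = {}" using disj by simp
  finally have int: "path_image c \<inter> path_image e \<subseteq> {0}" unfolding c e by auto
  have "arc (reversepath c +++ e)"
    using int by (intro arc_join) (use c e in \<open>auto simp: arc_reversepath\<close>)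
  hence "connected (- path_image (reversepath c +++ e))"
    by (rule connected_arc_complement) simp
  also have "path_image (reversepath c +++ e) = insert 0 (h ` ?R) \<union> insert 0 (h ` ?S)"
    using c e by (subst path_image_join) auto
  also have "\<dots> = insert 0 (h ` (?R \<union> ?S))" by auto
  finally show ?thesis
    using connected_complement_inversion[of "?R \<union> ?S" z0] z0
      closed_Un[OF closed_landing_ray[OF r] closed_landing_ray[OF s]]
    unfolding h_def by blast
qed

text \<open>Off a finite frontier the plane is connected, so \<open>C\<close> would be everything
  except its frontier, hence unbounded.\<close>

lemma bounded_open_infinite_frontier:
  fixes C :: "complex set"
  assumes "open C" "bounded C" "C \<noteq> {}"
  shows "infinite (frontier C)"
proof
  assume fin: "finite (frontier C)"
  have con: "connected (- frontier C)"
    unfolding Compl_eq_Diff_UNIV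
    by (rule connected_open_diff_countable) (use countable_finite[OF fin] in auto)
  have "C \<subseteq> - frontier C" using assms(1) by (auto simp: frontier_def interior_open)
  hence "- frontier C \<subseteq> C"
    using connected_Int_frontier[OF con, of C] assms(3) by blast
  hence "bounded (- frontier C)" using assms(2) bounded_subset by blast
  moreover have "bounded (frontier C)" using fin by (rule finite_imp_bounded)
  ultimately have "bounded (UNIV :: complex set)"
    by (metis Compl_partition2 bounded_Un)
  thus False by simp
qed

text \<open>Applied with \<open>B\<close> a basin and \<open>Y\<close> a union of rays that leaves
  it only at the landing point. A component missing \<open>B\<close> would be bounded with finite
  frontier; so every component is visible in the basin, where angles are available.\<close>

lemma component_meets_cobounded:
  fixes B Y :: "complex set"
  assumes "closed Y" "open B" "bounded (- B)" "finite (Y - B)" "C \<in> components (- Y)"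
  shows "C \<inter> B \<noteq> {}"
proof
  assume CB: "C \<inter> B = {}"
  have "open C" "C \<noteq> {}"
    using assms(1,5) open_components[of "- Y" C] in_components_nonempty[of C] by auto
  moreover have "bounded C" using CB assms(3) by (meson bounded_subset disjoint_eq_subset_Compl)
  moreover have "finite (frontier C)"
  proof (rule finite_subset[OF _ assms(4)])
    have "frontier C \<subseteq> Y" using frontier_of_components_closed_complement assms by blast
    moreover have "closure C \<inter> B = {}" using CB assms(2) by (simp add: open_Int_closure_eq_empty Int_commute)
    ultimately show "frontier C \<subseteq> Y - B" by (auto simp: frontier_def)
  qed
  ultimately show False using bounded_open_infinite_frontier by blast
qed

section \<open>Preimages under a polynomial\<close>

lemma continuous_on_poly [continuous_intros]: "continuous_on S (poly (f :: complex poly))"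
  by (intro continuous_at_imp_continuous_on) auto

lemma holomorphic_on_poly: "poly f holomorphic_on S"
  using poly_holomorphic_on[OF holomorphic_on_ident, of f S] by simp

lemma open_vimage_poly: "open T \<Longrightarrow> open (poly (f :: complex poly) -` T)"
  by (rule open_vimage[OF _ continuous_on_poly])

lemma deriv_poly: "deriv (poly f) z = poly (pderiv f) z"
  by (rule DERIV_imp_deriv[OF poly_DERIV])

text \<open>Over \<open>D\<close> the two counts add up to the degree. Neither can drop locally, so
  neither can rise, and connectedness does the rest.\<close>

lemma root_count_partition_const:
  assumes deg: "degree f > 0" and "open S" "open T" "S \<inter> T = {}"
    and D: "connected D" "poly f -` D \<subseteq> S \<union> T" and w: "w \<in> D" "w' \<in> D"
  shows "root_count f S w = root_count f S w'"
proof (rule connected_local_const[OF D(1) w])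
  have sum: "root_count f S y + root_count f T y = degree f" if "y \<in> D" for y
  proof -
    have "{z \<in> S \<union> T. poly f z = y} = {z \<in> UNIV. poly f z = y}" using D(2) that by auto
    hence "root_count f (S \<union> T) y = root_count f UNIV y" by (simp add: root_count_def)
    thus ?thesis using root_count_Un[OF deg assms(4)] root_count_UNIV[OF deg] by simp
  qed
  show "\<forall>x\<in>D. \<forall>\<^sub>F y in at x within D. root_count f S x = root_count f S y"
  proof
    fix x assume x: "x \<in> D"
    have "\<forall>\<^sub>F y in nhds x. y \<in> D \<longrightarrow> root_count f S x = root_count f S y"
      using root_count_lsc[OF deg assms(2), of x] root_count_lsc[OF deg assms(3), of x]
    proof eventually_elim
      case (elim y)
      thus ?case using sum[OF x] sum[of y] by auto
    qed
    thus "\<forall>\<^sub>F y in at x within D. root_count f S x = root_count f S y"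
      by (auto simp: eventually_at_filter elim: eventually_mono)
  qed
qed

text \<open>With no critical points and a constant number of roots in \<open>W\<close>,
  \<open>f\<close> is a covering of \<open>S\<close> by \<open>W\<close>. As \<open>S\<close> is
  simply connected, the identity of \<open>S\<close> lifts to a section, which uniqueness of lifts
  turns into a left inverse of \<open>f\<close> on the connected set \<open>W\<close>.\<close>

lemma poly_component_simply_connected_injective:
  assumes deg: "degree f > 0" and S: "open S" "simply_connected S"
    and W: "W \<in> components (poly f -` S)"
    and nc: "\<And>z. z \<in> W \<Longrightarrow> \<not> critical_point f z"
  shows "inj_on (poly f) W" "poly f ` W = S"
proof -
  \<comment> \<open>The other components of the preimage form the complementary open set for
    \<open>root_count_partition_const\<close>.\<close>
  define V where "V = poly f -` S - W"
  have oW: "open W" using W open_vimage_poly[OF S(1)] open_components by blast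
  have WS: "W \<subseteq> poly f -` S" using W in_components_subset by blast
  have Wne: "W \<noteq> {}" using W in_components_nonempty by blast
  have cW: "connected W" using W in_components_connected by blast
  have oV: "open V"
  proof -
    have "V = \<Union>(components (poly f -` S) - {W})"
      unfolding V_def using W by (rule in_components_unions_complement)
    thus ?thesis using open_vimage_poly[OF S(1)] open_components by (auto intro!: open_Union)
  qed
  have cS: "connected S" using S(2) simply_connected_imp_connected by blast
  obtain w0 where w0: "w0 \<in> W" using Wne by blast
  have const: "root_count f W y = root_count f W (poly f w0)" if "y \<in> S" for y
    using root_count_partition_const[OF deg oW oV _ cS _ that, of "poly f w0"] w0 WS
    unfolding V_def by blast
  have cnt: "root_count f W y = card {z\<in>W. poly f z = y}" for y
    by (rule root_count_eq_card[OF deg]) (use nc in blast)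
  show surj: "poly f ` W = S"
  proof
    show "poly f ` W \<subseteq> S" using WS by blast
    show "S \<subseteq> poly f ` W"
    proof
      fix y assume "y \<in> S"
      have "root_count f W (poly f w0) \<noteq> 0" using w0 by (subst root_count_eq_0_iff[OF deg]) auto
      hence "root_count f W y \<noteq> 0" using const[OF \<open>y \<in> S\<close>] by simp
      thus "y \<in> poly f ` W" by (simp add: root_count_eq_0_iff[OF deg])
    qed
  qed
  have cov: "covering_space W (poly f) S"
  proof
    show "continuous_on W (poly f)" by (rule continuous_on_poly)
    show "poly f ` W = S" by (rule surj)
    fix x assume x: "x \<in> S"
    define Z where "Z = {z\<in>W. poly f z = x}"
    have finZ: "finite Z" unfolding Z_def by (rule finite_poly_fibre_on[OF deg])
    obtain r1 where r1: "r1 > 0" "\<And>x y. x \<in> Z \<Longrightarrow> y \<in> Z \<Longrightarrow> x \<noteq> y \<Longrightarrow> ball x r1 \<inter> ball y r1 = {}"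
      using finite_disjoint_balls[OF finZ] by metis
    have "\<exists>r>0. ball z r \<subseteq> W \<and> inj_on (poly f) (ball z r)" if "z \<in> Z" for z
    proof -
      have "z \<in> W" "deriv (poly f) z \<noteq> 0"
        using that nc by (auto simp: Z_def deriv_poly critical_point_def)
      thus ?thesis
        using has_complex_derivative_locally_injective[OF holomorphic_on_poly, of z W f] oW by metis
    qed
    then obtain rr where rr: "\<And>z. z \<in> Z \<Longrightarrow> rr z > 0 \<and> ball z (rr z) \<subseteq> W \<and> inj_on (poly f) (ball z (rr z))"
      by metis
    define b where "b z = ball z (min r1 (rr z))" for z
    have b: "z \<in> b z" "b z \<subseteq> W" "inj_on (poly f) (b z)" "open (b z)" if "z \<in> Z" for z
      using rr[OF that] r1(1) by (auto simp: b_def intro: inj_on_subset)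
    have bdisj: "b y \<inter> b z = {}" if "y \<in> Z" "z \<in> Z" "y \<noteq> z" for y z
      using r1(2)[OF that] by (auto simp: b_def)
    \<comment> \<open>Over the common image of the discs each disc supplies one root. As the count
      is that over \<open>x\<close>, \<open>W\<close> contains no further root.\<close>
    define T where "T = S \<inter> (\<Inter>z\<in>Z. poly f ` b z)"
    have "open (poly f ` b z)" if "z \<in> Z" for z
      by (rule open_mapping_thm3) (use b[OF that] in \<open>auto simp: holomorphic_on_poly\<close>)
    hence oT: "open T" unfolding T_def using S(1) finZ by (intro open_Int open_INT) auto
    have xT: "x \<in> T" unfolding T_def using x b(1) by (auto simp: Z_def)
    define v where "v = (\<lambda>z. b z \<inter> poly f -` T) ` Z"
    have "W \<inter> poly f -` T \<subseteq> \<Union>v"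
    proof
      fix u assume u: "u \<in> W \<inter> poly f -` T"
      define y where "y = poly f u"
      have "\<forall>z\<in>Z. \<exists>u'\<in>b z. poly f u' = y" using u unfolding y_def T_def by force
      then obtain g where g: "\<And>z. z \<in> Z \<Longrightarrow> g z \<in> b z \<and> poly f (g z) = y" by metis
      have ginj: "inj_on g Z" by (rule inj_onI) (metis bdisj g disjoint_iff)
      have gsub: "g ` Z \<subseteq> {z\<in>W. poly f z = y}" using g b(2) by blast
      have "y \<in> S" using u by (simp add: y_def T_def)
      hence "card {z\<in>W. poly f z = y} = card Z"
        using const[OF x] const[of y] unfolding Z_def cnt[symmetric] by simp
      hence "g ` Z = {z\<in>W. poly f z = y}"
        using gsub ginj finite_poly_fibre_on[OF deg, of W y] by (intro card_subset_eq) (auto simp: card_image)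
      moreover have "u \<in> {z\<in>W. poly f z = y}" using u by (simp add: y_def)
      ultimately obtain z where "z \<in> Z" "u = g z" by blast
      thus "u \<in> \<Union>v" using g u unfolding v_def by auto
    qed
    hence Uv: "\<Union>v = W \<inter> poly f -` T" using b(2) unfolding v_def by blast
    have ov: "open u" if "u \<in> v" for u
      using that b(4) open_vimage_poly[OF oT] unfolding v_def by auto
    have "\<exists>q. homeomorphism u T (poly f) q" if uv: "u \<in> v" for u
    proof -
      obtain z where z: "z \<in> Z" "u = b z \<inter> poly f -` T" using uv unfolding v_def by blast
      have "poly f ` u = T" using z unfolding T_def by blast
      moreover have "inj_on (poly f) u" using z b(3) by (metis inf_le1 inj_on_subset)
      ultimately show ?thesis
        using invariance_of_domain_homeomorphism[OF ov[OF uv] continuous_on_poly, of f] by auto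
    qed
    moreover have "pairwise disjnt v"
      unfolding v_def pairwise_image by (auto simp: pairwise_def disjnt_def) (use bdisj in blast)+
    moreover have "\<forall>u\<in>v. openin (top_of_set W) u"
      using ov Uv by (auto intro!: open_subset)
    moreover have "openin (top_of_set S) T" by (rule open_subset) (use oT in \<open>auto simp: T_def\<close>)
    ultimately show "\<exists>T. x \<in> T \<and> openin (top_of_set S) T \<and> (\<exists>v. \<Union> v = W \<inter> poly f -` T \<and>
        (\<forall>u\<in>v. openin (top_of_set W) u) \<and> pairwise disjnt v \<and> (\<forall>u\<in>v. \<exists>q. homeomorphism u T (poly f) q))"
      using xT Uv by blast
  qed
  have fw0: "poly f w0 \<in> S" using w0 surj by blast
  obtain g where g: "continuous_on S g" "g \<in> S \<rightarrow> W" "g (poly f w0) = w0" "\<And>y. y \<in> S \<Longrightarrow> poly f (g y) = y"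
    using covering_space_lift_strong[OF cov w0 fw0 S(2) open_imp_locally_path_connected[OF S(1)], of "\<lambda>x. x"]
    by auto
  \<comment> \<open>Both \<open>g \<circ> poly f\<close> and \<open>id\<close> lift
    \<open>poly f\<close> along the covering, and they agree at \<open>w0\<close>.\<close>
  have "(g \<circ> poly f) z = id z" if "z \<in> W" for z
  proof (rule covering_space_lift_unique[OF cov, of "g \<circ> poly f" w0 id W "poly f"])
    show "(g \<circ> poly f) w0 = id w0" using g by simp
    show "continuous_on W (g \<circ> poly f)"
      using g(1) surj by (intro continuous_on_compose continuous_on_poly) auto
    show "g \<circ> poly f \<in> W \<rightarrow> W" using g(2) surj by auto
    show "poly f x = poly f ((g \<circ> poly f) x)" if "x \<in> W" for x
      using g(4) surj that by auto
  qed (use surj that w0 cW continuous_on_poly in auto)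
  thus "inj_on (poly f) W" by (intro inj_on_inverseI[of _ g]) auto
qed

text \<open>Discs about the roots over \<open>w0\<close> carry the full degree there, hence at least
  the degree nearby, which leaves no root outside them.\<close>

lemma eventually_preimages_near_roots:
  fixes f :: "complex poly"
  assumes deg: "degree f > 0" and "e > 0"
  shows "\<forall>\<^sub>F w in nhds w0. poly f -` {w} \<subseteq> (\<Union>q\<in>{q. poly f q = w0}. ball q e)"
proof -
  define T where "T = (\<Union>q\<in>{q. poly f q = w0}. ball q e)"
  have "{z\<in>T. poly f z = w0} = {z\<in>UNIV. poly f z = w0}" using \<open>e > 0\<close> by (force simp: T_def)
  hence "root_count f T w0 = degree f"
    using root_count_UNIV[OF deg, of w0] by (simp add: root_count_def)
  hence "\<forall>\<^sub>F w in nhds w0. degree f \<le> root_count f T w"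
    using root_count_lsc[OF deg, of T w0] by (auto simp: T_def)
  thus ?thesis
    unfolding T_def[symmetric]
  proof eventually_elim
    case (elim w)
    have "root_count f T w + root_count f (- T) w = degree f"
      using root_count_Un[OF deg, of T "- T" w] root_count_UNIV[OF deg] by simp
    hence "root_count f (- T) w = 0" using elim by simp
    hence "w \<notin> poly f ` (- T)" by (simp add: root_count_eq_0_iff[OF deg])
    thus ?case by blast
  qed
qed

text \<open>Near its end \<open>r\<close> stays in disjoint small discs about the finitely many
  roots over \<open>w0\<close>; being connected, this part of \<open>r\<close> stays in a single
  disc.\<close>

lemma preimage_ray_lands:
  fixes f :: "complex poly"
  assumes deg: "degree f > 0" and cont: "continuous_on {1<..} r"
    and lim: "((\<lambda>t. poly f (r t)) \<longlongrightarrow> w0) (at_right (1::real))"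
  obtains q where "poly f q = w0" "(r \<longlongrightarrow> q) (at_right 1)"
proof -
  define Z where "Z = {q. poly f q = w0}"
  have fin: "finite Z" unfolding Z_def by (rule finite_poly_fibre[OF deg])
  have ev: "\<forall>\<^sub>F t in at_right 1. r t \<in> (\<Union>q\<in>Z. ball q e)" if "e > 0" for e
    using filterlim_iff[THEN iffD1, OF lim, rule_format, OF eventually_preimages_near_roots[OF deg that]]
    unfolding Z_def by eventually_elim (meson subsetD vimage_singleton_eq)
  obtain e where e: "e > 0" "\<And>x y. x \<in> Z \<Longrightarrow> y \<in> Z \<Longrightarrow> x \<noteq> y \<Longrightarrow> ball x e \<inter> ball y e = {}"
    using finite_disjoint_balls[OF fin] by metis
  obtain b where b: "b > 1" "\<And>t. 1 < t \<Longrightarrow> t < b \<Longrightarrow> r t \<in> (\<Union>q\<in>Z. ball q e)"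
    using ev[OF e(1)] unfolding eventually_at_right_field by blast
  have "r ((1 + b) / 2) \<in> (\<Union>q\<in>Z. ball q e)" using b(1) by (intro b(2)) auto
  then obtain q where q: "q \<in> Z" "r ((1 + b) / 2) \<in> ball q e" by blast
  have inq: "r t \<in> ball q e" if "1 < t" "t < b" for t
  proof -
    have con: "connected (r ` {1<..<b})"
      by (intro connected_continuous_image continuous_on_subset[OF cont]) auto
    have "ball q e \<inter> r ` {1<..<b} = {} \<or> (\<Union>q'\<in>Z - {q}. ball q' e) \<inter> r ` {1<..<b} = {}"
    proof (rule connectedD[OF con])
      show "ball q e \<inter> (\<Union>q'\<in>Z - {q}. ball q' e) \<inter> r ` {1<..<b} = {}"
        using e(2) q(1) by blast
      show "r ` {1<..<b} \<subseteq> ball q e \<union> (\<Union>q'\<in>Z - {q}. ball q' e)" using b(2) by fastforce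
    qed auto
    moreover have "r ((1 + b) / 2) \<in> r ` {1<..<b}" using b(1) by auto
    ultimately have "(\<Union>q'\<in>Z - {q}. ball q' e) \<inter> r ` {1<..<b} = {}" using q(2) by blast
    moreover have "r t \<in> r ` {1<..<b}" using that by auto
    ultimately show ?thesis using b(2)[OF that] by blast
  qed
  have "(r \<longlongrightarrow> q) (at_right 1)"
  proof (rule tendstoI)
    fix d :: real assume "d > 0"
    \<comment> \<open>With radius at most \<open>e\<close>, the disc that contains
      \<open>r t\<close> can only be the one about \<open>q\<close>.\<close>
    define d' where "d' = min d e"
    have "d' > 0" using \<open>d > 0\<close> e(1) by (simp add: d'_def)
    have "\<forall>\<^sub>F t in at_right 1. t \<in> {1<..<b}" using b(1) by (intro eventually_at_right_real)
    with ev[OF \<open>d' > 0\<close>] show "\<forall>\<^sub>F t in at_right 1. dist (r t) q < d"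
    proof eventually_elim
      case (elim t)
      then obtain q' where q': "q' \<in> Z" "r t \<in> ball q' d'" by blast
      hence "r t \<in> ball q' e" by (simp add: d'_def)
      moreover have "r t \<in> ball q e" using elim inq by auto
      ultimately have "q' = q" using e(2)[OF q'(1) q(1)] by blast
      thus ?case using q'(2) by (simp add: d'_def dist_commute)
    qed
  qed
  with q(1) show thesis by (intro that) (auto simp: Z_def)
qed

section \<open>Invariance of the cyclic order of accesses\<close>

text \<open>\<open>f z - f q\<close> is \<open>z - q\<close> times a function \<open>h\<close>
  without zeros, which has a logarithm \<open>L\<close> on the disc. Adding \<open>L\<close> along
  \<gamma> to a continuous logarithm of \<gamma> - q gives one for the image curve, and over a
  closed curve \<open>L\<close> contributes no increment.\<close>

lemma winding_number_injective_holomorphic: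
  assumes f: "f holomorphic_on ball q \<delta>" "inj_on f (ball q \<delta>)"
    and \<gamma>: "path \<gamma>" "pathfinish \<gamma> = pathstart \<gamma>" "path_image \<gamma> \<subseteq> ball q \<delta>" "q \<notin> path_image \<gamma>"
  shows "winding_number (f \<circ> \<gamma>) (f q) = winding_number \<gamma> q"
proof -
  let ?D = "ball q \<delta>"
  have q: "q \<in> ?D"
    using \<gamma>(3) path_image_nonempty[of \<gamma>] by (metis ball_eq_empty centre_in_ball not_le subset_empty)
  define h where "h z = (if z = q then deriv f q else (f z - f q) / (z - q))" for z
  have hh: "h holomorphic_on ?D"
    using pole_theorem_open[OF f(1) open_ball, of q "\<lambda>z. f z / (z - q)"]
    unfolding h_def diff_divide_distrib by simp
  have hn: "h z \<noteq> 0" if "z \<in> ?D" for z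
    using that f(2) q holomorphic_injective_imp_regular[OF f(1) open_ball f(2) q]
    by (auto simp: h_def inj_on_def)
  obtain L where L: "L holomorphic_on ?D" "\<And>z. z \<in> ?D \<Longrightarrow> exp (L z) = h z"
    using holomorphic_logarithm_exists[OF convex_ball open_ball hh hn q] by metis
  obtain w where w: "path w" "pathfinish w - pathstart w = 2 * of_real pi * \<i> * winding_number \<gamma> q"
    "\<And>t. t \<in> {0..1} \<Longrightarrow> \<gamma> t = q + exp (w t)"
    using winding_number_as_continuous_log[OF \<gamma>(1,4)] by metis
  have im: "\<gamma> t \<in> ?D" if "t \<in> {0..1}" for t
    using \<gamma>(3) that unfolding path_image_def by blast
  define W where "W t = w t + L (\<gamma> t)" for t
  have ft: "(f \<circ> \<gamma>) t = f q + exp (W t)" if "t \<in> {0..1}" for t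
  proof -
    have "exp (W t) = (\<gamma> t - q) * h (\<gamma> t)"
      using w(3)[OF that] L(2)[OF im[OF that]] by (simp add: W_def exp_add)
    moreover have "\<gamma> t \<noteq> q" using w(3)[OF that] by simp
    ultimately show ?thesis by (simp add: h_def)
  qed
  have pW: "path W"
    unfolding W_def path_def
  proof (intro continuous_intros)
    show "continuous_on {0..1} w" using w(1) by (simp add: path_def)
    show "continuous_on {0..1} (\<lambda>t. L (\<gamma> t))"
      by (rule continuous_on_compose2[OF holomorphic_on_imp_continuous_on[OF L(1)]])
        (use \<gamma>(1) im in \<open>auto simp: path_def\<close>)
  qed
  have "winding_number (f \<circ> \<gamma>) (f q) = winding_number (\<lambda>t. exp (W t)) 0"
  proof -
    have "winding_number (f \<circ> \<gamma>) (f q) = winding_number (\<lambda>t. (f \<circ> \<gamma>) t - f q) 0"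
      by (rule winding_number_offset)
    also have "\<dots> = winding_number (exp \<circ> W) 0"
      by (rule winding_number_cong) (simp add: ft del: o_apply, simp)
    finally show ?thesis by (simp add: o_def)
  qed
  also have "\<dots> = (pathfinish W - pathstart W) / (2 * of_real pi * \<i>)"
    using winding_number_compose_exp[OF pW] by (simp add: o_def)
  also have "pathfinish W - pathstart W = pathfinish w - pathstart w"
    using \<gamma>(2) by (simp add: W_def pathfinish_def pathstart_def)
  finally show ?thesis using w(2) by (simp add: o_def)
qed

lemma inside_subset_ball:
  fixes S :: "'a::{real_normed_vector,perfect_space} set"
  assumes "S \<subseteq> ball q \<delta>"
  shows "inside S \<subseteq> ball q \<delta>"
proof -
  have "- ball q \<delta> \<subseteq> outside S" by (rule outside_subset_convex) (use assms in auto)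
  thus ?thesis using inside_Int_outside[of S] by blast
qed

text \<open>The image of the inside is open and bounded with frontier on the image curve. A
  component of the complement of that curve that meets it therefore cannot leave it and is
  bounded.\<close>

lemma image_inside_subset:
  assumes f: "f holomorphic_on ball q \<delta>" "inj_on f (ball q \<delta>)"
    and \<gamma>: "simple_path \<gamma>" "pathfinish \<gamma> = pathstart \<gamma>" "path_image \<gamma> \<subseteq> ball q \<delta>"
  shows "f ` inside (path_image \<gamma>) \<subseteq> inside (path_image (f \<circ> \<gamma>))"
proof -
  let ?D = "ball q \<delta>" and ?G = "inside (path_image \<gamma>)"
  note J = Jordan_inside_outside[OF \<gamma>(1,2)]
  have GD: "?G \<subseteq> ?D" by (rule inside_subset_ball[OF \<gamma>(3)])
  have cont: "continuous_on ?D f" using f(1) holomorphic_on_imp_continuous_on by blast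
  have fim: "path_image (f \<circ> \<gamma>) = f ` path_image \<gamma>" by (simp add: path_image_compose)
  have disj: "f ` ?G \<inter> f ` path_image \<gamma> = {}"
    using inj_on_image_Int[OF f(2) GD \<gamma>(3)] inside_no_overlap[of "path_image \<gamma>"] by simp
  have clG: "closure ?G = ?G \<union> path_image \<gamma>"
    using J by (metis closure_Un_frontier)
  have cmp: "compact (f ` closure ?G)"
    using J continuous_on_subset[OF cont, of "closure ?G"] GD \<gamma>(3)
    by (intro compact_continuous_image) (auto simp: clG[symmetric] compact_closure, auto simp: clG)
  have fr: "frontier (f ` ?G) \<subseteq> f ` path_image \<gamma>"
  proof -
    have "open (f ` ?G)"
      using J by (intro open_mapping_thm3) (auto intro: holomorphic_on_subset[OF f(1) GD] inj_on_subset[OF f(2) GD])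
    moreover have "closure (f ` ?G) \<subseteq> f ` closure ?G"
      using cmp by (intro closure_minimal image_mono closure_subset compact_imp_closed)
    ultimately show ?thesis unfolding frontier_def clG by (auto simp: interior_open)
  qed
  show ?thesis
  proof
    fix y assume y: "y \<in> f ` ?G"
    let ?C = "connected_component_set (- path_image (f \<circ> \<gamma>)) y"
    have yn: "y \<in> - path_image (f \<circ> \<gamma>)" using y disj fim by auto
    have "?C \<subseteq> f ` ?G"
    proof (rule ccontr)
      assume "\<not> ?C \<subseteq> f ` ?G"
      moreover have "?C \<inter> f ` ?G \<noteq> {}" using y yn by (auto intro: connected_component_refl)
      ultimately have "?C \<inter> frontier (f ` ?G) \<noteq> {}"
        by (intro connected_Int_frontier) auto
      thus False using fr fim connected_component_subset[of "- path_image (f \<circ> \<gamma>)" y] by auto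
    qed
    moreover have "bounded (f ` ?G)"
      using compact_imp_bounded[OF cmp] closure_subset by (metis bounded_subset image_mono)
    ultimately have "bounded ?C" using bounded_subset by blast
    thus "y \<in> inside (path_image (f \<circ> \<gamma>))" using yn by (auto simp: inside_def)
  qed
qed

text \<open>Stated for any injective holomorphic map so that it also applies to the local inverse;
  this gives the converse direction in the comparison of cyclic orders.\<close>

lemma ccw_around_transport:
  assumes f: "f holomorphic_on U" "inj_on f U" and U: "open U" "q \<in> U"
    and T: "T1 \<noteq> T2" "T2 \<noteq> T3" "T1 \<noteq> T3"
    and im: "f ` (S1 \<inter> U) \<subseteq> T1" "f ` (S2 \<inter> U) \<subseteq> T2" "f ` (S3 \<inter> U) \<subseteq> T3"
    and ccw: "ccw_around q S1 S2 S3"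
  shows "ccw_around (f q) T1 T2 T3"
proof -
  have "\<exists>\<gamma> t1 t2 t3.
        simple_path \<gamma> \<and> pathfinish \<gamma> = pathstart \<gamma> \<and> path_image \<gamma> \<subseteq> ball (f q) \<epsilon> \<and>
        f q \<in> inside (path_image \<gamma>) \<and> winding_number \<gamma> (f q) = 1 \<and>
        0 \<le> t1 \<and> t1 < t2 \<and> t2 < t3 \<and> t3 < 1 \<and>
        accesses \<gamma> (f q) T1 (\<gamma> t1) \<and> accesses \<gamma> (f q) T2 (\<gamma> t2) \<and> accesses \<gamma> (f q) T3 (\<gamma> t3)"
    if "\<epsilon> > 0" for \<epsilon>
  proof -
    have "isCont f q" using f(1) U holomorphic_on_imp_continuous_on continuous_on_eq_continuous_at by blast
    then obtain \<delta>1 where \<delta>1: "\<delta>1 > 0" "\<And>x. dist q x < \<delta>1 \<Longrightarrow> dist (f q) (f x) < \<epsilon>"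
      using \<open>\<epsilon> > 0\<close> unfolding continuous_at_eps_delta by (metis dist_commute)
    obtain \<delta>2 where \<delta>2: "\<delta>2 > 0" "ball q \<delta>2 \<subseteq> U" using U by (meson openE)
    define \<delta> where "\<delta> = min \<delta>1 \<delta>2"
    have \<delta>: "\<delta> > 0" "ball q \<delta> \<subseteq> U" "f ` ball q \<delta> \<subseteq> ball (f q) \<epsilon>"
      using \<delta>1 \<delta>2 by (auto simp: \<delta>_def)
    have fD: "f holomorphic_on ball q \<delta>" "inj_on f (ball q \<delta>)"
      using f \<delta>(2) by (auto intro: holomorphic_on_subset inj_on_subset)
    have cD: "continuous_on (ball q \<delta>) f" using fD(1) holomorphic_on_imp_continuous_on by blast
    obtain \<gamma> t1 t2 t3 where \<gamma>: "simple_path \<gamma>" "pathfinish \<gamma> = pathstart \<gamma>" "path_image \<gamma> \<subseteq> ball q \<delta>"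
        "q \<in> inside (path_image \<gamma>)" "winding_number \<gamma> q = 1"
      and t: "0 \<le> t1" "t1 < t2" "t2 < t3" "t3 < 1"
      and acc: "accesses \<gamma> q S1 (\<gamma> t1)" "accesses \<gamma> q S2 (\<gamma> t2)" "accesses \<gamma> q S3 (\<gamma> t3)"
      using ccw \<delta>(1) unfolding ccw_around_def by metis
    have ins: "inside (path_image \<gamma>) \<subseteq> ball q \<delta>" by (rule inside_subset_ball[OF \<gamma>(3)])
    have fins: "f ` inside (path_image \<gamma>) \<subseteq> inside (path_image (f \<circ> \<gamma>))"
      by (rule image_inside_subset[OF fD \<gamma>(1-3)])
    have qn: "q \<notin> path_image \<gamma>" using \<gamma>(4) inside_no_overlap[of "path_image \<gamma>"] by blast
    have acc': "accesses (f \<circ> \<gamma>) (f q) T ((f \<circ> \<gamma>) s)"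
      if S: "accesses \<gamma> q S (\<gamma> s)" "f ` (S \<inter> U) \<subseteq> T" and s: "0 \<le> s" "s < 1" for S T s
    proof -
      obtain \<beta> where \<beta>: "arc \<beta>" "pathstart \<beta> = q" "pathfinish \<beta> = \<gamma> s"
          "path_image \<beta> - {q} \<subseteq> S" "path_image \<beta> - {\<gamma> s} \<subseteq> inside (path_image \<gamma>)"
        using S(1) unfolding accesses_def by blast
      have gs: "\<gamma> s \<in> path_image \<gamma>" using s by (auto simp: path_image_def)
      have \<beta>D: "path_image \<beta> \<subseteq> ball q \<delta>" using \<beta>(5) ins gs \<gamma>(3) by blast
      have q\<beta>: "q \<in> path_image \<beta>" using \<beta>(2) by (metis pathstart_in_path_image)
      have s\<beta>: "\<gamma> s \<in> path_image \<beta>" using \<beta>(3) by (metis pathfinish_in_path_image)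
      have dif: "f ` path_image \<beta> - {f x} \<subseteq> f ` (path_image \<beta> - {x})" for x by blast
      show ?thesis
        unfolding accesses_def
      proof (intro exI[of _ "f \<circ> \<beta>"] conjI)
        show "arc (f \<circ> \<beta>)"
          unfolding arc_def
        proof
          show "path (f \<circ> \<beta>)"
            using \<beta>(1) by (intro path_continuous_image continuous_on_subset[OF cD \<beta>D]) (simp add: arc_def)
          show "inj_on (f \<circ> \<beta>) {0..1}"
            using \<beta>(1) \<beta>D inj_on_subset[OF fD(2)] by (intro comp_inj_on) (auto simp: arc_def path_image_def)
        qed
        show "pathstart (f \<circ> \<beta>) = f q" "pathfinish (f \<circ> \<beta>) = (f \<circ> \<gamma>) s"
          using \<beta>(2,3) by (simp_all add: pathstart_compose pathfinish_compose)
        show "path_image (f \<circ> \<beta>) - {f q} \<subseteq> T"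
          unfolding path_image_compose using dif[of q] \<beta>(4) \<beta>D \<delta>(2) S(2) by blast
        show "path_image (f \<circ> \<beta>) - {(f \<circ> \<gamma>) s} \<subseteq> inside (path_image (f \<circ> \<gamma>))"
        proof -
          have "path_image (f \<circ> \<beta>) - {(f \<circ> \<gamma>) s} \<subseteq> f ` (path_image \<beta> - {\<gamma> s})"
            using dif[of "\<gamma> s"] by (simp add: path_image_compose)
          also have "\<dots> \<subseteq> f ` inside (path_image \<gamma>)" by (rule image_mono[OF \<beta>(5)])
          finally show ?thesis using fins by (rule subset_trans)
        qed
      qed
    qed
    show ?thesis
    proof (rule exI[of _ "f \<circ> \<gamma>"], rule exI[of _ t1], rule exI[of _ t2], rule exI[of _ t3], intro conjI)
      show "simple_path (f \<circ> \<gamma>)"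
        using \<gamma>(1,3) cD fD(2) by (intro simple_path_continuous_image) (auto intro: continuous_on_subset inj_on_subset)
      show "pathfinish (f \<circ> \<gamma>) = pathstart (f \<circ> \<gamma>)" using \<gamma>(2) by (simp add: pathstart_compose pathfinish_compose)
      show "path_image (f \<circ> \<gamma>) \<subseteq> ball (f q) \<epsilon>" unfolding path_image_compose using \<gamma>(3) \<delta>(3) by blast
      show "f q \<in> inside (path_image (f \<circ> \<gamma>))" using fins \<gamma>(4) by blast
      show "winding_number (f \<circ> \<gamma>) (f q) = 1"
        using winding_number_injective_holomorphic[OF fD simple_path_imp_path[OF \<gamma>(1)] \<gamma>(2,3) qn] \<gamma>(5) by simp
      show "accesses (f \<circ> \<gamma>) (f q) T1 ((f \<circ> \<gamma>) t1)" by (rule acc'[OF acc(1) im(1)]) (use t in auto)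
      show "accesses (f \<circ> \<gamma>) (f q) T2 ((f \<circ> \<gamma>) t2)" by (rule acc'[OF acc(2) im(2)]) (use t in auto)
      show "accesses (f \<circ> \<gamma>) (f q) T3 ((f \<circ> \<gamma>) t3)" by (rule acc'[OF acc(3) im(3)]) (use t in auto)
    qed (use t in auto)
  qed
  thus ?thesis using T unfolding ccw_around_def by blast
qed

section \<open>Arcs of the circle\<close>

lemma circle_exp_eq_iff: "circle_exp s = circle_exp t \<longleftrightarrow> s - t \<in> \<int>"
proof -
  have "circle_exp s = circle_exp t \<longleftrightarrow> (\<exists>n::int. 2 * pi * s = 2 * pi * t + 2 * pi * n)"
    using sin_cos_eq_iff[of "2 * pi * s" "2 * pi * t"] by (auto simp: circle_exp_def complex_eq_iff)
  also have "\<dots> \<longleftrightarrow> (\<exists>n::int. s = t + n)"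
    by (simp flip: distrib_left)
  also have "\<dots> \<longleftrightarrow> s - t \<in> \<int>" by (auto simp: Ints_def algebra_simps)
  finally show ?thesis .
qed

lemma norm_circle_exp [simp]: "norm (circle_exp t) = 1"
  by (simp add: circle_exp_def)

lemma circle_exp_nonzero [simp]: "circle_exp t \<noteq> 0"
  by (simp add: circle_exp_def)

lemma circle_exp_power: "circle_exp t ^ n = circle_exp (real n * t)"
  unfolding circle_exp_def Complex.DeMoivre by (rule arg_cong[where f=cis]) simp

lemma continuous_on_circle_exp [continuous_intros]:
  "continuous_on S f \<Longrightarrow> continuous_on S (\<lambda>x. circle_exp (f x))"
  unfolding circle_exp_def cis_conv_exp by (intro continuous_intros)

lemma frac_eq_iff_diff_Ints: "frac x = frac y \<longleftrightarrow> x - y \<in> \<int>"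
proof
  assume "frac x = frac y"
  hence "x - y = of_int (\<lfloor>x\<rfloor> - \<lfloor>y\<rfloor>)" by (simp add: frac_def)
  thus "x - y \<in> \<int>" by (metis Ints_of_int)
next
  assume "x - y \<in> \<int>"
  then obtain n where "x = y + of_int n" by (auto elim!: Ints_cases simp: algebra_simps)
  thus "frac x = frac y" by (simp add: frac_def)
qed

lemma frac_diff_Ints: "frac x - x \<in> \<int>" "x - frac x \<in> \<int>"
  by (auto simp: frac_def)

lemma circle_exp_eq_iff_frac: "circle_exp s = circle_exp t \<longleftrightarrow> frac s = frac t"
  by (simp add: circle_exp_eq_iff frac_eq_iff_diff_Ints)

lemma circle_exp_frac [simp]: "circle_exp (frac t) = circle_exp t"
  by (simp add: circle_exp_eq_iff_frac)

lemma angle_unique: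
  assumes "s \<in> {0..<1}" "t \<in> {0..<1}" "circle_exp s = circle_exp t"
  shows "s = t"
  using assms by (simp add: circle_exp_eq_iff_frac frac_eq_id)

lemma frac_diff_explicit:
  assumes "x \<in> {0..<1}" "y \<in> {0..<1}"
  shows "frac (x - y) = (if y \<le> x then x - y else x - y + 1)"
  using assms by (auto simp: frac_unique_iff)

lemma frac_diff_gt_0:
  assumes "x \<in> {0..<1}" "y \<in> {0..<1}" "x \<noteq> y"
  shows "frac (x - y) > 0"
  unfolding frac_diff_explicit[OF assms(1,2)] using assms by auto

lemma polar_form:
  assumes "w \<noteq> 0"
  obtains t where "t \<in> {0..<1}" "w = of_real (norm w) * circle_exp t"
proof -
  define t where "t = frac (Arg w / (2 * pi))"
  have "circle_exp t = cis (Arg w)" by (simp add: t_def) (simp add: circle_exp_def)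
  hence "w = of_real (norm w) * circle_exp t" using assms by (simp add: cis_Arg_unique rcis_cmod_Arg flip: rcis_def)
  moreover have "t \<in> {0..<1}" by (simp add: t_def frac_lt_1)
  ultimately show thesis using that by blast
qed

lemma polar_unique:
  assumes "R > 0" "R' > 0" "of_real R * circle_exp s = of_real R' * circle_exp t"
  shows "R = R'" "frac s = frac t"
proof -
  have "norm (of_real R * circle_exp s) = norm (of_real R' * circle_exp t)" using assms(3) by simp
  thus "R = R'" using assms(1,2) by (simp add: norm_mult)
  thus "frac s = frac t" using assms by (simp add: circle_exp_eq_iff_frac)
qed

text \<open>Positions are measured as counterclockwise turns from \<open>a\<close>, so that arcs
  through the angle 0 are no special case. For \<open>a = b\<close> the arc is empty.\<close>

definition oarc :: "real \<Rightarrow> real \<Rightarrow> real set" where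
  "oarc a b = {t\<in>{0..<1}. 0 < frac (t - a) \<and> frac (t - a) < frac (b - a)}"

lemma oarc_subset: "oarc a b \<subseteq> {0..<1}"
  by (auto simp: oarc_def)

text \<open>Passes to a genuine interval of the real line, which starts at \<open>a\<close> and may
  extend beyond 1, as needed for continuity and connectedness.\<close>

lemma oarc_iff_lift:
  assumes "t \<in> {0..<1}"
  shows "t \<in> oarc a b \<longleftrightarrow> (\<exists>s. a < s \<and> s < a + frac (b - a) \<and> frac s = t)"
proof
  assume t: "t \<in> oarc a b"
  have "frac (a + frac (t - a)) = frac t"
    using frac_diff_Ints(1)[of "t - a"] by (simp add: frac_eq_iff_diff_Ints algebra_simps)
  thus "\<exists>s. a < s \<and> s < a + frac (b - a) \<and> frac s = t"
    using t assms by (intro exI[of _ "a + frac (t - a)"]) (auto simp: oarc_def simp del: frac_gt_0_iff)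
next
  assume "\<exists>s. a < s \<and> s < a + frac (b - a) \<and> frac s = t"
  then obtain s where s: "a < s" "s < a + frac (b - a)" "frac s = t" by blast
  have "frac (t - a) = frac (s - a)"
    using s(3) frac_diff_Ints(1)[of s] by (simp add: frac_eq_iff_diff_Ints)
  also have "\<dots> = s - a" using s frac_lt_1[of "b - a"] by (simp add: frac_eq)
  finally show "t \<in> oarc a b" using s assms by (simp add: oarc_def del: frac_gt_0_iff)
qed

lemma circle_exp_oarc: "circle_exp ` oarc a b = circle_exp ` {a<..<a + frac (b - a)}"
proof (intro equalityI subsetI)
  fix x assume "x \<in> circle_exp ` oarc a b"
  then obtain t where t: "t \<in> oarc a b" "x = circle_exp t" by blast
  then obtain s where "a < s" "s < a + frac (b - a)" "frac s = t"
    using oarc_iff_lift oarc_subset by blast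
  thus "x \<in> circle_exp ` {a<..<a + frac (b - a)}" using t by (intro image_eqI[of _ _ s]) auto
next
  fix x assume "x \<in> circle_exp ` {a<..<a + frac (b - a)}"
  then obtain s where s: "a < s" "s < a + frac (b - a)" "x = circle_exp s" by auto
  have "frac s \<in> oarc a b" using s oarc_iff_lift[of "frac s"] by (auto simp: frac_lt_1)
  thus "x \<in> circle_exp ` oarc a b" using s by (intro image_eqI[of _ _ "frac s"]) auto
qed

lemma oarc_nonempty:
  assumes "a \<in> {0..<1}" "b \<in> {0..<1}" "a \<noteq> b"
  shows "oarc a b \<noteq> {}"
proof -
  have "frac (b - a) > 0" by (rule frac_diff_gt_0) (use assms in auto)
  hence "circle_exp ` {a<..<a + frac (b - a)} \<noteq> {}" by (simp del: frac_gt_0_iff add: not_le)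
  thus ?thesis unfolding circle_exp_oarc[symmetric] by blast
qed

lemma oarc_iff_angle_ccw:
  assumes "a \<in> {0..<1}" "b \<in> {0..<1}" "t \<in> {0..<1}" "a \<noteq> b"
  shows "t \<in> oarc a b \<longleftrightarrow> angle_ccw a t b"
  using assms by (auto simp: oarc_def frac_diff_explicit angle_ccw_def simp del: frac_gt_0_iff)

lemma oarc_complement:
  assumes "a \<in> {0..<1}" "b \<in> {0..<1}" "t \<in> {0..<1}" "a \<noteq> b" "t \<noteq> a" "t \<noteq> b" "t \<notin> oarc a b"
  shows "t \<in> oarc b a"
  using assms by (auto simp: oarc_def frac_diff_explicit simp del: frac_gt_0_iff split: if_splits)

lemma oarc_swap_disjoint:
  assumes ab: "a \<in> {0..<1}" "b \<in> {0..<1}"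
  shows "oarc a b \<inter> oarc b a = {}"
proof (rule ccontr)
  assume "oarc a b \<inter> oarc b a \<noteq> {}"
  then obtain t where t: "t \<in> {0..<1}" "t \<in> oarc a b" "t \<in> oarc b a" using oarc_subset by blast
  have "frac (t - a) < frac (b - a)" "frac (t - b) < frac (a - b)" "t \<noteq> a" "t \<noteq> b"
    using t by (auto simp: oarc_def)
  thus False
    unfolding frac_diff_explicit[OF t(1) ab(1)] frac_diff_explicit[OF t(1) ab(2)]
      frac_diff_explicit[OF ab] frac_diff_explicit[OF ab(2,1)]
    using ab t(1) by (auto split: if_splits)
qed

lemma arc_length_oarc:
  assumes "a \<in> {0..<1}" "b \<in> {0..<1}"
  shows "arc_length (oarc a b) = frac (b - a)" "oarc a b \<in> sets lborel" "emeasure lborel (oarc a b) \<noteq> \<infinity>"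
proof -
  have *: "oarc a b = (if a \<le> b then {a<..<b} else {a<..<1} \<union> {0..<b})"
  proof (rule set_eqI)
    fix t show "t \<in> oarc a b \<longleftrightarrow> t \<in> (if a \<le> b then {a<..<b} else {a<..<1} \<union> {0..<b})"
    proof (cases "t \<in> {0..<1}")
      case True
      thus ?thesis using assms by (auto simp: oarc_def frac_diff_explicit simp del: frac_gt_0_iff split: if_splits)
    next
      case False
      thus ?thesis using assms oarc_subset[of a b] by auto
    qed
  qed
  have "measure lborel ({a<..<1} \<union> {0..<b}) = (1 - a) + b" if "\<not> a \<le> b"
    using that assms by (subst measure_Union) auto
  thus "arc_length (oarc a b) = frac (b - a)"
    using assms by (auto simp: * arc_length_def frac_diff_explicit)
  show "oarc a b \<in> sets lborel" unfolding * by auto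
  have "emeasure lborel (oarc a b) \<le> emeasure lborel {0..<1::real}"
    by (rule emeasure_mono) (use oarc_subset in auto)
  thus "emeasure lborel (oarc a b) \<noteq> \<infinity>" by (auto simp: top_unique)
qed

text \<open>The angles range over a real interval rather than over \<open>{0..<1}\<close>: the set
  is then the exponential image of a half-strip, and so open and connected.\<close>

definition wedge :: "real \<Rightarrow> real \<Rightarrow> complex set" where
  "wedge \<alpha> \<beta> = {w. \<exists>R t. 1 < R \<and> \<alpha> < t \<and> t < \<beta> \<and> w = of_real R * circle_exp t}"

lemma wedge_eq_exp_image:
  "wedge \<alpha> \<beta> = exp ` ({z. 0 < Re z} \<inter> {z. 2 * pi * \<alpha> < Im z} \<inter> {z. Im z < 2 * pi * \<beta>})"
proof (intro equalityI subsetI)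
  fix w assume "w \<in> wedge \<alpha> \<beta>"
  then obtain R t where R: "1 < R" "\<alpha> < t" "t < \<beta>" "w = of_real R * circle_exp t"
    by (auto simp: wedge_def)
  have "w = exp (Complex (ln R) (2 * pi * t))"
    using R by (simp add: exp_eq_polar circle_exp_def)
  thus "w \<in> exp ` ({z. 0 < Re z} \<inter> {z. 2 * pi * \<alpha> < Im z} \<inter> {z. Im z < 2 * pi * \<beta>})"
    using R by (intro image_eqI[of _ _ "Complex (ln R) (2 * pi * t)"]) auto
next
  fix w assume "w \<in> exp ` ({z. 0 < Re z} \<inter> {z. 2 * pi * \<alpha> < Im z} \<inter> {z. Im z < 2 * pi * \<beta>})"
  then obtain z where z: "0 < Re z" "2 * pi * \<alpha> < Im z" "Im z < 2 * pi * \<beta>" "w = exp z" by auto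
  have "w = of_real (exp (Re z)) * circle_exp (Im z / (2 * pi))"
    using z(4) by (simp add: exp_eq_polar circle_exp_def)
  moreover have "\<alpha> < Im z / (2 * pi)" "Im z / (2 * pi) < \<beta>"
    using z by (simp_all add: field_simps)
  ultimately show "w \<in> wedge \<alpha> \<beta>" using z(1) unfolding wedge_def
    by (intro CollectI exI[of _ "exp (Re z)"] exI[of _ "Im z / (2 * pi)"]) simp
qed

lemma exp_open_map: "open S \<Longrightarrow> open (exp ` (S :: complex set))"
proof -
  have "\<not> (exp :: complex \<Rightarrow> complex) constant_on UNIV"
  proof
    assume "(exp :: complex \<Rightarrow> complex) constant_on UNIV"
    hence "exp (1 :: complex) = exp 0" unfolding constant_on_def by (metis UNIV_I)
    thus False using exp_eq_1[of "1::complex"] by simp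
  qed
  thus "open S \<Longrightarrow> open (exp ` (S :: complex set))"
    using open_mapping_thm[of exp UNIV S] holomorphic_on_exp by auto
qed

lemma open_wedge: "open (wedge \<alpha> \<beta>)"
  unfolding wedge_eq_exp_image
  by (intro exp_open_map open_Int open_halfspace_Re_gt open_halfspace_Im_gt open_halfspace_Im_lt)

lemma connected_wedge: "connected (wedge \<alpha> \<beta>)"
  unfolding wedge_eq_exp_image
  by (intro connected_continuous_image continuous_intros convex_connected convex_Int
      convex_halfspace_Re_gt convex_halfspace_Im_gt convex_halfspace_Im_lt)

lemma wedge_subset: "wedge \<alpha> \<beta> \<subseteq> {w. norm w > 1}"
  by (auto simp: wedge_def norm_mult)

lemma in_wedge_iff:
  assumes "R > 1" "t \<in> {0..<1}"
  shows "of_real R * circle_exp t \<in> wedge a (a + frac (b - a)) \<longleftrightarrow> t \<in> oarc a b"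
proof
  assume "of_real R * circle_exp t \<in> wedge a (a + frac (b - a))"
  then obtain R' s where s: "R' > 1" "a < s" "s < a + frac (b - a)"
     "of_real R * circle_exp t = of_real R' * circle_exp s" by (auto simp: wedge_def)
  have "frac t = frac s" by (rule polar_unique(2)[OF _ _ s(4)]) (use assms s in auto)
  thus "t \<in> oarc a b" using s assms oarc_iff_lift[OF assms(2)] by auto
next
  assume "t \<in> oarc a b"
  then obtain s where "a < s" "s < a + frac (b - a)" "frac s = t"
    using oarc_iff_lift[OF assms(2)] by auto
  thus "of_real R * circle_exp t \<in> wedge a (a + frac (b - a))"
    using assms unfolding wedge_def by (intro CollectI exI[of _ R] exI[of _ s]) auto
qed

lemma openin_circle_arc: "openin (top_of_set (sphere 0 1)) (circle_exp ` {\<alpha><..<\<beta>})"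
proof -
  let ?U = "exp ` ({z. 2 * pi * \<alpha> < Im z} \<inter> {z. Im z < 2 * pi * \<beta>})"
  have "circle_exp ` {\<alpha><..<\<beta>} = sphere 0 1 \<inter> ?U"
  proof (intro equalityI subsetI)
    fix x assume "x \<in> circle_exp ` {\<alpha><..<\<beta>}"
    then obtain t where t: "\<alpha> < t" "t < \<beta>" "x = circle_exp t" by auto
    have "x = exp (Complex 0 (2 * pi * t))" using t by (simp add: exp_eq_polar circle_exp_def)
    thus "x \<in> sphere 0 1 \<inter> ?U" using t by auto
  next
    fix x assume "x \<in> sphere 0 1 \<inter> ?U"
    then obtain z where z: "2 * pi * \<alpha> < Im z" "Im z < 2 * pi * \<beta>" "x = exp z" "norm x = 1" by auto
    have "x = circle_exp (Im z / (2 * pi))" using z(3,4) by (simp add: exp_eq_polar circle_exp_def norm_mult)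
    moreover have "\<alpha> < Im z / (2 * pi)" "Im z / (2 * pi) < \<beta>"
      using z by (simp_all add: field_simps)
    ultimately show "x \<in> circle_exp ` {\<alpha><..<\<beta>}" by auto
  qed
  moreover have "open ?U" by (intro exp_open_map open_Int open_halfspace_Im_gt open_halfspace_Im_lt)
  ultimately show ?thesis by (metis openin_open)
qed

text \<open>A component that meets a piece contains it; if it were larger, that piece and the union
  of the others would disconnect it.\<close>

lemma components_of_open_partition:
  assumes X: "X = (\<Union>i\<in>I. T i)"
    and T: "\<And>i. i \<in> I \<Longrightarrow> openin (top_of_set X) (T i) \<and> connected (T i) \<and> T i \<noteq> {}"
    and disj: "\<And>i j. i \<in> I \<Longrightarrow> j \<in> I \<Longrightarrow> i \<noteq> j \<Longrightarrow> T i \<inter> T j = {}"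
  shows "components X = T ` I"
proof -
  have comp: "C = T i" if C: "C \<in> components X" and i: "i \<in> I" "C \<inter> T i \<noteq> {}" for C i
  proof
    show "T i \<subseteq> C" by (rule components_maximal[OF C]) (use i T X in auto)
    have rel: "openin (top_of_set C) (C \<inter> V)" if V: "openin (top_of_set X) V" for V
    proof -
      obtain G where "open G" "V = X \<inter> G" using V by (auto simp: openin_open)
      moreover from this have "C \<inter> V = C \<inter> G" using in_components_subset[OF C] by blast
      ultimately show ?thesis by (auto simp: openin_open)
    qed
    show "C \<subseteq> T i"
    proof (rule ccontr)
      assume n: "\<not> C \<subseteq> T i"
      let ?V = "\<Union>j\<in>I - {i}. T j"
      have "openin (top_of_set X) ?V" using T by (intro openin_Union) auto
      hence "openin (top_of_set C) (C \<inter> ?V)" "openin (top_of_set C) (C \<inter> T i)"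
        using rel T[OF i(1)] by blast+
      moreover have "C \<subseteq> (C \<inter> T i) \<union> (C \<inter> ?V)" using in_components_subset[OF C] X by blast
      moreover have "(C \<inter> T i) \<inter> (C \<inter> ?V) = {}" using disj i by blast
      moreover have "C \<inter> ?V \<noteq> {}" using n in_components_subset[OF C] X by blast
      ultimately show False using in_components_connected[OF C] i(2) unfolding connected_openin by blast
    qed
  qed
  show ?thesis
  proof (intro equalityI subsetI)
    fix C assume C: "C \<in> components X"
    then obtain x where "x \<in> C" using in_components_nonempty by fastforce
    moreover have "x \<in> X" using C \<open>x \<in> C\<close> in_components_subset by blast
    ultimately obtain i where "i \<in> I" "C \<inter> T i \<noteq> {}" using X by blast
    thus "C \<in> T ` I" using comp[OF C] by blast
  next
    fix C assume "C \<in> T ` I"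
    then obtain i where i: "i \<in> I" "C = T i" by blast
    then obtain x where x: "x \<in> T i" using T by blast
    hence "x \<in> X" using i X by blast
    then obtain D where D: "D \<in> components X" "x \<in> D" by (metis Union_components UnionE)
    hence "D = T i" using comp[OF D(1) i(1)] x by blast
    thus "C \<in> components X" using D i by simp
  qed
qed

section \<open>Finite sets of angles and their complementary arcs\<close>

locale angle_set =
  fixes A :: "real set"
  assumes A_subset: "A \<subseteq> {0..<1}" and finite_A: "finite A" and card_A: "2 \<le> card A"
begin

lemma frac_pos: "a \<in> A \<Longrightarrow> b \<in> A \<Longrightarrow> a \<noteq> b \<Longrightarrow> frac (b - a) > 0"
  using A_subset by (intro frac_diff_gt_0) auto

text \<open>The counterclockwise successor of \<open>a\<close>. Complementary arcs, and later
  sectors, are indexed by their initial angle, so that sums and bijections over them become ones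
  over \<open>A\<close>.\<close>

definition next_angle :: "real \<Rightarrow> real" where
  "next_angle a = arg_min_on (\<lambda>b. frac (b - a)) (A - {a})"

abbreviation gap :: "real \<Rightarrow> real" where
  "gap a \<equiv> frac (next_angle a - a)"

abbreviation arc_from :: "real \<Rightarrow> real set" where
  "arc_from a \<equiv> oarc a (next_angle a)"

lemma A_minus_nonempty: "A - {a} \<noteq> {}"
proof
  assume "A - {a} = {}"
  hence "card A \<le> card {a}" by (intro card_mono) auto
  thus False using card_A by simp
qed

lemma A_nonempty: "A \<noteq> {}"
  using A_minus_nonempty by blast

lemma next_angle:
  shows "next_angle a \<in> A" "next_angle a \<noteq> a"
    and gap_le: "b \<in> A \<Longrightarrow> b \<noteq> a \<Longrightarrow> gap a \<le> frac (b - a)"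
  using arg_min_if_finite(1)[of "A - {a}" "\<lambda>b. frac (b - a)"] A_minus_nonempty[of a] finite_A
    arg_min_least[of "A - {a}" b "\<lambda>b. frac (b - a)"]
  by (auto simp: next_angle_def)

lemma gap_pos: "a \<in> A \<Longrightarrow> gap a > 0"
  using frac_pos next_angle by metis

lemma arc_from_disjoint_A: "a \<in> A \<Longrightarrow> arc_from a \<inter> A = {}"
  using gap_le[of _ a] by (force simp: oarc_def)

text \<open>Recognises the successor by an empty arc, which is the form that preservation of cyclic
  order provides.\<close>

lemma next_angle_unique:
  assumes "a \<in> A" "b \<in> A" "b \<noteq> a" "oarc a b \<inter> A = {}"
  shows "next_angle a = b"
proof (rule ccontr)
  assume "next_angle a \<noteq> b"
  have n: "next_angle a \<in> {0..<1}" "b \<in> {0..<1}" "a \<in> {0..<1}" using next_angle(1)[of a] subsetD[OF A_subset] assms by blast+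
  have "frac (next_angle a - a) \<noteq> frac (b - a)"
    using \<open>next_angle a \<noteq> b\<close> n by (auto simp: frac_diff_explicit split: if_splits)
  hence "frac (next_angle a - a) < frac (b - a)" using gap_le[OF assms(2,3)] by simp
  hence "next_angle a \<in> oarc a b"
    using gap_pos[OF assms(1)] n(1) by (simp add: oarc_def del: frac_gt_0_iff)
  thus False using assms(4) next_angle(1) by blast
qed

text \<open>An angle of \<open>A\<close> met after \<open>a\<close> on the way to \<open>t\<close>
  would come before the successor of \<open>a\<close>. Thus \<open>a\<close> is the last angle
  before \<open>t\<close>, which gives disjointness of the arcs; conversely, minimising the turn to
  \<open>t\<close> shows that they cover.\<close>

lemma arc_from_nearest:
  assumes "a \<in> A" "t \<in> arc_from a" "a' \<in> A"
  shows "frac (t - a) \<le> frac (t - a')"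
proof (rule ccontr)
  assume "\<not> frac (t - a) \<le> frac (t - a')"
  hence lt: "frac (t - a') < frac (t - a)" by simp
  have ne: "a' \<noteq> a" using lt by auto
  have "frac ((t - a) - (t - a')) = frac (t - a) - frac (t - a')"
    using lt by (intro frac_diff_pos) simp
  moreover have "(t - a) - (t - a') = a' - a" by simp
  ultimately have "frac (a' - a) \<le> frac (t - a)" by (metis diff_le_eq le_add_same_cancel1 frac_ge_0)
  also have "\<dots> < gap a" using assms(2) by (simp add: oarc_def)
  finally show False using gap_le[OF assms(3) ne] by simp
qed

lemma arc_from_disjoint:
  assumes "a \<in> A" "a' \<in> A" "a \<noteq> a'"
  shows "arc_from a \<inter> arc_from a' = {}"
proof (rule ccontr)
  assume "arc_from a \<inter> arc_from a' \<noteq> {}"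
  then obtain t where t: "t \<in> arc_from a" "t \<in> arc_from a'" by blast
  hence "frac (t - a) = frac (t - a')" using arc_from_nearest assms by (meson order_antisym)
  moreover have "t \<in> {0..<1}" "a \<in> {0..<1}" "a' \<in> {0..<1}" using subsetD[OF A_subset] subsetD[OF oarc_subset] t assms by blast+
  ultimately have "a = a'" by (auto simp: frac_diff_explicit split: if_splits)
  thus False using assms(3) by simp
qed

lemma arc_from_cover:
  assumes "t \<in> {0..<1}" "t \<notin> A"
  obtains a where "a \<in> A" "t \<in> arc_from a"
proof -
  obtain a where a: "a \<in> A" "\<And>b. b \<in> A \<Longrightarrow> frac (t - a) \<le> frac (t - b)"
    using arg_min_if_finite(1)[OF finite_A A_nonempty, of "\<lambda>b. frac (t - b)"]
      arg_min_least[OF finite_A A_nonempty, of _ "\<lambda>b. frac (t - b)"] by metis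
  have pos: "frac (t - b) > 0" if "b \<in> A" for b
    by (rule frac_diff_gt_0) (use assms that A_subset in auto)
  have "frac (t - a) < gap a"
  proof (rule ccontr)
    assume n: "\<not> frac (t - a) < gap a"
    hence "frac ((t - a) - (next_angle a - a)) = frac (t - a) - gap a" by (intro frac_diff_pos) simp
    hence "frac (t - next_angle a) < frac (t - a)" using gap_pos[OF a(1)] by simp
    thus False using a(2)[OF next_angle(1), of a] by simp
  qed
  thus thesis using that[OF a(1)] pos[OF a(1)] assms(1) by (simp add: oarc_def del: frac_gt_0_iff)
qed

lemma arc_from_nonempty: "a \<in> A \<Longrightarrow> arc_from a \<noteq> {}"
  using A_subset next_angle[of a] by (intro oarc_nonempty) auto

text \<open>The bridge from topological components on the circle to arcs indexed by their initial
  angles; it rests on \<open>circle_exp\<close> being injective on \<open>{0..<1}\<close>.\<close>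

lemma complementary_arcs_eq: "complementary_arcs A = arc_from ` A"
proof -
  let ?X = "sphere 0 1 - circle_exp ` A"
  have Xeq: "?X = (\<Union>a\<in>A. circle_exp ` arc_from a)"
  proof (intro equalityI subsetI)
    fix x assume x: "x \<in> ?X"
    obtain t where t: "t \<in> {0..<1}" "x = of_real (norm x) * circle_exp t"
      by (rule polar_form[of x]) (use x in auto)
    hence xt: "x = circle_exp t" using x by simp
    hence "t \<notin> A" using x by blast
    then obtain a where "a \<in> A" "t \<in> arc_from a" using arc_from_cover t(1) by blast
    thus "x \<in> (\<Union>a\<in>A. circle_exp ` arc_from a)" using xt by blast
  next
    fix x assume "x \<in> (\<Union>a\<in>A. circle_exp ` arc_from a)"
    then obtain a t where a: "a \<in> A" "t \<in> arc_from a" "x = circle_exp t" by blast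
    have "x \<notin> circle_exp ` A"
    proof
      assume "x \<in> circle_exp ` A"
      then obtain s where s: "s \<in> A" "circle_exp t = circle_exp s" using a by auto
      hence "t = s" using angle_unique a A_subset oarc_subset by blast
      thus False using arc_from_disjoint_A a s by blast
    qed
    thus "x \<in> ?X" using a by auto
  qed
  have comps: "components ?X = (\<lambda>a. circle_exp ` arc_from a) ` A"
  proof (rule components_of_open_partition[OF Xeq])
    fix a assume a: "a \<in> A"
    have "openin (top_of_set (sphere 0 1)) (circle_exp ` arc_from a)"
      unfolding circle_exp_oarc by (rule openin_circle_arc)
    hence "openin (top_of_set ?X) (circle_exp ` arc_from a)"
      by (rule openin_subset_trans) (use Xeq a in auto)
    moreover have "connected (circle_exp ` arc_from a)"
      unfolding circle_exp_oarc circle_exp_def cis_conv_exp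
      by (intro connected_continuous_image continuous_intros) auto
    ultimately show "openin (top_of_set ?X) (circle_exp ` arc_from a) \<and>
        connected (circle_exp ` arc_from a) \<and> circle_exp ` arc_from a \<noteq> {}"
      using arc_from_nonempty[OF a] by simp
  next
    fix a b assume ab: "a \<in> A" "b \<in> A" "a \<noteq> b"
    show "circle_exp ` arc_from a \<inter> circle_exp ` arc_from b = {}"
    proof (rule ccontr)
      assume "circle_exp ` arc_from a \<inter> circle_exp ` arc_from b \<noteq> {}"
      then obtain s t where st: "s \<in> arc_from a" "t \<in> arc_from b" "circle_exp s = circle_exp t" by auto
      hence "s = t" using angle_unique oarc_subset by blast
      thus False using arc_from_disjoint ab st by blast
    qed
  qed
  show ?thesis
  proof (intro equalityI subsetI)
    fix I assume "I \<in> complementary_arcs A"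
    then obtain a where a: "a \<in> A" "I \<subseteq> {0..<1}" "circle_exp ` I = circle_exp ` arc_from a"
      unfolding complementary_arcs_def comps by blast
    have "inj_on circle_exp {0..<1}" by (rule inj_onI) (rule angle_unique)
    hence "I = arc_from a" using a oarc_subset by (metis inj_on_image_eq_iff)
    thus "I \<in> arc_from ` A" using a by blast
  next
    fix I assume "I \<in> arc_from ` A"
    thus "I \<in> complementary_arcs A"
      unfolding complementary_arcs_def comps using oarc_subset by blast
  qed
qed

lemma arc_length_arc_from: "a \<in> A \<Longrightarrow> arc_length (arc_from a) = gap a"
  using A_subset next_angle[of a] by (intro arc_length_oarc) auto

text \<open>The arcs fill the circle up to the finite set \<open>A\<close>, which has measure
  zero.\<close>

lemma sum_gap: "(\<Sum>a\<in>A. gap a) = 1"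
proof -
  have disj: "disjoint_family_on arc_from A"
    using arc_from_disjoint by (auto simp: disjoint_family_on_def)
  have U: "(\<Union>a\<in>A. arc_from a) = {0..<1} - A"
  proof (intro equalityI subsetI)
    fix t assume "t \<in> (\<Union>a\<in>A. arc_from a)"
    thus "t \<in> {0..<1} - A" using arc_from_disjoint_A subsetD[OF oarc_subset] by blast
  next
    fix t assume "t \<in> {0..<1} - A"
    hence "t \<in> {0..<1}" "t \<notin> A" by blast+
    thus "t \<in> (\<Union>a\<in>A. arc_from a)" using arc_from_cover by blast
  qed
  have fm: "arc_from a \<in> sets lborel" "emeasure lborel (arc_from a) \<noteq> \<infinity>" if "a \<in> A" for a
    using arc_length_oarc(2,3)[of a "next_angle a"] subsetD[OF A_subset] next_angle(1) that by blast+
  have "(\<Sum>a\<in>A. gap a) = (\<Sum>a\<in>A. measure lborel (arc_from a))"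
    using arc_length_arc_from by (simp add: arc_length_def)
  also have "\<dots> = measure lborel (\<Union>a\<in>A. arc_from a)"
    by (rule measure_finite_Union[OF finite_A _ disj, symmetric]) (use fm in auto)
  also have "\<dots> = measure lborel {0..<1::real}"
    unfolding U by (rule measure_Diff_null_set) (auto intro: finite_imp_null_set_lborel finite_A)
  finally show ?thesis by simp
qed

end

section \<open>Multiplication of angles and covering numbers\<close>

lemma angle_mult_range: "angle_mult d t \<in> {0..<1}"
  by (simp add: angle_mult_def frac_lt_1)

lemma circle_exp_angle_mult: "circle_exp (angle_mult d t) = circle_exp (real d * t)"
  by (simp add: angle_mult_def)

text \<open>Replacing angles by representatives modulo 1 changes d times a turn only by an
  integer.\<close>

lemma frac_mult_gap:
  "frac (real d * frac (b - a)) = frac (angle_mult d b - angle_mult d a)"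
proof -
  have "real d * frac (b - a) - (angle_mult d b - angle_mult d a) =
      of_int (- (int d * \<lfloor>b - a\<rfloor>) + \<lfloor>real d * b\<rfloor> - \<lfloor>real d * a\<rfloor>)"
    by (simp add: frac_def angle_mult_def algebra_simps)
  thus ?thesis unfolding frac_eq_iff_diff_Ints by (metis Ints_of_int)
qed

text \<open>A turn of x from \<open>a\<close> moves the image by d x turns. If \<theta> is
  \<open>u\<close> turns ahead of the image of \<open>a\<close>, its preimages sit at x = (u + i)/d,
  and those inside the arc correspond to the integers i with 0 < u + i < n + v, where v is the turn
  between the two image angles.\<close>

lemma card_angle_mult_fibre:
  assumes d: "d > 0" and \<theta>: "\<theta> \<in> {0..<1}"
    and ne: "angle_mult d b \<noteq> angle_mult d a"
  defines "n \<equiv> nat \<lfloor>real d * frac (b - a)\<rfloor>"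
  shows "finite {t\<in>oarc a b. angle_mult d t = \<theta>}"
    "card {t\<in>oarc a b. angle_mult d t = \<theta>} =
       (if \<theta> \<in> oarc (angle_mult d a) (angle_mult d b) then n + 1 else n)"
proof -
  define a' b' where "a' = angle_mult d a" and "b' = angle_mult d b"
  define u where "u = frac (\<theta> - a')"
  define v where "v = frac (b' - a')"
  have ab': "a' \<in> {0..<1}" "b' \<in> {0..<1}" by (simp_all add: a'_def b'_def angle_mult_range del: atLeastLessThan_iff)
  have v: "0 < v" "v < 1" unfolding v_def using frac_diff_gt_0[OF ab'(2,1)] ne
    by (simp_all add: frac_lt_1 a'_def b'_def del: frac_gt_0_iff)
  have u: "0 \<le> u" "u < 1" by (simp_all add: u_def frac_lt_1)
  have dl: "real d * frac (b - a) = real n + v"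
  proof -
    have "real_of_int \<lfloor>real d * frac (b - a)\<rfloor> = real n" unfolding n_def by simp
    moreover have "frac (real d * frac (b - a)) = v" unfolding v_def a'_def b'_def by (rule frac_mult_gap)
    ultimately show ?thesis unfolding frac_def by linarith
  qed
  define N where "N = {i::nat. 0 < u + i \<and> u + i < real n + v}"
  define g where "g i = frac (a + (u + real i) / d)" for i :: nat
  have diff: "frac (g i - a) = (u + i) / d" if "i \<in> N" for i
  proof -
    have "frac (b - a) < 1" by (rule frac_lt_1)
    hence "real d * frac (b - a) < real d" using d by simp
    hence "(u + i) / d < 1" using that dl d by (auto simp: N_def field_simps)
    moreover have "0 \<le> (u + i) / d" using u by simp
    moreover have "g i - a - (u + i) / d \<in> \<int>"
      using frac_diff_Ints(1)[of "a + (u + real i) / d"] by (simp add: g_def algebra_simps)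
    ultimately show ?thesis by (simp add: frac_unique_iff)
  qed
  have inj: "inj_on g N"
  proof (rule inj_onI)
    fix i j assume "i \<in> N" "j \<in> N" "g i = g j"
    hence "(u + i) / d = (u + j) / d" using diff by metis
    thus "i = j" using d by simp
  qed
  have img: "g ` N = {t\<in>oarc a b. angle_mult d t = \<theta>}"
  proof (intro equalityI subsetI)
    fix t assume "t \<in> g ` N"
    then obtain i where i: "i \<in> N" "t = g i" by blast
    have "0 < frac (t - a)" using i d unfolding i(2) diff[OF i(1)] by (simp add: N_def)
    moreover have "frac (t - a) < frac (b - a)"
    proof -
      have "u + i < real d * frac (b - a)" using i(1) dl by (simp add: N_def)
      thus ?thesis using d unfolding i(2) diff[OF i(1)] by (simp add: field_simps)
    qed
    moreover have "t \<in> {0..<1}" by (simp add: i(2) g_def frac_lt_1)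
    moreover have "angle_mult d t = \<theta>"
    proof -
      have e: "real d * t - \<theta> = real d * (t - (a + (u + i) / d)) + (real d * a - a') + (u - (\<theta> - a')) + real i"
        using d by (simp add: field_simps)
      have "t - (a + (u + i) / d) \<in> \<int>" "real d * a - a' \<in> \<int>" "u - (\<theta> - a') \<in> \<int>"
        unfolding i(2) g_def a'_def angle_mult_def u_def by (rule frac_diff_Ints)+
      hence "real d * t - \<theta> \<in> \<int>"
        unfolding e by (intro Ints_add Ints_mult Ints_of_nat)
      thus ?thesis using \<theta> by (simp add: angle_mult_def frac_unique_iff)
    qed
    ultimately show "t \<in> {t\<in>oarc a b. angle_mult d t = \<theta>}" by (simp add: oarc_def del: frac_gt_0_iff)
  next
    fix t assume "t \<in> {t\<in>oarc a b. angle_mult d t = \<theta>}"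
    hence t: "t \<in> {0..<1}" "0 < frac (t - a)" "frac (t - a) < frac (b - a)" "angle_mult d t = \<theta>"
      by (auto simp: oarc_def simp del: frac_gt_0_iff)
    define x where "x = frac (t - a)"
    have "frac (real d * x) = u" unfolding x_def u_def a'_def t(4)[symmetric] by (rule frac_mult_gap)
    moreover define i where "i = nat \<lfloor>real d * x\<rfloor>"
    moreover have "real_of_int \<lfloor>real d * x\<rfloor> = real i" using d t(2) by (simp add: i_def x_def)
    ultimately have dx: "real d * x = u + i" by (simp add: frac_def)
    have xe: "x = (u + i) / d" using dx d by (simp add: field_simps)
    have "i \<in> N" unfolding N_def mem_Collect_eq dx[symmetric] dl[symmetric] using t d by (simp add: x_def del: frac_gt_0_iff)
    moreover have "t = g i"
    proof -
      have "a + x - t \<in> \<int>" using frac_diff_Ints(1)[of "t - a"] by (simp add: x_def algebra_simps)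
      hence "frac (a + x) = t" using t(1) by (simp add: frac_unique_iff)
      thus ?thesis unfolding g_def xe[symmetric] by (rule sym)
    qed
    ultimately show "t \<in> g ` N" by blast
  qed
  have mem: "\<theta> \<in> oarc a' b' \<longleftrightarrow> 0 < u \<and> u < v"
    using \<theta> by (simp add: oarc_def u_def v_def del: frac_gt_0_iff)
  \<comment> \<open>For \<open>u = 0\<close> the index 0 would give the excluded endpoint
    \<open>a\<close>, so 1, ..., n remain. For \<open>u \<ge> v\<close> the index n falls on or
    beyond \<open>b\<close>. Only \<open>0 < u < v\<close> gives n + 1 solutions.\<close>
  have N: "N = (if u = 0 then {1..n} else if u < v then {..n} else {..<n})"
  proof (cases "u = 0")
    case True
    have "i \<in> N \<longleftrightarrow> i \<in> {1..n}" for i using True v by (auto simp: N_def)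
    hence "N = {1..n}" by blast
    thus ?thesis using True by simp
  next
    case False
    hence "u > 0" using u by simp
    hence "i \<in> N \<longleftrightarrow> i \<in> (if u < v then {..n} else {..<n})" for i
      using u v by (auto simp: N_def)
    hence "N = (if u < v then {..n} else {..<n})" by blast
    thus ?thesis using False by simp
  qed
  show "finite {t\<in>oarc a b. angle_mult d t = \<theta>}" unfolding img[symmetric] N by simp
  have "card {t\<in>oarc a b. angle_mult d t = \<theta>} = card N" unfolding img[symmetric] by (rule card_image[OF inj])
  also have "\<dots> = (if 0 < u \<and> u < v then n + 1 else n)" unfolding N using u v by auto
  finally show "card {t\<in>oarc a b. angle_mult d t = \<theta>} =
       (if \<theta> \<in> oarc (angle_mult d a) (angle_mult d b) then n + 1 else n)"
    using mem unfolding a'_def b'_def by simp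
qed

section \<open>Complementary arcs at two consecutive times\<close>

locale angle_step = X: angle_set A + Y: angle_set A'
  for A A' :: "real set" +
  fixes d :: nat
  assumes d_ge_2: "2 \<le> d"
    and bij: "bij_betw (angle_mult d) A A'"
    and ccw_preserved: "\<And>a b c. a \<in> A \<Longrightarrow> b \<in> A \<Longrightarrow> c \<in> A \<Longrightarrow> angle_ccw a b c \<Longrightarrow>
      angle_ccw (angle_mult d a) (angle_mult d b) (angle_mult d c)"
begin

abbreviation im :: "real \<Rightarrow> real" where
  "im \<equiv> angle_mult d"

lemma im_in: "a \<in> A \<Longrightarrow> im a \<in> A'"
  using bij bij_betwE by blast

lemma im_inj: "a \<in> A \<Longrightarrow> b \<in> A \<Longrightarrow> im a = im b \<longleftrightarrow> a = b"
  using bij by (meson bij_betw_imp_inj_on inj_on_eq_iff)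

text \<open>An angle of \<open>A'\<close> strictly between the two images would come from an angle
  of \<open>A\<close> on the other side, against the preserved cyclic order. Hence an arc goes to
  the arc at the image of its initial angle, up to full turns.\<close>

lemma next_angle_im:
  assumes a: "a \<in> A"
  shows "Y.next_angle (im a) = im (X.next_angle a)"
proof (rule Y.next_angle_unique)
  let ?b = "X.next_angle a"
  have b: "?b \<in> A" "?b \<noteq> a" by (rule X.next_angle)+
  show "im a \<in> A'" "im ?b \<in> A'" using im_in a b by blast+
  show "im ?b \<noteq> im a" using im_inj a b by blast
  show "oarc (im a) (im ?b) \<inter> A' = {}"
  proof (rule ccontr)
    assume "oarc (im a) (im ?b) \<inter> A' \<noteq> {}"
    then obtain c' where c': "c' \<in> oarc (im a) (im ?b)" "c' \<in> A'" by blast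
    then obtain c where c: "c \<in> A" "c' = im c" using bij by (metis bij_betw_imp_surj_on imageE)
    have rng: "x \<in> {0..<1}" if "x \<in> A" for x using X.A_subset that by blast
    have ccw': "angle_ccw (im a) (im c) (im ?b)"
      using c' c oarc_iff_angle_ccw[OF angle_mult_range angle_mult_range angle_mult_range] im_inj a b by metis
    have "c \<notin> oarc a ?b" using X.arc_from_disjoint_A[OF a] c by blast
    hence "\<not> angle_ccw a c ?b" using oarc_iff_angle_ccw rng a b c by metis
    moreover have "c \<noteq> a" "c \<noteq> ?b" using ccw' by (auto simp: angle_ccw_def)
    ultimately have "angle_ccw a ?b c" using b(2) by (auto simp: angle_ccw_def)
    hence "angle_ccw (im a) (im ?b) (im c)" by (intro ccw_preserved a b c)
    thus False using ccw' by (auto simp: angle_ccw_def)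
  qed
qed

text \<open>The paper's covering number \<open>k\<close> of the arc starting at \<open>a\<close> is \<open>extra a + 1\<close>.\<close>

definition extra :: "real \<Rightarrow> nat" where
  "extra a = nat \<lfloor>real d * X.gap a\<rfloor>"

text \<open>The image of the arc sweeps \<open>extra a\<close> full turns and then once the arc that
  starts at \<open>im a\<close>.\<close>

lemma d_gap:
  assumes "a \<in> A"
  shows "real d * X.gap a = real (extra a) + Y.gap (im a)"
proof -
  have "real_of_int \<lfloor>real d * X.gap a\<rfloor> = real (extra a)" by (simp add: extra_def)
  moreover have "frac (real d * X.gap a) = Y.gap (im a)"
    unfolding next_angle_im[OF assms] by (rule frac_mult_gap)
  ultimately show ?thesis unfolding frac_def[of "real d * X.gap a"] by linarith
qed

lemma fibre_in_arc:
  assumes a: "a \<in> A" and \<theta>: "\<theta> \<in> {0..<1}"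
  shows "finite {t\<in>X.arc_from a. im t = \<theta>}"
    and "card {t\<in>X.arc_from a. im t = \<theta>} = (if \<theta> \<in> Y.arc_from (im a) then extra a + 1 else extra a)"
proof -
  have ne: "im (X.next_angle a) \<noteq> im a" using X.next_angle im_inj a by metis
  have d: "d > 0" using d_ge_2 by simp
  show "finite {t\<in>X.arc_from a. im t = \<theta>}" by (rule card_angle_mult_fibre(1)[OF d \<theta> ne])
  show "card {t\<in>X.arc_from a. im t = \<theta>} = (if \<theta> \<in> Y.arc_from (im a) then extra a + 1 else extra a)"
    unfolding next_angle_im[OF a] extra_def by (rule card_angle_mult_fibre(2)[OF d \<theta> ne])
qed

text \<open>Summation of \<open>d_gap\<close>: both families of gaps have total length 1.\<close>

lemma sum_extra: "(\<Sum>a\<in>A. extra a) = d - 1"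
proof -
  have "real (\<Sum>a\<in>A. extra a) = (\<Sum>a\<in>A. real d * X.gap a - Y.gap (im a))"
    using d_gap by simp
  also have "\<dots> = real d * (\<Sum>a\<in>A. X.gap a) - (\<Sum>a\<in>A. Y.gap (im a))"
    by (simp add: sum_subtractf sum_distrib_left)
  also have "(\<Sum>a\<in>A. Y.gap (im a)) = (\<Sum>a\<in>A'. Y.gap a)"
    by (rule sum.reindex_bij_betw[OF bij])
  finally have "real (\<Sum>a\<in>A. extra a) = real d - 1" by (simp only: X.sum_gap Y.sum_gap)
  hence "real (\<Sum>a\<in>A. extra a) = real (d - 1)" using d_ge_2 by (simp add: of_nat_diff)
  thus ?thesis by (simp only: of_nat_eq_iff)
qed

lemma extra_less: "a \<in> A \<Longrightarrow> extra a < d"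
  using member_le_sum[of a A extra] sum_extra X.finite_A d_ge_2 by simp

lemma exists_extra: "\<exists>a\<in>A. extra a \<ge> 1"
proof (rule ccontr)
  assume "\<not> ?thesis"
  hence "(\<Sum>a\<in>A. extra a) = 0" by (simp add: not_le)
  thus False using sum_extra d_ge_2 by simp
qed

lemma Y_gap_lt: "Y.gap a < 1"
  by (rule frac_lt_1)

text \<open>Length exactly 1/d cannot occur, because the remainder \<open>Y.gap (im a)\<close> lies
  strictly between 0 and 1.\<close>

lemma gap_gt_iff:
  assumes a: "a \<in> A"
  shows "X.gap a > 1 / real d \<longleftrightarrow> extra a \<ge> 1"
proof -
  have "X.gap a > 1 / real d \<longleftrightarrow> real d * X.gap a > 1" using d_ge_2 by (simp add: field_simps)
  also have "\<dots> \<longleftrightarrow> extra a \<ge> 1"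
    using d_gap[OF a] Y.gap_pos[OF im_in[OF a]] Y_gap_lt[of "im a"]
    by (cases "extra a") (auto simp del: frac_gt_0_iff)
  finally show ?thesis .
qed

lemma not_inj_on_arc:
  assumes a: "a \<in> A" and e: "extra a \<ge> 1"
  shows "\<not> inj_on im (X.arc_from a)"
proof
  assume inj: "inj_on im (X.arc_from a)"
  obtain \<theta> where \<theta>: "\<theta> \<in> Y.arc_from (im a)" using Y.arc_from_nonempty[OF im_in[OF a]] by blast
  have \<theta>r: "\<theta> \<in> {0..<1}" using \<theta> oarc_subset by blast
  let ?F = "{t\<in>X.arc_from a. im t = \<theta>}"
  have "card (im ` ?F) = card ?F" by (rule card_image) (rule inj_on_subset[OF inj], auto)
  moreover have "card (im ` ?F) \<le> card {\<theta>}" by (rule card_mono) auto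
  ultimately show False using fibre_in_arc(2)[OF a \<theta>r] \<theta> e by simp
qed

text \<open>Multiplied by d, these gaps become gaps of distinct arcs at the next time. Some arc
  makes a full turn, and the gap at its image is missing from the total 1.\<close>

lemma noncritical_width:
  "(\<Sum>a\<in>{a\<in>A. extra a = 0}. X.gap a) < 1 / real d"
proof -
  obtain a0 where a0: "a0 \<in> A" "extra a0 \<ge> 1" using exists_extra by blast
  have "real d * (\<Sum>a\<in>{a\<in>A. extra a = 0}. X.gap a) = (\<Sum>a\<in>{a\<in>A. extra a = 0}. Y.gap (im a))"
    unfolding sum_distrib_left using d_gap by (intro sum.cong) auto
  also have "\<dots> \<le> (\<Sum>a\<in>A - {a0}. Y.gap (im a))"
    using a0 X.finite_A by (intro sum_mono2) auto
  also have "\<dots> = (\<Sum>a\<in>A. Y.gap (im a)) - Y.gap (im a0)"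
    using a0 X.finite_A by (simp add: sum_diff1)
  also have "(\<Sum>a\<in>A. Y.gap (im a)) = 1"
    using sum.reindex_bij_betw[OF bij, of Y.gap] Y.sum_gap by simp
  also have "1 - Y.gap (im a0) < 1" using Y.gap_pos[OF im_in[OF a0(1)]] by (simp del: frac_gt_0_iff)
  finally show ?thesis using d_ge_2 by (simp add: field_simps)
qed

lemma arc_covers_arc:
  assumes a: "a \<in> A" and c: "c \<in> A'"
  shows "arc_covers d (X.arc_from a) (Y.arc_from c) k \<longleftrightarrow> k = (if c = im a then extra a + 1 else extra a)"
proof -
  have card: "card {t\<in>X.arc_from a. im t = \<theta>} = (if c = im a then extra a + 1 else extra a)"
    if t: "\<theta> \<in> Y.arc_from c" for \<theta>
  proof -
    have "\<theta> \<in> {0..<1}" using t oarc_subset by blast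
    moreover have "\<theta> \<in> Y.arc_from (im a) \<longleftrightarrow> c = im a"
      using t Y.arc_from_disjoint[OF c im_in[OF a]] by blast
    ultimately show ?thesis using fibre_in_arc(2)[OF a] by simp
  qed
  have "finite {t\<in>X.arc_from a. im t = \<theta>}" if t: "\<theta> \<in> Y.arc_from c" for \<theta>
    using fibre_in_arc(1)[OF a] t oarc_subset by blast
  thus ?thesis using card Y.arc_from_nonempty[OF c] unfolding arc_covers_def by fastforce
qed

end

section \<open>Sectors of a single time\<close>

text \<open>One Boettcher map without any dynamics: \<open>\<phi>\<close> carries the polar
  coordinates of the exterior of the disc to the basin.\<close>

locale basin_chart =
  fixes B :: "complex set" and \<phi> :: "complex \<Rightarrow> complex"
  assumes open_B: "open B" and bounded_compl_B: "bounded (- B)"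
    and holo: "\<phi> holomorphic_on B" and bij_phi: "bij_betw \<phi> B {w. norm w > 1}"
    and phi_inf: "filterlim \<phi> at_infinity at_infinity"
begin

abbreviation E :: "complex set" where "E \<equiv> {w. norm w > 1}"

abbreviation \<psi> :: "complex \<Rightarrow> complex" where "\<psi> \<equiv> inv_into B \<phi>"

abbreviation rp :: "real \<Rightarrow> real \<Rightarrow> complex" where
  "rp t R \<equiv> \<psi> (of_real R * circle_exp t)"

abbreviation ray :: "real \<Rightarrow> complex set" where "ray t \<equiv> rp t ` {1<..}"

lemma inj_phi: "inj_on \<phi> B" and image_phi: "\<phi> ` B = E"
  using bij_phi by (auto simp: bij_betw_def)

lemma psi_phi [simp]: "z \<in> B \<Longrightarrow> \<psi> (\<phi> z) = z"
  using inj_phi by simp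

lemma phi_psi: "norm w > 1 \<Longrightarrow> \<phi> (\<psi> w) = w"
  using image_phi by (intro f_inv_into_f) auto

lemma psi_in: "norm w > 1 \<Longrightarrow> \<psi> w \<in> B"
  using image_phi by (intro inv_into_into) auto

lemma phi_norm: "z \<in> B \<Longrightarrow> norm (\<phi> z) > 1"
  using image_phi by blast

lemma psi_inj: "norm w > 1 \<Longrightarrow> norm w' > 1 \<Longrightarrow> \<psi> w = \<psi> w' \<Longrightarrow> w = w'"
  by (metis phi_psi)

lemma continuous_on_psi: "continuous_on E \<psi>"
proof -
  obtain g where g: "homeomorphism B (\<phi> ` B) \<phi> g"
    using invariance_of_domain_homeomorphism[OF open_B holomorphic_on_imp_continuous_on[OF holo] _ inj_phi]
    by auto
  have "continuous_on E g" using g image_phi by (simp add: homeomorphism_def)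
  moreover have "g w = \<psi> w" if "w \<in> E" for w
  proof -
    have "\<psi> w \<in> B" "\<phi> (\<psi> w) = w" using that psi_in phi_psi by auto
    thus ?thesis using g by (metis homeomorphism_apply1)
  qed
  ultimately show ?thesis by (metis continuous_on_cong)
qed

lemma open_image_psi:
  assumes "open U" "U \<subseteq> E"
  shows "open (\<psi> ` U)"
  by (rule invariance_of_domain[OF continuous_on_subset[OF continuous_on_psi assms(2)] assms(1)])
    (use assms(2) psi_inj in \<open>auto simp: inj_on_def\<close>)

text \<open>In the coordinate \<open>1/z\<close> the map \<open>\<phi>\<close> extends to a continuous injection at the origin, so by
  invariance of domain its image contains a neighbourhood of infinity.\<close>

lemma psi_at_infinity: "filterlim \<psi> at_infinity at_infinity"
proof -
  have "\<exists>\<rho>. \<forall>w. \<rho> \<le> norm w \<longrightarrow> r < norm (\<psi> w)" if "r > 0" for r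
  proof -
    obtain r0 where r0: "\<And>z. z \<in> - B \<Longrightarrow> norm z \<le> r0" using bounded_compl_B by (meson bounded_iff)
    define s where "s = max r r0"
    have s: "s > 0" "r \<le> s" using \<open>r > 0\<close> by (auto simp: s_def)
    have sB: "z \<in> B" if "norm z > s" for z using r0[of z] that by (fastforce simp: s_def)
    define k where "k u = (if u = 0 then 0 else inverse (\<phi> (inverse u)))" for u
    let ?D = "ball (0::complex) (inverse s)"
    have inv: "norm (inverse u) > s" if "u \<in> ?D" "u \<noteq> 0" for u
    proof -
      have "norm u < inverse s" using that by simp
      hence "inverse (inverse s) < inverse (norm u)"
        using that by (intro less_imp_inverse_less) auto
      thus ?thesis by (simp add: norm_inverse)
    qed
    have cont0: "isCont k 0"
    proof -
      have "((\<lambda>u. inverse (\<phi> (inverse u))) \<longlongrightarrow> 0) (at 0)"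
        by (rule filterlim_compose[OF tendsto_inverse_0 filterlim_compose[OF phi_inf filterlim_inverse_at_infinity]])
      hence "(k \<longlongrightarrow> 0) (at 0)"
        by (rule Lim_transform_eventually) (auto simp: k_def eventually_at_filter)
      thus ?thesis by (simp add: isCont_def k_def)
    qed
    have "continuous_on (?D - {0}) (\<lambda>u. inverse (\<phi> (inverse u)))"
    proof (intro continuous_intros)
      show "continuous_on (?D - {0}) (\<lambda>u. \<phi> (inverse u))"
      proof (rule continuous_on_compose2[OF holomorphic_on_imp_continuous_on[OF holo]])
        show "continuous_on (?D - {0}) inverse" by (intro continuous_intros) auto
        show "inverse ` (?D - {0}) \<subseteq> B" using inv sB by blast
      qed
      show "\<forall>u\<in>?D - {0}. \<phi> (inverse u) \<noteq> 0"
      proof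
        fix u assume "u \<in> ?D - {0}"
        hence "norm (\<phi> (inverse u)) > 1" using inv sB phi_norm by blast
        thus "\<phi> (inverse u) \<noteq> 0" by auto
      qed
    qed
    hence "continuous_on (?D - {0}) k" by (rule continuous_on_eq) (auto simp: k_def)
    hence "isCont k u" if "u \<in> ?D - {0}" for u
      using that continuous_on_eq_continuous_at[of "?D - {0}" k] by (auto simp: open_delete)
    hence "continuous_on ?D k" using cont0 by (intro continuous_at_imp_continuous_on) blast
    moreover have "inj_on k ?D"
    proof (rule inj_onI)
      fix u v assume uv: "u \<in> ?D" "v \<in> ?D" "k u = k v"
      have nz: "inverse (\<phi> (inverse x)) \<noteq> 0" if "x \<in> ?D" "x \<noteq> 0" for x
        using phi_norm[OF sB[OF inv[OF that]]] by auto
      show "u = v"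
      proof (cases "u = 0 \<or> v = 0")
        case True
        thus ?thesis using uv nz by (metis k_def)
      next
        case False
        hence "\<phi> (inverse u) = \<phi> (inverse v)" using uv by (simp add: k_def)
        hence "inverse u = inverse v" using inj_phi sB inv uv False by (meson inj_onD)
        thus ?thesis by simp
      qed
    qed
    ultimately have "open (k ` ?D)" by (intro invariance_of_domain) auto
    moreover have "0 \<in> k ` ?D" using s by (intro image_eqI[of _ _ 0]) (auto simp: k_def)
    ultimately obtain \<delta> where \<delta>: "\<delta> > 0" "ball 0 \<delta> \<subseteq> k ` ?D" by (meson openE)
    show ?thesis
    proof (intro exI[of _ "inverse \<delta> + 1"] allI impI)
      fix w :: complex assume w: "inverse \<delta> + 1 \<le> norm w"
      have w0: "w \<noteq> 0" using w \<delta>(1) by (metis add_pos_pos inverse_positive_iff_positive less_numeral_extra(1) norm_zero not_le)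
      have "inverse \<delta> < norm w" using w by simp
      hence "inverse (norm w) < inverse (inverse \<delta>)" using \<delta>(1) by (intro less_imp_inverse_less) auto
      hence "inverse w \<in> ball 0 \<delta>" using \<delta>(1) by (simp add: norm_inverse)
      then obtain u where u: "u \<in> ?D" "inverse w = k u" using \<delta>(2) by blast
      have u0: "u \<noteq> 0" using u w0 by (auto simp: k_def)
      hence "w = \<phi> (inverse u)" using u by (simp add: k_def)
      hence "\<psi> w = inverse u" using psi_phi sB inv u u0 by metis
      thus "r < norm (\<psi> w)" using inv[OF u(1) u0] s by simp
    qed
  qed
  thus ?thesis
    unfolding filterlim_at_infinity[of 0, simplified] eventually_at_infinity by (meson less_imp_le)
qed

lemma norm_polar: "R > 1 \<Longrightarrow> norm (of_real R * circle_exp t) > 1"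
  by (simp add: norm_mult)

lemma landing_ray_rp:
  assumes "(rp t \<longlongrightarrow> q) (at_right 1)" "q \<notin> B"
  shows "landing_ray (rp t) q"
  unfolding landing_ray_def
proof (intro conjI)
  show "continuous_on {1<..} (rp t)"
    by (rule continuous_on_compose2[OF continuous_on_psi]) (auto intro!: continuous_intros simp: norm_mult)
  show "inj_on (rp t) {1<..}"
  proof (rule inj_onI)
    fix R S :: real assume RS: "R \<in> {1<..}" "S \<in> {1<..}" "rp t R = rp t S"
    have "of_real R * circle_exp t = of_real S * circle_exp t"
      by (rule psi_inj[OF norm_polar norm_polar RS(3)]) (use RS in auto)
    thus "R = S" by simp
  qed
  show "q \<notin> rp t ` {1<..}" using assms(2) psi_in norm_polar by auto
  show "(rp t \<longlongrightarrow> q) (at_right 1)" by (rule assms(1))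
  show "filterlim (rp t) at_infinity at_top"
    by (rule filterlim_compose[OF psi_at_infinity])
      (simp add: filterlim_at_infinity_conv_norm_at_top norm_mult filterlim_abs_real)
qed

lemma ray_subset: "ray t \<subseteq> B"
  using psi_in norm_polar by auto

lemma in_ray_iff:
  assumes "R > 1" "s \<in> {0..<1}" "t \<in> {0..<1}"
  shows "rp s R \<in> ray t \<longleftrightarrow> s = t"
proof
  assume "rp s R \<in> ray t"
  then obtain R' where R': "R' > 1" "rp s R = rp t R'" by auto
  hence "of_real R * circle_exp s = of_real R' * circle_exp t"
    using psi_inj norm_polar assms(1) by blast
  hence "frac s = frac t" using polar_unique(2)[of R R' s t] assms(1) R'(1) by simp
  thus "s = t" using assms by (simp add: frac_eq_id)
qed (use assms in auto)

lemma rays_disjoint: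
  assumes "s \<in> {0..<1}" "t \<in> {0..<1}" "s \<noteq> t"
  shows "ray s \<inter> ray t = {}"
  using in_ray_iff[OF _ assms(1,2)] assms(3) by auto

lemma B_polar:
  assumes "z \<in> B"
  obtains R t where "R > 1" "t \<in> {0..<1}" "z = rp t R"
proof -
  have n: "norm (\<phi> z) > 1" using assms by (rule phi_norm)
  hence nz: "\<phi> z \<noteq> 0" by auto
  obtain t where t: "t \<in> {0..<1}" "\<phi> z = of_real (norm (\<phi> z)) * circle_exp t"
    by (rule polar_form[OF nz])
  have "z = rp t (norm (\<phi> z))" using t(2) assms by (metis psi_phi)
  thus thesis using that n t by blast
qed

text \<open>The union of the rays with angles in \<open>oarc a b\<close>; openness and connectedness
  are inherited from the wedge.\<close>

definition piece :: "real \<Rightarrow> real \<Rightarrow> complex set" where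
  "piece a b = \<psi> ` wedge a (a + frac (b - a))"

lemma open_piece: "open (piece a b)"
  unfolding piece_def by (rule open_image_psi[OF open_wedge wedge_subset])

lemma connected_piece: "connected (piece a b)"
  unfolding piece_def
  by (rule connected_continuous_image[OF continuous_on_subset[OF continuous_on_psi wedge_subset] connected_wedge])

lemma piece_subset: "piece a b \<subseteq> B"
  unfolding piece_def using wedge_subset psi_in by blast

lemma in_piece_iff:
  assumes "R > 1" "t \<in> {0..<1}"
  shows "rp t R \<in> piece a b \<longleftrightarrow> t \<in> oarc a b"
proof -
  have "rp t R \<in> piece a b \<longleftrightarrow> of_real R * circle_exp t \<in> wedge a (a + frac (b - a))"
  proof
    assume "rp t R \<in> piece a b"
    then obtain w where w: "w \<in> wedge a (a + frac (b - a))" "\<psi> w = rp t R" unfolding piece_def by auto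
    hence "w = of_real R * circle_exp t" using wedge_subset norm_polar[OF assms(1)] psi_inj by blast
    thus "of_real R * circle_exp t \<in> wedge a (a + frac (b - a))" using w by simp
  qed (auto simp: piece_def)
  thus ?thesis using in_wedge_iff[OF assms] by simp
qed

text \<open>At fixed radius the points \<open>rp t R\<close> tend to \<open>rp a R\<close> as t
  decreases to \<open>a\<close>. Through this a sector accumulates at the landing point of its
  boundary ray.\<close>

lemma ray_in_closure_piece:
  assumes "R > 1" "frac (b - a) > 0"
  shows "rp a R \<in> closure (piece a b)"
proof (rule Lim_in_closed_set[OF closed_closure])
  have *: "\<forall>\<^sub>F t in at_right a. t \<in> {a<..<a + frac (b - a)}"
    by (rule eventually_at_right_real) (use assms(2) in linarith)
  show "\<forall>\<^sub>F t in at_right a. rp t R \<in> closure (piece a b)"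
    using *
  proof eventually_elim
    case (elim t)
    hence "of_real R * circle_exp t \<in> wedge a (a + frac (b - a))"
      using assms(1) unfolding wedge_def by auto
    thus ?case unfolding piece_def by (intro subsetD[OF closure_subset] imageI)
  qed
  have "continuous_on UNIV (\<lambda>t. rp t R)"
    by (rule continuous_on_compose2[OF continuous_on_psi])
      (use assms(1) in \<open>auto intro!: continuous_intros simp: norm_mult\<close>)
  hence "((\<lambda>t. rp t R) \<longlongrightarrow> rp a R) (at a)"
    by (simp add: continuous_on_eq_continuous_at isCont_def)
  thus "((\<lambda>t. rp t R) \<longlongrightarrow> rp a R) (at_right a)" by (rule tendsto_within_subset) auto
qed simp

end

section \<open>Sectors at a common landing point\<close>

locale portrait_chart = basin_chart B \<phi> + angle_set A
  for B :: "complex set" and \<phi> :: "complex \<Rightarrow> complex" and A :: "real set" +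
  fixes p :: complex
  assumes p_notin: "p \<notin> B"
    and lands: "\<And>a. a \<in> A \<Longrightarrow> (rp a \<longlongrightarrow> p) (at_right 1)"
begin

lemma A_range: "a \<in> A \<Longrightarrow> a \<in> {0..<1}"
  using A_subset by blast

definition web :: "complex set" where
  "web = insert p (\<Union>a\<in>A. ray a)"

abbreviation pc :: "real \<Rightarrow> complex set" where
  "pc a \<equiv> piece a (next_angle a)"

lemma landing_A: "a \<in> A \<Longrightarrow> landing_ray (rp a) p"
  using landing_ray_rp lands p_notin by blast

lemma web_eq: "web = (\<Union>a\<in>A. insert p (ray a))"
  unfolding web_def using A_nonempty by auto

lemma closed_web: "closed web"
  unfolding web_eq using closed_landing_ray landing_A finite_A by (intro closed_UN) auto

lemma connected_web: "connected web"
  unfolding web_eq by (intro connected_Union) (use connected_landing_ray landing_A A_nonempty in auto)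

lemma unbounded_web: "\<not> bounded web"
proof
  assume "bounded web"
  then obtain r where r: "\<And>z. z \<in> web \<Longrightarrow> norm z \<le> r" by (meson bounded_iff)
  obtain a where a: "a \<in> A" using A_nonempty by blast
  have "filterlim (rp a) at_infinity at_top" using landing_A[OF a] by (simp add: landing_ray_def)
  hence "filterlim (\<lambda>R. norm (rp a R)) at_top at_top" by (simp add: filterlim_at_infinity_conv_norm_at_top)
  hence "\<forall>\<^sub>F R in at_top. r + 1 \<le> norm (rp a R)" by (simp add: filterlim_at_top)
  with eventually_gt_at_top[of 1] have "\<forall>\<^sub>F R in at_top. R < (0::real)"
  proof eventually_elim
    case (elim R)
    hence "rp a R \<in> web" using a by (auto simp: web_def)
    thus ?case using r[of "rp a R"] elim by simp
  qed
  with eventually_gt_at_top[of 0] have "\<forall>\<^sub>F R in at_top. (0::real) < R \<and> R < 0"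
    by (rule eventually_conj)
  thus False by (auto dest!: eventually_happens)
qed

lemma web_minus_B: "web - B = {p}"
  unfolding web_def using p_notin ray_subset by blast

lemma rp_in_web_iff:
  assumes "R > 1" "t \<in> {0..<1}"
  shows "rp t R \<in> web \<longleftrightarrow> t \<in> A"
proof
  assume "rp t R \<in> web"
  moreover have "rp t R \<noteq> p" using p_notin psi_in norm_polar assms(1) by metis
  ultimately obtain a where "a \<in> A" "rp t R \<in> ray a" unfolding web_def by blast
  thus "t \<in> A" using in_ray_iff[OF assms] A_range by blast
qed (use assms in \<open>auto simp: web_def\<close>)

lemma rp_in_pc_iff: "R > 1 \<Longrightarrow> t \<in> {0..<1} \<Longrightarrow> rp t R \<in> pc a \<longleftrightarrow> t \<in> arc_from a"
  by (rule in_piece_iff)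

lemma pc_disjoint_web:
  assumes "a \<in> A"
  shows "pc a \<inter> web = {}"
proof (rule ccontr)
  assume "pc a \<inter> web \<noteq> {}"
  then obtain z where z: "z \<in> pc a" "z \<in> web" by blast
  then obtain R t where Rt: "R > 1" "t \<in> {0..<1}" "z = rp t R" using B_polar piece_subset by blast
  hence "t \<in> arc_from a" "t \<in> A" using z rp_in_pc_iff rp_in_web_iff by blast+
  thus False using arc_from_disjoint_A[OF assms] by blast
qed

lemma B_minus_web: "B - web = (\<Union>a\<in>A. pc a)"
proof (intro equalityI subsetI)
  fix z assume z: "z \<in> B - web"
  then obtain R t where Rt: "R > 1" "t \<in> {0..<1}" "z = rp t R" using B_polar by blast
  hence "t \<notin> A" using z rp_in_web_iff by blast
  then obtain a where "a \<in> A" "t \<in> arc_from a" using arc_from_cover Rt by blast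
  thus "z \<in> (\<Union>a\<in>A. pc a)" using Rt rp_in_pc_iff by blast
next
  fix z assume "z \<in> (\<Union>a\<in>A. pc a)"
  thus "z \<in> B - web" using pc_disjoint_web piece_subset by blast
qed

definition base_angle :: "real \<Rightarrow> real" where
  "base_angle a = (SOME t. t \<in> arc_from a)"

lemma base_angle: "a \<in> A \<Longrightarrow> base_angle a \<in> arc_from a"
  unfolding base_angle_def using arc_from_nonempty some_in_eq by blast

text \<open>The radius 2 stands for any value above 1, and the base angle for any angle of the arc:
  the whole piece is connected and lies in the same component.\<close>

definition sec :: "real \<Rightarrow> complex set" where
  "sec a = connected_component_set (- web) (rp (base_angle a) 2)"

lemma base_in_pc: "a \<in> A \<Longrightarrow> rp (base_angle a) 2 \<in> pc a"
  using base_angle subsetD[OF oarc_subset base_angle] by (intro rp_in_pc_iff[THEN iffD2]) simp_all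

lemma pc_subset_sec:
  assumes "a \<in> A"
  shows "pc a \<subseteq> sec a"
  unfolding sec_def
  by (rule connected_component_maximal[OF base_in_pc[OF assms] connected_piece])
    (use pc_disjoint_web[OF assms] in blast)

lemma sec_subset: "sec a \<subseteq> - web"
  unfolding sec_def by (rule connected_component_subset)

lemma connected_sec: "connected (sec a)"
  unfolding sec_def by (rule connected_connected_component)

lemma open_sec: "open (sec a)"
  unfolding sec_def using closed_web by (intro open_connected_component) auto

lemma sec_in_components:
  assumes "a \<in> A"
  shows "sec a \<in> components (- web)"
  unfolding sec_def using base_in_pc[OF assms] pc_disjoint_web[OF assms] by (intro componentsI) blast

text \<open>A sector with pieces over two different arcs would join the two sides of the Jordan curve
  formed by infinity and the two rays bounding one of these arcs.\<close>

lemma sec_disjoint_pc: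
  assumes a: "a \<in> A" and c: "c \<in> A" and ne: "a \<noteq> c"
  shows "sec a \<inter> pc c = {}"
proof (rule ccontr)
  assume meet: "sec a \<inter> pc c \<noteq> {}"
  define b where "b = next_angle a"
  define Y where "Y = insert p (ray a \<union> ray b)"
  have b: "b \<in> A" "b \<noteq> a" unfolding b_def by (rule next_angle)+
  have r: "a \<in> {0..<1}" "b \<in> {0..<1}" using a b A_range by blast+
  have YX: "Y \<subseteq> web" unfolding Y_def web_def using a b by blast
  have clY: "closed Y"
    using closed_Un[OF closed_landing_ray[OF landing_A[OF a]] closed_landing_ray[OF landing_A[OF b(1)]]]
    by (simp add: Y_def Un_insert_left Un_insert_right)
  have finY: "finite (Y - B)" using YX web_minus_B by (metis Diff_mono finite.emptyI finite_insert finite_subset order_refl)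
  have pab: "pc a = piece a b" by (simp add: b_def)
  have mem: "rp t R \<in> Y \<longleftrightarrow> t = a \<or> t = b" if "R > 1" "t \<in> {0..<1}" for t R
  proof -
    have "rp t R \<noteq> p" using p_notin psi_in norm_polar that(1) by metis
    thus ?thesis unfolding Y_def using in_ray_iff[OF that] r by blast
  qed
  have BY: "B - Y = piece a b \<union> piece b a"
  proof (intro equalityI subsetI)
    fix z assume z: "z \<in> B - Y"
    then obtain R t where Rt: "R > 1" "t \<in> {0..<1}" "z = rp t R" using B_polar by blast
    hence "t \<noteq> a" "t \<noteq> b" using z mem by blast+
    hence "t \<in> oarc a b \<or> t \<in> oarc b a" using oarc_complement[OF r Rt(2)] b(2) by blast
    thus "z \<in> piece a b \<union> piece b a" using in_piece_iff[OF Rt(1,2)] Rt(3) by blast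
  next
    fix z assume z: "z \<in> piece a b \<union> piece b a"
    then obtain R t where Rt: "R > 1" "t \<in> {0..<1}" "z = rp t R" using B_polar piece_subset by blast
    hence "t \<in> oarc a b \<or> t \<in> oarc b a" using z in_piece_iff by blast
    hence "t \<noteq> a" "t \<noteq> b" by (auto simp: oarc_def)
    thus "z \<in> B - Y" using z piece_subset mem[OF Rt(1,2)] Rt(3) by blast
  qed
  have pcc: "pc c \<subseteq> piece b a"
  proof
    fix z assume z: "z \<in> pc c"
    then obtain R t where Rt: "R > 1" "t \<in> {0..<1}" "z = rp t R" using B_polar piece_subset by blast
    have t: "t \<in> arc_from c" using z Rt rp_in_pc_iff by blast
    hence "t \<notin> oarc a b" "t \<noteq> a" "t \<noteq> b"
      using arc_from_disjoint[OF a c ne] arc_from_disjoint_A[OF c] a b unfolding b_def by blast+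
    hence "t \<in> oarc b a" using oarc_complement[OF r Rt(2)] b(2) by blast
    thus "z \<in> piece b a" using in_piece_iff[OF Rt(1,2)] Rt(3) by blast
  qed
  have sY: "sec a \<subseteq> - Y" using sec_subset YX by blast
  \<comment> \<open>Every component of the complement meets the basin, hence contains one of the two
    pieces. Both pieces meet \<open>sec a\<close>, one through \<open>pc a\<close>, the other
    through \<open>pc c\<close>.\<close>
  have meets: "C \<inter> sec a \<noteq> {}" if C: "C \<in> components (- Y)" for C
  proof -
    have "C \<inter> B \<noteq> {}" by (rule component_meets_cobounded[OF clY open_B bounded_compl_B finY C])
    hence "C \<inter> (piece a b \<union> piece b a) \<noteq> {}" using BY in_components_subset[OF C] by blast
    then consider "C \<inter> piece a b \<noteq> {}" | "C \<inter> piece b a \<noteq> {}" by blast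
    thus ?thesis
    proof cases
      case 1
      hence "piece a b \<subseteq> C" using components_maximal[OF C connected_piece] BY by blast
      thus ?thesis using pc_subset_sec[OF a] base_in_pc[OF a] pab by blast
    next
      case 2
      hence "piece b a \<subseteq> C" using components_maximal[OF C connected_piece] BY by blast
      thus ?thesis using pcc meet by blast
    qed
  qed
  have "connected (- Y)"
    unfolding connected_eq_components_subset_sing_exists
  proof (rule exI, rule subsetI)
    fix C assume C: "C \<in> components (- Y)"
    have "rp (base_angle a) 2 \<in> - Y" using base_in_pc[OF a] pab BY by blast
    hence D: "connected_component_set (- Y) (rp (base_angle a) 2) \<in> components (- Y)" by (rule componentsI)
    have "C = connected_component_set (- Y) (rp (base_angle a) 2)"
      by (rule joinable_components_eq[of "sec a" "- Y"])
        (intro conjI connected_sec sY C D meets[OF C] meets[OF D])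
    thus "C \<in> {connected_component_set (- Y) (rp (base_angle a) 2)}" by simp
  qed
  moreover have "\<not> connected (- Y)"
  proof -
    have "ray a \<inter> ray b = {}" using rays_disjoint r b(2) by blast
    moreover have "rp (base_angle a) 2 \<notin> insert p (ray a \<union> ray b)"
      using base_in_pc[OF a] pab BY unfolding Y_def by blast
    ultimately show ?thesis
      unfolding Y_def using landing_rays_same_point_separate[OF landing_A[OF a] landing_A[OF b(1)]] by blast
  qed
  ultimately show False by blast
qed

lemma sec_Int_B:
  assumes "a \<in> A"
  shows "sec a \<inter> B = pc a"
proof (intro equalityI subsetI)
  fix z assume z: "z \<in> sec a \<inter> B"
  then obtain c where "c \<in> A" "z \<in> pc c" using B_minus_web sec_subset by blast
  thus "z \<in> pc a" using sec_disjoint_pc[OF assms] z by blast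
qed (use pc_subset_sec[OF assms] piece_subset in blast)

text \<open>The web leaves the basin only at \<open>p\<close>, so each component meets a piece and
  is the sector of that piece.\<close>

lemma components_eq: "components (- web) = sec ` A"
proof (intro equalityI subsetI)
  fix C assume C: "C \<in> components (- web)"
  have "C \<inter> B \<noteq> {}"
    by (rule component_meets_cobounded[OF closed_web open_B bounded_compl_B _ C]) (simp add: web_minus_B)
  then obtain a where a: "a \<in> A" "C \<inter> pc a \<noteq> {}" using B_minus_web in_components_subset[OF C] by blast
  hence "C \<inter> sec a \<noteq> {}" using pc_subset_sec by blast
  hence "C = sec a" using components_nonoverlap[OF C sec_in_components[OF a(1)]] by blast
  thus "C \<in> sec ` A" using a by blast
qed (use sec_in_components in blast)

lemma sec_disjoint:
  assumes "a \<in> A" "b \<in> A" "a \<noteq> b"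
  shows "sec a \<inter> sec b = {}"
proof (rule ccontr)
  assume "sec a \<inter> sec b \<noteq> {}"
  hence "sec a = sec b"
    using components_nonoverlap[OF sec_in_components sec_in_components] assms by blast
  thus False using sec_disjoint_pc[OF assms] base_in_pc[OF assms(2)] pc_subset_sec[OF assms(2)] by blast
qed

lemma sec_nonempty: "a \<in> A \<Longrightarrow> sec a \<noteq> {}"
  using base_in_pc pc_subset_sec by blast

lemma inj_on_sec: "inj_on sec A"
  by (rule inj_onI) (metis inf.idem sec_disjoint sec_nonempty)

lemma Union_sec: "- web = (\<Union>a\<in>A. sec a)"
  using Union_components[of "- web"] unfolding components_eq by simp

lemma p_in_closure_sec:
  assumes a: "a \<in> A"
  shows "p \<in> closure (sec a)"
proof (rule Lim_in_closed_set[OF closed_closure])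
  show "(rp a \<longlongrightarrow> p) (at_right 1)" by (rule lands[OF a])
  have "\<forall>\<^sub>F R in at_right (1::real). R \<in> {1<..<2}" by (intro eventually_at_right_real) simp
  thus "\<forall>\<^sub>F R in at_right 1. rp a R \<in> closure (sec a)"
  proof eventually_elim
    case (elim R)
    hence "rp a R \<in> closure (pc a)" using gap_pos[OF a] by (intro ray_in_closure_piece) auto
    thus ?case using closure_mono[OF pc_subset_sec[OF a]] by blast
  qed
qed simp

text \<open>The complement consists of the web and the other sectors, all attached at
  \<open>p\<close>; so it is connected, and it is unbounded because of the rays. An open connected
  planar set whose complement has no bounded component is simply connected.\<close>

lemma simply_connected_sec:
  assumes a: "a \<in> A"
  shows "simply_connected (sec a)"
proof -
  have eq: "- sec a = web \<union> (\<Union>c\<in>A - {a}. insert p (sec c))"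
  proof (intro equalityI subsetI)
    fix z assume z: "z \<in> - sec a"
    show "z \<in> web \<union> (\<Union>c\<in>A - {a}. insert p (sec c))"
    proof (cases "z \<in> web")
      case False
      hence "z \<in> (\<Union>c\<in>A. sec c)" using Union_sec by blast
      thus ?thesis using z by blast
    qed blast
  next
    fix z assume z: "z \<in> web \<union> (\<Union>c\<in>A - {a}. insert p (sec c))"
    have "p \<in> web" by (simp add: web_def)
    thus "z \<in> - sec a" using z sec_subset[of a] sec_disjoint[OF a] by blast
  qed
  have con: "connected (insert p (sec c))" if "c \<in> A" for c
    by (rule connected_intermediate_closure[OF connected_sec])
      (use p_in_closure_sec[OF that] closure_subset in auto)
  have "connected (\<Union>(insert web ((\<lambda>c. insert p (sec c)) ` (A - {a}))))"
    by (rule connected_Union) (use con connected_web in \<open>auto simp: web_def\<close>)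
  hence "connected (- sec a)" unfolding eq by simp
  moreover have "\<not> bounded (- sec a)" using unbounded_web eq by (metis bounded_subset sup_ge1)
  ultimately have "\<forall>C\<in>components (- sec a). \<not> bounded C"
    using connected_eq_components_subset_sing by blast
  thus ?thesis
    unfolding simply_connected_eq_unbounded_complement_components[OF open_sec]
    using connected_sec by blast
qed

lemma sec_angles:
  assumes a: "a \<in> A"
  shows "{t\<in>{0..<1}. \<exists>z \<in> sec a \<inter> B. z \<in> ray t} = arc_from a"
proof (intro equalityI subsetI)
  fix t assume "t \<in> {t\<in>{0..<1}. \<exists>z \<in> sec a \<inter> B. z \<in> ray t}"
  then obtain R where "t \<in> {0..<1}" "R > 1" "rp t R \<in> sec a \<inter> B" by auto
  thus "t \<in> arc_from a" unfolding sec_Int_B[OF a] using rp_in_pc_iff by blast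
next
  fix t assume t: "t \<in> arc_from a"
  have tr: "t \<in> {0..<1}" using t oarc_subset by blast
  hence "rp t 2 \<in> pc a" using t by (subst rp_in_pc_iff) auto
  hence "rp t 2 \<in> sec a \<inter> B" using sec_Int_B[OF a] by blast
  moreover have "rp t 2 \<in> ray t" by (rule image_eqI[where x = 2]) auto
  ultimately show "t \<in> {t\<in>{0..<1}. \<exists>z \<in> sec a \<inter> B. z \<in> ray t}" using tr by blast
qed

lemma frontier_sec: "a \<in> A \<Longrightarrow> frontier (sec a) \<subseteq> web"
  using frontier_of_components_closed_complement[OF closed_web sec_in_components] .

end

section \<open>A step between two consecutive times\<close>

text \<open>\<open>only_A\<close> is the clause that no other ray lands at \<open>p\<close>. It
  makes the local degree at \<open>p\<close> equal to one, and it separates the landing points of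
  two rays with angles in and off \<open>A\<close>.\<close>

locale portrait_step =
  X: portrait_chart B \<phi> A p + Y: portrait_chart B' \<phi>' A' p' + S: angle_step A A' "degree f"
  for B \<phi> A p B' \<phi>' A' p' and f :: "complex poly" +
  assumes in_B: "\<And>z. poly f z \<in> B' \<longleftrightarrow> z \<in> B"
    and conj: "\<And>z. z \<in> B \<Longrightarrow> \<phi>' (poly f z) = \<phi> z ^ degree f"
    and f_p: "poly f p = p'"
    and only_A: "\<And>t. t \<in> {0..<1} \<Longrightarrow> (X.rp t \<longlongrightarrow> p) (at_right 1) \<Longrightarrow> t \<in> A"
begin

abbreviation d :: nat where "d \<equiv> degree f"

lemma degree_pos: "d > 0"
  using S.d_ge_2 by simp

lemma f_rp:
  assumes "R > 1"
  shows "poly f (X.rp t R) = Y.rp (S.im t) (R ^ d)"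
proof -
  have z: "X.rp t R \<in> B" using X.psi_in X.norm_polar assms by blast
  have "\<phi>' (poly f (X.rp t R)) = (of_real R * circle_exp t) ^ d"
    using conj[OF z] X.phi_psi[OF X.norm_polar[OF assms]] by simp
  also have "\<dots> = of_real (R ^ d) * circle_exp (S.im t)"
    by (simp add: power_mult_distrib circle_exp_power circle_exp_angle_mult)
  finally have "\<phi>' (poly f (X.rp t R)) = of_real (R ^ d) * circle_exp (S.im t)" .
  thus ?thesis using Y.psi_phi[of "poly f (X.rp t R)"] in_B z by metis
qed

lemma power_gt_1: "R > 1 \<Longrightarrow> R ^ d > (1::real)"
  using degree_pos by simp

lemma f_web: "z \<in> X.web \<Longrightarrow> poly f z \<in> Y.web"
proof -
  assume "z \<in> X.web"
  then consider "z = p" | a R where "a \<in> A" "R > 1" "z = X.rp a R" unfolding X.web_def by auto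
  thus "poly f z \<in> Y.web"
  proof cases
    case 1
    thus ?thesis by (simp add: f_p Y.web_def)
  next
    case 2
    have "poly f z = Y.rp (S.im a) (R ^ d)" using f_rp[OF 2(2)] 2(3) by simp
    moreover have "Y.rp (S.im a) (R ^ d) \<in> Y.ray (S.im a)"
      using power_gt_1[OF 2(2)] by (intro image_eqI[where x = "R ^ d"]) auto
    ultimately have "poly f z \<in> Y.ray (S.im a)" by metis
    thus ?thesis unfolding Y.web_def by (intro insertI2 UN_I[OF S.im_in[OF 2(1)]])
  qed
qed

lemma preimage_sectors: "poly f -` (- Y.web) \<subseteq> (\<Union>a\<in>A. X.sec a)"
  using f_web X.Union_sec by blast

text \<open>By the conjugacy, the derivative of the d-th power of \<open>\<phi>\<close> would vanish
  as well; but \<open>\<phi>\<close> is injective and has no zeros.\<close>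

lemma noncritical_in_B:
  assumes "z \<in> B"
  shows "\<not> critical_point f z"
proof
  assume c: "critical_point f z"
  have fz: "poly f z \<in> B'" using assms in_B by blast
  have d1: "(\<phi> has_field_derivative deriv \<phi> z) (at z)"
    using X.holo X.open_B assms holomorphic_derivI by blast
  have d2: "(\<phi>' has_field_derivative deriv \<phi>' (poly f z)) (at (poly f z))"
    using Y.holo Y.open_B fz holomorphic_derivI by blast
  have "((\<phi>' \<circ> poly f) has_field_derivative deriv \<phi>' (poly f z) * poly (pderiv f) z) (at z)"
    by (rule DERIV_chain[OF d2 poly_DERIV])
  hence D1: "((\<phi>' \<circ> poly f) has_field_derivative 0) (at z)" using c by (simp add: critical_point_def)
  have D2: "((\<lambda>z. \<phi> z ^ d) has_field_derivative of_nat d * (deriv \<phi> z * \<phi> z ^ (d - Suc 0))) (at z)"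
    by (rule DERIV_power[OF d1])
  have "\<forall>\<^sub>F y in nhds z. y \<in> B" using X.open_B assms by (rule eventually_nhds_in_open)
  hence "\<forall>\<^sub>F y in nhds z. (\<phi>' \<circ> poly f) y = \<phi> y ^ d"
    by eventually_elim (simp add: conj)
  from DERIV_cong_ev[OF refl this refl] D1
  have "((\<lambda>z. \<phi> z ^ d) has_field_derivative 0) (at z)" by blast
  hence "of_nat d * (deriv \<phi> z * \<phi> z ^ (d - Suc 0)) = 0" using DERIV_unique[OF D2] by blast
  moreover have "deriv \<phi> z \<noteq> 0"
    by (rule holomorphic_injective_imp_regular[OF X.holo X.open_B X.inj_phi assms])
  moreover have "\<phi> z \<noteq> 0" using X.phi_norm[OF assms] by auto
  ultimately show False using degree_pos by simp
qed

lemma fibre_over_B: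
  assumes "R > 1" "\<theta> \<in> {0..<1}" "poly f z = Y.rp \<theta> (R ^ d)"
  obtains t where "t \<in> {0..<1}" "S.im t = \<theta>" "z = X.rp t R"
proof -
  have R': "R ^ d > 1" by (rule power_gt_1[OF assms(1)])
  have "Y.rp \<theta> (R ^ d) \<in> B'" using Y.psi_in Y.norm_polar R' by blast
  hence "z \<in> B" using in_B assms(3) by metis
  then obtain r t where rt: "r > 1" "t \<in> {0..<1}" "z = X.rp t r" using X.B_polar by blast
  have "Y.rp (S.im t) (r ^ d) = Y.rp \<theta> (R ^ d)" using f_rp[OF rt(1)] rt(3) assms(3) by metis
  hence eq: "of_real (r ^ d) * circle_exp (S.im t) = of_real (R ^ d) * circle_exp \<theta>"
    using Y.psi_inj Y.norm_polar power_gt_1 rt(1) assms(1) by blast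
  have pos: "r ^ d > 0" "R ^ d > 0" using rt(1) assms(1) by auto
  have "r ^ d = R ^ d" by (rule polar_unique(1)[OF pos eq])
  hence "r = R" using rt(1) assms(1) degree_pos by (simp add: power_eq_iff_eq_base)
  moreover have "S.im t = \<theta>"
    using polar_unique(2)[OF pos eq] assms(2) angle_mult_range by (metis frac_eq_id)
  ultimately show thesis using that rt by blast
qed

text \<open>Over the basin all roots are simple and have the same radius, so they are counted by
  their angles.\<close>

lemma root_count_over_B:
  assumes a: "a \<in> A" and R: "R > 1" and \<theta>: "\<theta> \<in> {0..<1}"
  shows "root_count f (X.sec a) (Y.rp \<theta> R) =
    (if \<theta> \<in> Y.arc_from (S.im a) then S.extra a + 1 else S.extra a)"
proof -
  \<comment> \<open>\<open>f\<close> raises radii to the power d.\<close>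
  define r where "r = root d R"
  have r: "r > 1" "r ^ d = R" unfolding r_def using R degree_pos by simp_all
  have B': "Y.rp \<theta> R \<in> B'" using Y.psi_in Y.norm_polar R by blast
  have "root_count f (X.sec a) (Y.rp \<theta> R) = card {z\<in>X.sec a. poly f z = Y.rp \<theta> R}"
    by (rule root_count_eq_card[OF degree_pos]) (use B' in_B noncritical_in_B in metis)
  also have "{z\<in>X.sec a. poly f z = Y.rp \<theta> R} = (\<lambda>t. X.rp t r) ` {t\<in>X.arc_from a. S.im t = \<theta>}"
  proof (intro equalityI subsetI)
    fix z assume z: "z \<in> {z\<in>X.sec a. poly f z = Y.rp \<theta> R}"
    hence "poly f z = Y.rp \<theta> (r ^ d)" using r by simp
    then obtain t where t: "t \<in> {0..<1}" "S.im t = \<theta>" "z = X.rp t r"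
      by (rule fibre_over_B[OF r(1) \<theta>])
    have "z \<in> X.sec a \<inter> B" using z t(3) X.psi_in X.norm_polar r(1) by blast
    hence "t \<in> X.arc_from a" unfolding X.sec_Int_B[OF a] using X.rp_in_pc_iff[OF r(1) t(1)] t(3) by blast
    thus "z \<in> (\<lambda>t. X.rp t r) ` {t\<in>X.arc_from a. S.im t = \<theta>}" using t by blast
  next
    fix z assume "z \<in> (\<lambda>t. X.rp t r) ` {t\<in>X.arc_from a. S.im t = \<theta>}"
    then obtain t where t: "t \<in> X.arc_from a" "S.im t = \<theta>" "z = X.rp t r" by blast
    have "t \<in> {0..<1}" using t(1) oarc_subset by blast
    hence "z \<in> X.sec a" using t X.rp_in_pc_iff[OF r(1)] X.pc_subset_sec[OF a] by blast
    moreover have "poly f z = Y.rp \<theta> R" using f_rp[OF r(1)] t r(2) by simp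
    ultimately show "z \<in> {z\<in>X.sec a. poly f z = Y.rp \<theta> R}" by blast
  qed
  also have "card \<dots> = card {t\<in>X.arc_from a. S.im t = \<theta>}"
  proof (rule card_image, rule inj_onI)
    fix s t assume st: "s \<in> {t\<in>X.arc_from a. S.im t = \<theta>}" "t \<in> {t\<in>X.arc_from a. S.im t = \<theta>}"
      "X.rp s r = X.rp t r"
    have "s \<in> {0..<1}" "t \<in> {0..<1}" using st oarc_subset by blast+
    moreover have "X.rp s r \<in> X.ray t" using st(3) r(1) by auto
    ultimately show "s = t" using X.in_ray_iff[OF r(1)] by blast
  qed
  also have "\<dots> = (if \<theta> \<in> Y.arc_from (S.im a) then S.extra a + 1 else S.extra a)"
    by (rule S.fibre_in_arc(2)[OF a \<theta>])
  finally show ?thesis .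
qed

text \<open>No root over a sector lies on the web, so the other sectors form the complementary open
  set, and the count is that at a marked basin point of the sector.\<close>

lemma root_count_on_sector:
  assumes a: "a \<in> A" and c: "c \<in> A'" and w: "w \<in> Y.sec c"
  shows "root_count f (X.sec a) w = (if c = S.im a then S.extra a + 1 else S.extra a)"
proof -
  define w' where "w' = Y.rp (Y.base_angle c) 2"
  have w': "w' \<in> Y.sec c" unfolding w'_def using Y.base_in_pc[OF c] Y.pc_subset_sec[OF c] by blast
  have "root_count f (X.sec a) w = root_count f (X.sec a) w'"
  proof (rule root_count_partition_const[OF degree_pos X.open_sec _ _ Y.connected_sec _ w w'])
    show "open (\<Union>b\<in>A - {a}. X.sec b)" using X.open_sec by blast
    show "X.sec a \<inter> (\<Union>b\<in>A - {a}. X.sec b) = {}" using X.sec_disjoint[OF a] by blast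
    show "poly f -` Y.sec c \<subseteq> X.sec a \<union> (\<Union>b\<in>A - {a}. X.sec b)"
      using preimage_sectors Y.sec_subset[of c] by blast
  qed
  also have "\<dots> = (if Y.base_angle c \<in> Y.arc_from (S.im a) then S.extra a + 1 else S.extra a)"
    unfolding w'_def
    by (rule root_count_over_B[OF a]) (use subsetD[OF oarc_subset Y.base_angle[OF c]] in auto)
  also have "Y.base_angle c \<in> Y.arc_from (S.im a) \<longleftrightarrow> c = S.im a"
    using Y.base_angle[OF c] Y.arc_from_disjoint[OF c S.im_in[OF a]] by blast
  finally show ?thesis .
qed

lemma preimage_rays_land:
  assumes "S.im t \<in> A'"
  obtains q where "poly f q = p'" "(X.rp t \<longlongrightarrow> q) (at_right 1)"
proof -
  have cont: "continuous_on {1<..} (X.rp t)"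
    by (rule continuous_on_compose2[OF X.continuous_on_psi]) (auto intro!: continuous_intros simp: norm_mult)
  have "filterlim (\<lambda>R::real. R ^ d) (at_right 1) (at_right 1)"
    unfolding filterlim_at
  proof
    have "((\<lambda>R::real. R ^ d) \<longlongrightarrow> 1 ^ d) (at_right 1)" by (intro tendsto_intros)
    thus "((\<lambda>R::real. R ^ d) \<longlongrightarrow> 1) (at_right 1)" by simp
    have "\<forall>\<^sub>F R in at_right (1::real). R \<in> {1<..<2}" by (intro eventually_at_right_real) simp
    thus "\<forall>\<^sub>F R in at_right (1::real). R ^ d \<in> {1<..} \<and> R ^ d \<noteq> 1"
      by eventually_elim (use power_gt_1 in fastforce)
  qed
  from filterlim_compose[OF Y.lands[OF assms] this]
  have "((\<lambda>R. Y.rp (S.im t) (R ^ d)) \<longlongrightarrow> p') (at_right 1)" .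
  moreover have "\<forall>\<^sub>F R in at_right (1::real). Y.rp (S.im t) (R ^ d) = poly f (X.rp t R)"
  proof -
    have "\<forall>\<^sub>F R in at_right (1::real). R \<in> {1<..<2}" by (intro eventually_at_right_real) simp
    thus ?thesis by eventually_elim (use f_rp in simp)
  qed
  ultimately have "((\<lambda>R. poly f (X.rp t R)) \<longlongrightarrow> p') (at_right 1)"
    by (rule Lim_transform_eventually)
  from preimage_ray_lands[OF degree_pos cont this] show thesis using that by blast
qed

text \<open>Each of the rays landing at \<open>p'\<close> has only one preimage landing at \<open>p\<close>, so the local degree at \<open>p\<close> is one.\<close>

lemma order_p: "order p (f - [:p':]) = 1"
proof -
  obtain a where a: "a \<in> A" using X.A_nonempty by blast
  define T where "T = {t\<in>{0..<1}. S.im t = S.im a}"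
  have "finite T"
  proof -
    have "T \<subseteq> A \<union> (\<Union>c\<in>A. {t\<in>X.arc_from c. S.im t = S.im a})"
    proof
      fix t assume "t \<in> T"
      hence t: "t \<in> {0..<1}" "S.im t = S.im a" unfolding T_def by blast+
      show "t \<in> A \<union> (\<Union>c\<in>A. {t\<in>X.arc_from c. S.im t = S.im a})"
      proof (cases "t \<in> A")
        case False
        then obtain c where "c \<in> A" "t \<in> X.arc_from c" using X.arc_from_cover t(1) by blast
        thus ?thesis using t by blast
      qed blast
    qed
    moreover have "finite {t\<in>X.arc_from c. S.im t = S.im a}" if "c \<in> A" for c
      by (rule S.fibre_in_arc(1)[OF that Y.A_range[OF S.im_in[OF a]]])
    ultimately show ?thesis using X.finite_A by (meson finite_UN finite_Un finite_subset)
  qed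
  \<comment> \<open>Another ray with the same image lands at a root over \<open>p'\<close>. This
    root is not \<open>p\<close>, since \<open>a\<close> is the only angle of \<open>A\<close> over
    \<open>S.im a\<close>.\<close>
  have "\<exists>q. q \<noteq> p \<and> (X.rp t \<longlongrightarrow> q) (at_right 1)" if t: "t \<in> T - {a}" for t
  proof -
    have im: "S.im t = S.im a" "t \<in> {0..<1}" "t \<noteq> a" using t unfolding T_def by blast+
    obtain q where q: "(X.rp t \<longlongrightarrow> q) (at_right 1)"
      using preimage_rays_land[of t] im S.im_in[OF a] by metis
    have "q \<noteq> p"
    proof
      assume "q = p"
      hence "t \<in> A" using only_A im(2) q by blast
      thus False using S.im_inj a im by blast
    qed
    thus ?thesis using q by blast
  qed
  then obtain q where q: "\<And>t. t \<in> T - {a} \<Longrightarrow> q t \<noteq> p \<and> (X.rp t \<longlongrightarrow> q t) (at_right 1)" by metis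
  obtain e where e: "e > 0" "\<And>x. x \<in> q ` (T - {a}) \<Longrightarrow> x \<noteq> p \<Longrightarrow> e \<le> dist p x"
    using finite_set_avoid[of "q ` (T - {a})" p] \<open>finite T\<close> by blast
  have far: "\<forall>\<^sub>F R in at_right 1. \<forall>t\<in>T - {a}. X.rp t R \<notin> ball p (e / 2)"
  proof (rule eventually_ball_finite)
    show "\<forall>t\<in>T - {a}. \<forall>\<^sub>F R in at_right 1. X.rp t R \<notin> ball p (e / 2)"
    proof
      fix t assume t: "t \<in> T - {a}"
      have dq: "e \<le> dist p (q t)" using e(2) q[OF t] t by blast
      have "\<forall>\<^sub>F R in at_right 1. dist (X.rp t R) (q t) < e / 2"
        using q[OF t] e(1) by (intro tendstoD) auto
      thus "\<forall>\<^sub>F R in at_right 1. X.rp t R \<notin> ball p (e / 2)"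
      proof eventually_elim
        case (elim R)
        have "dist p (q t) \<le> dist p (X.rp t R) + dist (X.rp t R) (q t)" by (rule dist_triangle)
        thus ?case using elim dq by simp
      qed
    qed
  qed (use \<open>finite T\<close> in simp)
  have "((\<lambda>R. poly f (X.rp a R)) \<longlongrightarrow> poly f p) (at_right 1)"
    by (rule isCont_tendsto_compose[OF _ X.lands[OF a]]) simp
  hence lim: "filterlim (\<lambda>R. poly f (X.rp a R)) (nhds p') (at_right 1)" by (simp add: f_p)
  \<comment> \<open>For R close to 1 the ball contains at least as many roots over
    \<open>poly f (X.rp a R)\<close> as the order at \<open>p\<close>, but by \<open>far\<close>
    only the one on the ray of angle \<open>a\<close>.\<close>
  have near: "\<forall>\<^sub>F R in at_right 1. order p (f - [:p':]) \<le> root_count f (ball p (e / 2)) (poly f (X.rp a R))"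
    using order_le_root_count_ball[OF degree_pos f_p, of "e / 2"] e(1)
    by (intro filterlim_iff[THEN iffD1, OF lim, rule_format]) simp
  have "\<forall>\<^sub>F R in at_right (1::real). R \<in> {1<..<2}" by (intro eventually_at_right_real) simp
  with far near have "\<forall>\<^sub>F R in at_right (1::real). order p (f - [:p':]) \<le> 1"
  proof eventually_elim
    case (elim R)
    have R: "R > 1" using elim by simp
    let ?w = "poly f (X.rp a R)"
    have w: "?w = Y.rp (S.im a) (R ^ d)" by (rule f_rp[OF R])
    have wB: "?w \<in> B'" using in_B X.psi_in X.norm_polar[OF R] by blast
    have "root_count f (ball p (e / 2)) ?w = card {z\<in>ball p (e / 2). poly f z = ?w}"
      by (rule root_count_eq_card[OF degree_pos]) (use wB in_B noncritical_in_B in metis)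
    also have "\<dots> \<le> card {X.rp a R}"
    proof (rule card_mono)
      show "{z\<in>ball p (e / 2). poly f z = ?w} \<subseteq> {X.rp a R}"
      proof
        fix z assume z: "z \<in> {z\<in>ball p (e / 2). poly f z = ?w}"
        hence "poly f z = Y.rp (S.im a) (R ^ d)" using w by simp
        then obtain t where t: "t \<in> {0..<1}" "S.im t = S.im a" "z = X.rp t R"
          by (rule fibre_over_B[OF R Y.A_range[OF S.im_in[OF a]]])
        have "t = a"
        proof (rule ccontr)
          assume "t \<noteq> a"
          hence "t \<in> T - {a}" using t unfolding T_def by blast
          thus False using elim z t(3) by blast
        qed
        thus "z \<in> {X.rp a R}" using t by blast
      qed
    qed simp
    finally show ?case using elim by simp
  qed
  hence "order p (f - [:p':]) \<le> 1" by simp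
  thus ?thesis using order_fibre_pos[OF degree_pos f_p] by simp
qed

lemma noncritical_p: "\<not> critical_point f p"
  using critical_point_iff_order[OF degree_pos] order_p f_p by metis

text \<open>Semicontinuity bounds each count by \<open>S.extra\<close>. These bounds add up to d -
  1, exactly the number of roots over \<open>p'\<close> apart from the simple root \<open>p\<close>;
  so no bound is strict.\<close>

lemma root_count_at_p':
  assumes a: "a \<in> A"
  shows "root_count f (X.sec a) p' = S.extra a"
proof -
  have le: "root_count f (X.sec b) p' \<le> S.extra b" if b: "b \<in> A" for b
  proof -
    \<comment> \<open>Any sector other than that at \<open>S.im b\<close> serves: it has
      \<open>p'\<close> in its closure, and over it the count is \<open>S.extra b\<close> and not
      one more.\<close>
    define c where "c = Y.next_angle (S.im b)"
    have c: "c \<in> A'" "c \<noteq> S.im b" unfolding c_def by (rule Y.next_angle)+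
    obtain e where e: "e > 0" "\<And>w. dist w p' < e \<Longrightarrow> root_count f (X.sec b) p' \<le> root_count f (X.sec b) w"
      using root_count_lsc[OF degree_pos X.open_sec, of b p'] unfolding eventually_nhds_metric by blast
    obtain w where "w \<in> Y.sec c" "dist w p' < e"
      using Y.p_in_closure_sec[OF c(1)] e(1) unfolding closure_approachable by blast
    thus ?thesis using e(2)[of w] root_count_on_sector[OF b c(1)] c(2) by simp
  qed
  have web: "root_count f X.web p' = 1"
  proof -
    \<comment> \<open>The rest of the web lies in the basin, whose points are not mapped to
      \<open>p'\<close>.\<close>
    have "{z\<in>X.web. poly f z = p'} = {p}"
    proof (intro equalityI subsetI)
      fix z assume z: "z \<in> {z\<in>X.web. poly f z = p'}"
      hence "z \<notin> B" using in_B Y.p_notin by blast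
      thus "z \<in> {p}" using z X.web_minus_B by blast
    qed (auto simp: X.web_def f_p)
    thus ?thesis by (simp add: root_count_def order_p)
  qed
  have "X.web \<union> (\<Union>b\<in>A. X.sec b) = UNIV" using X.Union_sec by blast
  hence "d = root_count f (X.web \<union> (\<Union>b\<in>A. X.sec b)) p'" using root_count_UNIV[OF degree_pos] by simp
  also have "\<dots> = 1 + root_count f (\<Union>b\<in>A. X.sec b) p'"
    using web X.Union_sec by (subst root_count_Un[OF degree_pos]) auto
  also have "root_count f (\<Union>b\<in>A. X.sec b) p' = (\<Sum>b\<in>A. root_count f (X.sec b) p')"
    using X.sec_disjoint X.finite_A by (intro root_count_UNION[OF degree_pos]) auto
  finally have "(\<Sum>b\<in>A. root_count f (X.sec b) p') = (\<Sum>b\<in>A. S.extra b)"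
    using S.sum_extra by simp
  moreover have "(\<Sum>b\<in>A. root_count f (X.sec b) p') < (\<Sum>b\<in>A. S.extra b)"
    if "root_count f (X.sec a) p' \<noteq> S.extra a"
    using that le a X.finite_A by (intro sum_strict_mono_ex1) (auto simp: order_less_le)
  ultimately show ?thesis by linarith
qed

lemma root_count_sec:
  assumes a: "a \<in> A"
  shows "root_count f (X.sec a) w = (if w \<in> Y.sec (S.im a) then S.extra a + 1 else S.extra a)"
proof -
  consider "w = p'" | c R where "c \<in> A'" "R > 1" "w = Y.rp c R" | c where "c \<in> A'" "w \<in> Y.sec c"
    using Y.Union_sec unfolding Y.web_def by blast
  thus ?thesis
  proof cases
    case 1
    have "p' \<notin> Y.sec (S.im a)" using Y.sec_subset unfolding Y.web_def by blast
    thus ?thesis using root_count_at_p'[OF a] 1 by simp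
  next
    case 2
    have "w \<in> Y.web" using 2 unfolding Y.web_def by blast
    hence "w \<notin> Y.sec (S.im a)" using Y.sec_subset by blast
    moreover have "c \<notin> Y.arc_from (S.im a)" using Y.arc_from_disjoint_A[OF S.im_in[OF a]] 2(1) by blast
    ultimately show ?thesis using root_count_over_B[OF a 2(2) Y.A_range[OF 2(1)]] 2(3) by simp
  next
    case 3
    have "w \<in> Y.sec (S.im a) \<longleftrightarrow> c = S.im a" using 3 Y.sec_disjoint[OF 3(1) S.im_in[OF a]] by blast
    thus ?thesis using root_count_on_sector[OF a 3] by simp
  qed
qed

end

section \<open>Images of sectors, critical points and the local picture at the base point\<close>

context portrait_step
begin

lemma image_sec:
  assumes a: "a \<in> A"
  shows "poly f ` X.sec a = (if S.extra a = 0 then Y.sec (S.im a) else UNIV)"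
proof -
  have "w \<in> poly f ` X.sec a \<longleftrightarrow> w \<in> (if S.extra a = 0 then Y.sec (S.im a) else UNIV)" for w
    using root_count_eq_0_iff[OF degree_pos, of "X.sec a" w] root_count_sec[OF a, of w] by (auto split: if_splits)
  thus ?thesis by blast
qed

lemma inj_on_sec_noncritical:
  assumes a: "a \<in> A" and e: "S.extra a = 0"
  shows "inj_on (poly f) (X.sec a)"
proof (rule inj_onI)
  fix x y assume xy: "x \<in> X.sec a" "y \<in> X.sec a" "poly f x = poly f y"
  have "card {z\<in>X.sec a. poly f z = poly f y} \<le> root_count f (X.sec a) (poly f y)"
    by (rule card_fibre_le_root_count[OF degree_pos])
  also have "\<dots> \<le> 1" using root_count_sec[OF a] e by simp
  finally have "card {z\<in>X.sec a. poly f z = poly f y} \<le> Suc 0" by simp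
  hence "\<forall>u\<in>{z\<in>X.sec a. poly f z = poly f y}. \<forall>v\<in>{z\<in>X.sec a. poly f z = poly f y}. u = v"
    using card_le_Suc0_iff_eq[OF finite_poly_fibre_on[OF degree_pos]] by blast
  thus "x = y" using xy by blast
qed

lemma noncritical_sec:
  assumes a: "a \<in> A" and e: "S.extra a = 0" and z: "z \<in> X.sec a"
  shows "\<not> critical_point f z"
  using holomorphic_injective_imp_regular[OF holomorphic_on_poly X.open_sec inj_on_sec_noncritical[OF a e] z]
  by (simp add: deriv_poly critical_point_def)

lemma homeomorphism_sec:
  assumes a: "a \<in> A" and e: "S.extra a = 0"
  shows "\<exists>g. homeomorphism (X.sec a) (Y.sec (S.im a)) (poly f) g"
proof -
  obtain g where "homeomorphism (X.sec a) (poly f ` X.sec a) (poly f) g"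
    using invariance_of_domain_homeomorphism[OF X.open_sec continuous_on_poly _ inj_on_sec_noncritical[OF a e]]
    by auto
  thus ?thesis using image_sec[OF a] e by auto
qed

text \<open>The first of the \<open>k\<close> subsectors over the critical value sector is bounded by the ray of angle \<open>a\<close>,
  landing at \<open>p\<close>, and by a ray landing at another preimage of \<open>p'\<close>. If it contained no critical
  point it would be mapped bijectively; then it would be a component of the complement of two
  disjoint half-open arcs and a finite set, which is connected.\<close>

lemma critical_point_over_value_sector:
  assumes a: "a \<in> A" and e: "S.extra a \<ge> 1"
  shows "\<exists>c\<in>X.sec a. critical_point f c \<and> poly f c \<in> Y.sec (S.im a)"
proof -
  define a' where "a' = S.im a"
  define b' where "b' = Y.next_angle a'"
  have a': "a' \<in> A'" unfolding a'_def by (rule S.im_in[OF a])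
  have b': "b' \<in> A'" unfolding b'_def by (rule Y.next_angle(1))
  \<comment> \<open>The turn after which the image has run once through the arc at
    \<open>a'\<close>; \<open>a1\<close> is the end of the first of the \<open>S.extra a + 1\<close>
    subarcs over it.\<close>
  define x where "x = Y.gap a' / d"
  define a1 where "a1 = frac (a + x)"
  have gp: "0 < Y.gap a'" "Y.gap a' < 1" using Y.gap_pos[OF a'] frac_lt_1 by auto
  have x: "0 < x" "x < 1" "d * x = Y.gap a'" using gp degree_pos S.d_ge_2 by (auto simp: x_def field_simps)
  \<comment> \<open>Here \<open>S.extra a \<ge> 1\<close> enters: \<open>a1\<close> lies inside the
    arc, so it is not an angle of \<open>A\<close>.\<close>
  have xgap: "x < X.gap a"
  proof -
    have "d * x < d * X.gap a" unfolding x(3) S.d_gap[OF a] a'_def using e by simp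
    thus ?thesis using degree_pos by simp
  qed
  have ar: "a \<in> {0..<1}" by (rule X.A_range[OF a])
  have a1r: "a1 \<in> {0..<1}" unfolding a1_def by (simp add: frac_lt_1)
  have fa1: "frac (a1 - a) = x"
  proof -
    have "a1 - a - x \<in> \<int>" using frac_diff_Ints(1)[of "a + x"] by (simp add: a1_def algebra_simps)
    thus ?thesis using x by (simp add: frac_unique_iff)
  qed
  have a1arc: "a1 \<in> X.arc_from a" using a1r fa1 x xgap by (simp add: oarc_def del: frac_gt_0_iff)
  hence a1A: "a1 \<notin> A" using X.arc_from_disjoint_A[OF a] by blast
  hence aa1: "a \<noteq> a1" using a by blast
  have ima1: "S.im a1 = b'"
  proof -
    have "frac (S.im a1 - a') = frac (d * x)" unfolding a'_def fa1[symmetric] by (rule frac_mult_gap[symmetric])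
    also have "\<dots> = frac (b' - a')" unfolding x(3) b'_def by simp
    finally have "(S.im a1 - a') - (b' - a') \<in> \<int>" unfolding frac_eq_iff_diff_Ints .
    hence "frac (S.im a1) = frac b'" unfolding frac_eq_iff_diff_Ints by simp
    thus ?thesis using angle_mult_range Y.A_range[OF b'] by (metis frac_eq_id)
  qed
  let ?S' = "Y.sec a'"
  let ?Q = "X.piece a a1"
  have Qin: "X.rp t R \<in> ?Q \<longleftrightarrow> t \<in> oarc a a1" if "R > 1" "t \<in> {0..<1}" for t R
    by (rule X.in_piece_iff[OF that])
  have sub: "oarc a a1 \<subseteq> X.arc_from a"
    using fa1 xgap by (auto simp: oarc_def simp del: frac_gt_0_iff)
  have Qpc: "?Q \<subseteq> X.pc a"
  proof
    fix z assume z: "z \<in> ?Q"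
    then obtain R t where Rt: "R > 1" "t \<in> {0..<1}" "z = X.rp t R" using X.B_polar X.piece_subset by blast
    thus "z \<in> X.pc a" using z Qin X.rp_in_pc_iff sub by blast
  qed
  have fQ: "poly f ` ?Q \<subseteq> ?S'"
  proof
    fix w assume "w \<in> poly f ` ?Q"
    then obtain z where z: "z \<in> ?Q" "w = poly f z" by blast
    then obtain R t where Rt: "R > 1" "t \<in> {0..<1}" "z = X.rp t R" using X.B_polar X.piece_subset by blast
    have t: "0 < frac (t - a)" "frac (t - a) < x" using z Rt Qin fa1 by (auto simp: oarc_def simp del: frac_gt_0_iff)
    have lt: "d * frac (t - a) < Y.gap a'" using t(2) degree_pos unfolding x(3)[symmetric] by simp
    have "frac (S.im t - a') = frac (d * frac (t - a))" unfolding a'_def by (rule frac_mult_gap[symmetric])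
    also have "\<dots> = d * frac (t - a)" using lt gp by (simp add: frac_eq)
    finally have "S.im t \<in> Y.arc_from a'"
      using t(1) lt degree_pos angle_mult_range[of d t] by (simp add: oarc_def del: frac_gt_0_iff)
    hence "Y.rp (S.im t) (R ^ d) \<in> Y.pc a'" using Y.rp_in_pc_iff power_gt_1[OF Rt(1)] angle_mult_range by blast
    hence "Y.rp (S.im t) (R ^ d) \<in> ?S'" using Y.pc_subset_sec[OF a'] by blast
    thus "w \<in> ?S'" using f_rp[OF Rt(1)] z Rt by metis
  qed
  obtain t0 where t0: "t0 \<in> oarc a a1" using oarc_nonempty[OF ar a1r aa1] by blast
  define z0 where "z0 = X.rp t0 2"
  have z0: "z0 \<in> ?Q" unfolding z0_def using Qin[of 2 t0] t0 oarc_subset by (simp add: subset_iff)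
  \<comment> \<open>The component of the preimage of the value sector that contains the piece
    between the rays of angles \<open>a\<close> and \<open>a1\<close>.\<close>
  define W where "W = connected_component_set (poly f -` ?S') z0"
  have QV: "?Q \<subseteq> poly f -` ?S'" using fQ by blast
  have W: "W \<in> components (poly f -` ?S')" unfolding W_def using z0 QV by (intro componentsI) blast
  have QW: "?Q \<subseteq> W" unfolding W_def by (rule connected_component_maximal[OF z0 X.connected_piece QV])
  have Wpre: "W \<subseteq> poly f -` ?S'" using W by (rule in_components_subset)
  have "W \<subseteq> - X.web" using Wpre f_web Y.sec_subset[of a'] by blast
  hence Wsec: "W \<subseteq> X.sec a"
    using components_maximal[OF X.sec_in_components[OF a] in_components_connected[OF W]] QW Qpc z0 X.pc_subset_sec[OF a]
    by blast
  have openW: "open W" using W open_components[OF open_vimage_poly[OF Y.open_sec]] by blast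
  show ?thesis
  proof (rule ccontr)
    assume "\<not> ?thesis"
    hence nc: "\<not> critical_point f z" if "z \<in> W" for z
      using that Wsec Wpre unfolding a'_def by blast
    have inj: "inj_on (poly f) W" and img: "poly f ` W = ?S'"
      using poly_component_simply_connected_injective[OF degree_pos Y.open_sec Y.simply_connected_sec[OF a'] W nc] by blast+
    \<comment> \<open>The piece already covers all basin points of the value sector, so injectivity
      leaves no room in \<open>W\<close> for other basin points.\<close>
    have WB: "W \<inter> B \<subseteq> ?Q"
    proof
      fix z assume z: "z \<in> W \<inter> B"
      then obtain R t where Rt: "R > 1" "t \<in> {0..<1}" "z = X.rp t R" using X.B_polar by blast
      have "poly f z \<in> ?S' \<inter> B'" using z Wpre in_B by blast
      hence "Y.rp (S.im t) (R ^ d) \<in> Y.pc a'" unfolding Y.sec_Int_B[OF a'] using f_rp[OF Rt(1)] Rt(3) by metis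
      hence imt: "S.im t \<in> Y.arc_from a'"
        using Y.rp_in_pc_iff power_gt_1[OF Rt(1)] angle_mult_range by blast
      define y where "y = frac (S.im t - a')"
      have y: "0 < y" "y < Y.gap a'" using imt by (auto simp: y_def oarc_def simp del: frac_gt_0_iff)
      define s where "s = frac (a + y / d)"
      have yd: "0 < y / d" "y / d < x" using y degree_pos x(3) by (auto simp: x_def divide_strict_right_mono)
      have sr: "s \<in> {0..<1}" by (simp add: s_def frac_lt_1)
      have fs: "frac (s - a) = y / d"
      proof -
        have "s - a - y / d \<in> \<int>" using frac_diff_Ints(1)[of "a + y / d"] by (simp add: s_def algebra_simps)
        thus ?thesis using yd x by (simp add: frac_unique_iff)
      qed
      have sarc: "s \<in> oarc a a1" using sr fs yd fa1 by (simp add: oarc_def del: frac_gt_0_iff)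
      have "S.im s = S.im t"
      proof -
        have "frac (S.im s - a') = frac (d * frac (s - a))" unfolding a'_def by (rule frac_mult_gap[symmetric])
        also have "\<dots> = frac y" using fs degree_pos by simp
        also have "\<dots> = frac (S.im t - a')" by (simp add: y_def)
        finally have "frac (S.im s) = frac (S.im t)" unfolding frac_eq_iff_diff_Ints by simp
        thus ?thesis using angle_mult_range by (metis frac_eq_id)
      qed
      hence "poly f (X.rp s R) = poly f z" using f_rp[OF Rt(1)] Rt(3) by metis
      moreover have sQ: "X.rp s R \<in> ?Q" using Qin[OF Rt(1) sr] sarc by blast
      ultimately have "X.rp s R = z" using inj QW z by (meson IntD1 inj_onD subsetD)
      thus "z \<in> ?Q" using sQ by simp
    qed
    \<comment> \<open>The ray of angle \<open>a1\<close> lands at a root over \<open>p'\<close>,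
      which differs from \<open>p\<close> because \<open>a1\<close> is not in
      \<open>A\<close>.\<close>
    obtain q where q: "poly f q = p'" "(X.rp a1 \<longlongrightarrow> q) (at_right 1)"
      using preimage_rays_land[of a1] ima1 b' by metis
    have qp: "q \<noteq> p" using only_A[OF a1r] q(2) a1A by blast
    have qB: "q \<notin> B" using q(1) in_B Y.p_notin by metis
    have la1: "landing_ray (X.rp a1) q" by (rule X.landing_ray_rp[OF q(2) qB])
    define Y0 where "Y0 = insert p (X.ray a) \<union> insert q (X.ray a1)"
    have p'S: "p' \<notin> ?S'" using Y.sec_subset unfolding Y.web_def by blast
    have memY: "X.rp t R \<in> Y0 \<longleftrightarrow> t = a \<or> t = a1" if "R > 1" "t \<in> {0..<1}" for t R
    proof -
      have "X.rp t R \<in> B" using X.psi_in X.norm_polar that(1) by blast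
      hence "X.rp t R \<noteq> p" "X.rp t R \<noteq> q" using X.p_notin qB by auto
      thus ?thesis unfolding Y0_def using X.in_ray_iff[OF that ar] X.in_ray_iff[OF that a1r] by blast
    qed
    \<comment> \<open>A basin point \<open>zc\<close> of another sector lies off both rays and
      outside \<open>X.sec a\<close>; it will contradict \<open>D \<subseteq> W\<close>.\<close>
    define c where "c = X.next_angle a"
    have c: "c \<in> A" "c \<noteq> a" unfolding c_def by (rule X.next_angle)+
    define zc where "zc = X.rp (X.base_angle c) 2"
    have bc: "X.base_angle c \<in> X.arc_from c" by (rule X.base_angle[OF c(1)])
    have bcr: "X.base_angle c \<in> {0..<1}" using bc oarc_subset by blast
    have zcB: "zc \<in> B" "zc \<in> X.sec c"
      unfolding zc_def using X.base_in_pc[OF c(1)] X.piece_subset X.pc_subset_sec[OF c(1)] by blast+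
    have "X.base_angle c \<noteq> a" "X.base_angle c \<noteq> a1"
      using bc a1arc X.arc_from_disjoint[OF c(1) a c(2)] X.arc_from_disjoint_A[OF c(1)] a by blast+
    hence zcY: "zc \<notin> Y0" unfolding zc_def using memY[of 2 "X.base_angle c"] bcr by simp
    have conY: "connected (- Y0)"
      unfolding Y0_def
    proof (rule landing_rays_distinct_points_connected[OF X.landing_A[OF a] la1])
      have "X.ray a \<inter> X.ray a1 = {}" by (rule X.rays_disjoint[OF ar a1r aa1])
      moreover have "p \<notin> X.ray a1" "q \<notin> X.ray a" using X.ray_subset X.p_notin qB by blast+
      ultimately show "insert p (X.ray a) \<inter> insert q (X.ray a1) = {}" using qp by blast
      show "zc \<notin> insert p (X.ray a) \<union> insert q (X.ray a1)" using zcY unfolding Y0_def .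
    qed
    \<comment> \<open>Outside the basin the frontier of \<open>W\<close> contains only roots over
      \<open>p'\<close>. Removing these finitely many points leaves a connected set.\<close>
    define F where "F = {z. poly f z = p'}"
    define D where "D = - Y0 - F"
    have clY: "closed Y0"
      unfolding Y0_def by (intro closed_Un closed_landing_ray X.landing_A[OF a] la1)
    have conD: "connected D"
      unfolding D_def
      by (rule connected_open_diff_countable)
        (use clY conY finite_poly_fibre[OF degree_pos] in \<open>auto simp: F_def countable_finite\<close>)
    have "W \<inter> Y0 = {}"
    proof (rule ccontr)
      assume "W \<inter> Y0 \<noteq> {}"
      then obtain z where z: "z \<in> W" "z \<in> Y0" by blast
      have "z \<noteq> p" "z \<notin> X.ray a" using z(1) Wsec X.sec_subset[of a] a unfolding X.web_def by blast+
      moreover have "z \<noteq> q" using z(1) Wpre q(1) p'S by blast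
      ultimately have "z \<in> X.ray a1" using z(2) unfolding Y0_def by blast
      then obtain R where R: "R > 1" "z = X.rp a1 R" by auto
      have "z \<in> B" using R X.psi_in X.norm_polar by blast
      hence "z \<in> ?Q" using WB z by blast
      hence "a1 \<in> oarc a a1" using Qin[OF R(1) a1r] R(2) by blast
      thus False by (simp add: oarc_def)
    qed
    moreover have "W \<inter> F = {}" unfolding F_def using Wpre p'S by blast
    ultimately have WD: "W \<subseteq> D" unfolding D_def by blast
    \<comment> \<open>In the basin such a point would lie on the other side of the two rays, in an
      open piece disjoint from \<open>W\<close>. Elsewhere it would map to \<open>p'\<close>, the
      only web point outside the basin.\<close>
    have "D \<inter> frontier W = {}"
    proof (rule ccontr)
      assume "D \<inter> frontier W \<noteq> {}"
      then obtain z where z: "z \<in> D" "z \<in> frontier W" by blast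
      have zW: "z \<in> closure W" "z \<notin> W" using z(2) openW by (auto simp: frontier_def interior_open)
      show False
      proof (cases "z \<in> B")
        case True
        then obtain R t where Rt: "R > 1" "t \<in> {0..<1}" "z = X.rp t R" using X.B_polar by blast
        have ta: "t \<noteq> a" "t \<noteq> a1" using z(1) memY[OF Rt(1,2)] Rt(3) unfolding D_def by blast+
        have "t \<notin> oarc a a1" using zW(2) QW Qin[OF Rt(1,2)] Rt(3) by blast
        hence "t \<in> oarc a1 a" using oarc_complement[OF ar a1r Rt(2) aa1 ta] by blast
        hence zP: "z \<in> X.piece a1 a" using X.in_piece_iff[OF Rt(1,2)] Rt(3) by blast
        have "X.piece a1 a \<inter> W = {}"
        proof (rule ccontr)
          assume "X.piece a1 a \<inter> W \<noteq> {}"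
          then obtain u where u: "u \<in> X.piece a1 a" "u \<in> W" by blast
          then obtain R s where Rs: "R > 1" "s \<in> {0..<1}" "u = X.rp s R" using X.B_polar X.piece_subset by blast
          have "u \<in> ?Q" using u WB X.piece_subset by blast
          hence "s \<in> oarc a a1" "s \<in> oarc a1 a" using u X.in_piece_iff[OF Rs(1,2)] Rs(3) by blast+
          thus False using oarc_swap_disjoint[OF ar a1r] by blast
        qed
        hence "X.piece a1 a \<inter> closure W = {}" using X.open_piece by (simp add: open_Int_closure_eq_empty)
        thus False using zP zW(1) by blast
      next
        case False
        have "poly f z \<in> closure ?S'"
          using image_closure_subset[OF continuous_on_poly closed_closure, of f W ?S'] img zW(1)
          by (metis closure_subset image_subset_iff)
        moreover have "z \<notin> poly f -` ?S'"
        proof -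
          have "closed (- (poly f -` ?S'))" using open_vimage_poly[OF Y.open_sec] by blast
          from frontier_of_components_closed_complement[OF this] W have "frontier W \<subseteq> - (poly f -` ?S')" by simp
          thus ?thesis using z(2) by blast
        qed
        ultimately have "poly f z \<in> frontier ?S'" using Y.open_sec by (auto simp: frontier_def interior_open)
        hence "poly f z \<in> Y.web - B'" using Y.frontier_sec[OF a'] False in_B by blast
        hence "poly f z = p'" using Y.web_minus_B by blast
        thus False using z(1) unfolding D_def F_def by blast
      qed
    qed
    moreover have "D \<inter> W \<noteq> {}" using WD QW z0 by blast
    ultimately have "D \<subseteq> W" using connected_Int_frontier[OF conD, of W] by blast
    moreover have "zc \<in> D" unfolding D_def F_def using zcY zcB(1) in_B Y.p_notin by blast
    ultimately have "zc \<in> X.sec a" using Wsec by blast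
    thus False using zcB(2) X.sec_disjoint[OF c(1) a c(2)] by blast
  qed
qed

text \<open>For z in a sector and close to \<open>p\<close>, the roots near those over
  \<open>p'\<close> in that sector already account for \<open>S.extra a\<close> roots away from
  \<open>p\<close>, and z itself is one more. By \<open>root_count_sec\<close> the image of z can
  only lie in the sector at \<open>S.im a\<close>.\<close>

lemma local_homeomorphism:
  obtains U V g where "open U" "p \<in> U" "open V" "p' \<in> V" "homeomorphism U V (poly f) g"
    "g holomorphic_on V" "\<And>a. a \<in> A \<Longrightarrow> poly f ` (X.sec a \<inter> U) = Y.sec (S.im a) \<inter> V"
proof -
  have "deriv (poly f) p \<noteq> 0" using noncritical_p by (simp add: deriv_poly critical_point_def)
  then obtain r where r: "r > 0" "inj_on (poly f) (ball p r)"
    using has_complex_derivative_locally_injective[OF holomorphic_on_poly, of p UNIV f] by auto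
  have pU: "p \<notin> X.sec a" for a using X.sec_subset unfolding X.web_def by blast
  have "\<exists>\<delta>>0. \<forall>z\<in>X.sec a \<inter> ball p \<delta>. poly f z \<in> Y.sec (S.im a)" if a: "a \<in> A" for a
  proof -
    obtain e where e: "e > 0" "\<And>x. x \<in> {z\<in>X.sec a. poly f z = p'} \<Longrightarrow> x \<noteq> p \<Longrightarrow> e \<le> dist p x"
      using finite_set_avoid[OF finite_poly_fibre_on[OF degree_pos, of "X.sec a" p'], of p] by blast
    \<comment> \<open>Keeps all the roots over \<open>p'\<close> in the sector but excludes the
      points near \<open>p\<close>.\<close>
    define T where "T = X.sec a - cball p (e / 2)"
    have "{z\<in>T. poly f z = p'} = {z\<in>X.sec a. poly f z = p'}"
    proof (intro equalityI subsetI)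
      fix z assume z: "z \<in> {z\<in>X.sec a. poly f z = p'}"
      hence "z \<noteq> p" using pU by blast
      hence "e \<le> dist p z" using e(2) z by blast
      thus "z \<in> {z\<in>T. poly f z = p'}" using z e(1) by (simp add: T_def)
    qed (auto simp: T_def)
    hence "root_count f T p' = S.extra a" using root_count_at_p'[OF a] by (simp add: root_count_def)
    moreover have "open T" unfolding T_def using X.open_sec by (intro open_Diff) auto
    ultimately have ev: "\<forall>\<^sub>F w in nhds p'. S.extra a \<le> root_count f T w"
      using root_count_lsc[OF degree_pos, of T p'] by simp
    have "isCont (poly f) p" by simp
    hence "filterlim (poly f) (nhds p') (nhds p)" unfolding f_p[symmetric] by (simp add: isCont_def tendsto_nhds_iff)
    from filterlim_iff[THEN iffD1, OF this, rule_format, OF ev]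
    obtain \<delta> where \<delta>: "\<delta> > 0" "\<And>z. dist z p < \<delta> \<Longrightarrow> S.extra a \<le> root_count f T (poly f z)"
      unfolding eventually_nhds_metric by blast
    show ?thesis
    proof (intro exI[of _ "min \<delta> (e / 2)"] conjI ballI)
      fix z assume z: "z \<in> X.sec a \<inter> ball p (min \<delta> (e / 2))"
      have 1: "S.extra a \<le> root_count f T (poly f z)" using z by (intro \<delta>(2)) (auto simp: dist_commute)
      have "T \<inter> {z} = {}" using z by (auto simp: T_def)
      hence 2: "root_count f (T \<union> {z}) (poly f z) = root_count f T (poly f z) + root_count f {z} (poly f z)"
        by (rule root_count_Un[OF degree_pos])
      have 3: "root_count f {z} (poly f z) \<noteq> 0" using root_count_eq_0_iff[OF degree_pos] by blast
      have "root_count f (T \<union> {z}) (poly f z) \<le> root_count f (X.sec a) (poly f z)"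
        using z by (intro root_count_mono[OF degree_pos]) (auto simp: T_def)
      hence "S.extra a < root_count f (X.sec a) (poly f z)" using 1 2 3 by linarith
      thus "poly f z \<in> Y.sec (S.im a)" using root_count_sec[OF a, of "poly f z"] by (simp split: if_splits)
    qed (use \<delta>(1) e(1) in auto)
  qed
  then obtain \<delta> where \<delta>: "\<And>a. a \<in> A \<Longrightarrow> \<delta> a > 0 \<and> (\<forall>z\<in>X.sec a \<inter> ball p (\<delta> a). poly f z \<in> Y.sec (S.im a))"
    by metis
  define \<epsilon> where "\<epsilon> = Min (insert r (\<delta> ` A))"
  have \<epsilon>: "\<epsilon> > 0" "\<epsilon> \<le> r" "\<And>a. a \<in> A \<Longrightarrow> \<epsilon> \<le> \<delta> a"
    unfolding \<epsilon>_def using X.finite_A \<delta> r(1) by auto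
  define U where "U = ball p \<epsilon>"
  define V where "V = poly f ` U"
  have inj: "inj_on (poly f) U" unfolding U_def by (rule inj_on_subset[OF r(2)]) (use \<epsilon>(2) in auto)
  have oU: "open U" "p \<in> U" using \<epsilon>(1) by (auto simp: U_def)
  obtain g where g: "g holomorphic_on V" "\<And>z. z \<in> U \<Longrightarrow> g (poly f z) = z"
    using holomorphic_has_inverse[OF holomorphic_on_poly oU(1) inj] unfolding V_def by metis
  have hom: "homeomorphism U V (poly f) g"
    using g holomorphic_on_imp_continuous_on[OF g(1)] continuous_on_poly
    by (auto simp: homeomorphism_def V_def image_image)
  have oV: "open V" unfolding V_def by (rule open_mapping_thm3[OF holomorphic_on_poly oU(1) inj])
  have sub: "poly f z \<in> Y.sec (S.im a)" if "a \<in> A" "z \<in> X.sec a" "z \<in> U" for a z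
    using \<delta>[OF that(1)] \<epsilon>(3)[OF that(1)] that by (auto simp: U_def)
  have eq: "poly f ` (X.sec a \<inter> U) = Y.sec (S.im a) \<inter> V" if a: "a \<in> A" for a
  proof (intro equalityI subsetI)
    fix w assume "w \<in> poly f ` (X.sec a \<inter> U)"
    thus "w \<in> Y.sec (S.im a) \<inter> V" using sub[OF a] unfolding V_def by blast
  next
    \<comment> \<open>The preimage in \<open>U\<close> lies in some sector, which near
      \<open>p\<close> maps into the sector at its own image angle; disjointness of the sectors
      identifies it.\<close>
    fix w assume w: "w \<in> Y.sec (S.im a) \<inter> V"
    then obtain z where z: "z \<in> U" "w = poly f z" unfolding V_def by blast
    have "z \<in> (\<Union>c\<in>A. X.sec c)" using preimage_sectors w z Y.sec_subset[of "S.im a"] by blast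
    then obtain c where c: "c \<in> A" "z \<in> X.sec c" by blast
    have "w \<in> Y.sec (S.im c)" using sub[OF c z(1)] z(2) by simp
    hence "S.im c = S.im a" using w Y.sec_disjoint S.im_in c(1) a by blast
    hence "c = a" using S.im_inj c(1) a by blast
    thus "w \<in> poly f ` (X.sec a \<inter> U)" using z c by blast
  qed
  show thesis
    by (rule that[OF oU oV _ hom g(1) eq]) (use f_p oU(2) in \<open>auto simp: V_def\<close>)
qed

text \<open>One direction transports curves by \<open>f\<close>, the other by its local inverse
  \<open>g\<close>.\<close>

lemma ccw_around_iff:
  assumes U: "open U" "p \<in> U" "open V" "p' \<in> V" "homeomorphism U V (poly f) g" "g holomorphic_on V"
    and eq: "\<And>a. a \<in> A \<Longrightarrow> poly f ` (X.sec a \<inter> U) = Y.sec (S.im a) \<inter> V"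
    and abc: "a \<in> A" "b \<in> A" "c \<in> A"
  shows "ccw_around p (X.sec a) (X.sec b) (X.sec c) \<longleftrightarrow>
    ccw_around p' (Y.sec (S.im a)) (Y.sec (S.im b)) (Y.sec (S.im c))"
proof -
  have neq: "X.sec s \<noteq> X.sec t \<longleftrightarrow> Y.sec (S.im s) \<noteq> Y.sec (S.im t)" if "s \<in> A" "t \<in> A" for s t
    using inj_on_eq_iff[OF X.inj_on_sec that] inj_on_eq_iff[OF Y.inj_on_sec S.im_in[OF that(1)] S.im_in[OF that(2)]]
      S.im_inj[OF that] by blast
  have injf: "inj_on (poly f) U" and injg: "inj_on g V"
    using U(5) by (auto simp: homeomorphism_def intro: inj_on_inverseI)
  have gp: "g p' = p" using U(2,5) f_p by (metis homeomorphism_apply1)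
  have geq: "g ` (Y.sec (S.im t) \<inter> V) \<subseteq> X.sec t" if "t \<in> A" for t
    using eq[OF that] U(5) by (auto simp: homeomorphism_def eq_commute[of "poly f ` _"])
  show ?thesis
  proof
    assume ccw: "ccw_around p (X.sec a) (X.sec b) (X.sec c)"
    have "ccw_around (poly f p) (Y.sec (S.im a)) (Y.sec (S.im b)) (Y.sec (S.im c))"
      by (rule ccw_around_transport[OF holomorphic_on_poly injf U(1,2) _ _ _ _ _ _ ccw])
        (use ccw neq abc eq in \<open>auto simp: ccw_around_def\<close>)
    thus "ccw_around p' (Y.sec (S.im a)) (Y.sec (S.im b)) (Y.sec (S.im c))" by (simp add: f_p)
  next
    assume ccw: "ccw_around p' (Y.sec (S.im a)) (Y.sec (S.im b)) (Y.sec (S.im c))"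
    have "ccw_around (g p') (X.sec a) (X.sec b) (X.sec c)"
      by (rule ccw_around_transport[OF U(6) injg U(3,4) _ _ _ _ _ _ ccw])
        (use ccw neq abc geq in \<open>auto simp: ccw_around_def\<close>)
    thus "ccw_around p (X.sec a) (X.sec b) (X.sec c)" by (simp add: gp)
  qed
qed

end

section \<open>Iterated basins of infinity\<close>

lemma bounded_poly_seq_escape:
  assumes "bounded_poly_seq d K M P"
  obtains R0 where "R0 \<ge> 1" "\<And>m z. m \<ge> 1 \<Longrightarrow> norm z \<ge> R0 \<Longrightarrow> norm (poly (P m) z) \<ge> 2 * norm z"
proof
  \<comment> \<open>The leading term has modulus at least |z|^n / K, and the at most d lower terms
    have modulus at most M |z|^(n-1) each; the constant makes |z|/K - M d at least 2.\<close>
  define R0 where "R0 = max 1 (K * (M * d + 2))"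
  show "R0 \<ge> 1" by (simp add: R0_def)
  fix m :: nat and z :: complex
  assume m: "m \<ge> 1" and z: "norm z \<ge> R0"
  define n where "n = degree (P m)"
  have b: "2 \<le> n" "n \<le> d" "1 / K \<le> norm (coeff (P m) n)" "\<And>k. k < n \<Longrightarrow> norm (coeff (P m) k) \<le> M"
    and K: "K \<ge> 1" "M \<ge> 0"
    using assms m unfolding bounded_poly_seq_def n_def by auto
  have z1: "norm z \<ge> 1" using z by (simp add: R0_def)
  \<comment> \<open>Degree at least 2 gives j \<ge> 1, hence |z| \<le> |z|^j, which supplies the
    factor |z| in the final estimate.\<close>
  obtain j where j: "n = Suc j" "j \<ge> 1" using b(1) by (cases n) auto
  have low: "norm (\<Sum>k<n. coeff (P m) k * z ^ k) \<le> real d * (M * norm z ^ j)"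
  proof -
    have "norm (\<Sum>k<n. coeff (P m) k * z ^ k) \<le> (\<Sum>k<n. M * norm z ^ j)"
    proof (rule sum_norm_le)
      fix k assume k: "k \<in> {..<n}"
      hence "norm (coeff (P m) k) * norm z ^ k \<le> M * norm z ^ j"
        using b(4) z1 K j by (intro mult_mono power_increasing) auto
      thus "norm (coeff (P m) k * z ^ k) \<le> M * norm z ^ j" by (simp add: norm_mult norm_power)
    qed
    also have "\<dots> = real n * (M * norm z ^ j)" by simp
    also have "\<dots> \<le> real d * (M * norm z ^ j)" using b(2) K by (intro mult_right_mono) auto
    finally show ?thesis .
  qed
  have "poly (P m) z = (\<Sum>k<n. coeff (P m) k * z ^ k) + coeff (P m) n * z ^ n"
    by (simp add: poly_altdef n_def flip: lessThan_Suc_atMost)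
  hence "norm (coeff (P m) n * z ^ n) \<le> norm (poly (P m) z) + norm (\<Sum>k<n. coeff (P m) k * z ^ k)"
    by (metis add_diff_cancel_left' norm_triangle_ineq4)
  moreover have "1 / K * norm z ^ n \<le> norm (coeff (P m) n * z ^ n)"
    unfolding norm_mult norm_power using b(3) by (intro mult_right_mono) auto
  ultimately have "1 / K * norm z ^ n - real d * (M * norm z ^ j) \<le> norm (poly (P m) z)"
    using low by linarith
  moreover have "1 / K * norm z ^ n - real d * (M * norm z ^ j) = norm z ^ j * (norm z / K - M * d)"
    by (simp add: j algebra_simps)
  moreover have "norm z * 2 \<le> norm z ^ j * (norm z / K - M * d)"
  proof (rule mult_mono)
    show "norm z \<le> norm z ^ j" using z1 j(2) power_increasing[of 1 j "norm z"] by simp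
    have "K * (M * d + 2) \<le> norm z" using z by (simp add: R0_def)
    hence "M * d + 2 \<le> norm z / K" using K by (simp add: field_simps)
    thus "2 \<le> norm z / K - M * d" by simp
  qed auto
  ultimately show "norm (poly (P m) z) \<ge> 2 * norm z" by linarith
qed

lemma iterate_self [simp]: "iterate P m m = id"
  by (cases m) auto

lemma iterate_left:
  assumes "Suc m \<le> n"
  shows "iterate P m n z = iterate P (Suc m) n (poly (P (Suc m)) z)"
  using assms by (induction n rule: dec_induct) auto

lemma continuous_on_iterate: "continuous_on S (iterate P m n)"
proof (induction n arbitrary: S)
  case (Suc n)
  show ?case
    using continuous_on_compose[OF Suc.IH continuous_on_poly, of S "P (Suc n)"] by (auto simp: id_def)
qed (simp add: id_def)

lemma poly_in_basin_iff:
  "poly (P (Suc m)) z \<in> basin_infinity P (Suc m) \<longleftrightarrow> z \<in> basin_infinity P m"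
proof -
  have "\<forall>\<^sub>F n in sequentially. norm (iterate P (Suc m) n (poly (P (Suc m)) z)) = norm (iterate P m n z)"
    using eventually_ge_at_top[of "Suc m"] by eventually_elim (simp add: iterate_left)
  from filterlim_cong[OF refl refl this] show ?thesis by (simp add: basin_infinity_def)
qed

text \<open>Beyond \<open>R0\<close> the modulus doubles at every step, so passing \<open>R0\<close>
  once suffices to escape. This exhibits the basin as a union of open sets with bounded
  complement.\<close>

lemma basin_infinity_eq:
  assumes R0: "R0 \<ge> 1" "\<And>m z. m \<ge> 1 \<Longrightarrow> norm z \<ge> R0 \<Longrightarrow> norm (poly (P m) z) \<ge> 2 * norm z"
  shows "basin_infinity P m = (\<Union>n\<in>{m..}. {z. R0 < norm (iterate P m n z)})"
proof (intro equalityI subsetI)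
  fix z assume "z \<in> basin_infinity P m"
  hence "\<forall>\<^sub>F n in sequentially. R0 < norm (iterate P m n z)"
    by (simp add: basin_infinity_def filterlim_at_top_dense)
  then obtain N where "\<And>n. n \<ge> N \<Longrightarrow> R0 < norm (iterate P m n z)"
    unfolding eventually_sequentially by blast
  hence "R0 < norm (iterate P m (max N m) z)" by simp
  thus "z \<in> (\<Union>n\<in>{m..}. {z. R0 < norm (iterate P m n z)})" by (intro UN_I[of "max N m"]) auto
next
  fix z assume "z \<in> (\<Union>n\<in>{m..}. {z. R0 < norm (iterate P m n z)})"
  then obtain n where n: "n \<ge> m" "R0 < norm (iterate P m n z)" by blast
  have grow: "R0 * 2 ^ k \<le> norm (iterate P m (n + k) z)" for k
  proof (induction k)
    case (Suc k)
    have "R0 * 1 \<le> R0 * 2 ^ k" using R0(1) by (intro mult_left_mono) auto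
    hence "R0 \<le> norm (iterate P m (n + k) z)" using Suc.IH by simp
    hence "2 * norm (iterate P m (n + k) z) \<le> norm (poly (P (Suc (n + k))) (iterate P m (n + k) z))"
      by (intro R0(2)) auto
    thus ?case using Suc.IH n(1) by simp
  qed (use n in simp)
  have "filterlim (\<lambda>k. (2::real) ^ k) at_top sequentially"
    using filterlim_realpow_sequentially_gt1[of "2::real"]
    by (simp add: filterlim_at_infinity_conv_norm_at_top norm_power)
  hence "filterlim (\<lambda>k. R0 * 2 ^ k) at_top sequentially"
    using R0(1) by (intro filterlim_tendsto_pos_mult_at_top[OF tendsto_const]) auto
  hence "filterlim (\<lambda>k. norm (iterate P m (n + k) z)) at_top sequentially"
    by (rule filterlim_at_top_mono) (use grow in simp)
  hence "filterlim (\<lambda>k. norm (iterate P m (k + n) z)) at_top sequentially" by (simp add: add.commute)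
  hence "filterlim (\<lambda>k. norm (iterate P m k z)) at_top sequentially"
    using eventually_sequentially_seg[of "\<lambda>k. Q (norm (iterate P m k z))" n for Q]
    unfolding filterlim_iff by simp
  thus "z \<in> basin_infinity P m" by (simp add: basin_infinity_def)
qed

lemma
  assumes "bounded_poly_seq d K M P"
  shows open_basin_infinity: "open (basin_infinity P m)"
    and bounded_compl_basin_infinity: "bounded (- basin_infinity P m)"
proof -
  obtain R0 where R0: "R0 \<ge> 1" "\<And>m z. m \<ge> 1 \<Longrightarrow> norm z \<ge> R0 \<Longrightarrow> norm (poly (P m) z) \<ge> 2 * norm z"
    using bounded_poly_seq_escape[OF assms] by metis
  have eq: "basin_infinity P m = (\<Union>n\<in>{m..}. {z. R0 < norm (iterate P m n z)})"
    by (rule basin_infinity_eq[OF R0])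
  have "open {z. R0 < norm (iterate P m n z)}" for n
    by (intro open_Collect_less continuous_intros continuous_on_iterate)
  thus "open (basin_infinity P m)" unfolding eq by blast
  have "norm z \<le> R0" if "z \<in> - basin_infinity P m" for z
  proof (rule ccontr)
    assume "\<not> norm z \<le> R0"
    hence "R0 < norm (iterate P m m z)" by simp
    thus False using that unfolding eq by blast
  qed
  thus "bounded (- basin_infinity P m)" by (meson bounded_iff)
qed

text \<open>Puts the orbit points outside the basins, as the charts require. The basin is open, so
  it misses the closure of the filled Julia set too.\<close>

lemma julia_disjoint_basin:
  assumes "bounded_poly_seq d K M P"
  shows "julia P m \<inter> basin_infinity P m = {}"
proof -
  have "filled_julia P m \<inter> basin_infinity P m = {}"
  proof (rule ccontr)
    assume "filled_julia P m \<inter> basin_infinity P m \<noteq> {}"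
    then obtain z where z: "z \<in> filled_julia P m" "z \<in> basin_infinity P m" by blast
    have "((\<lambda>n. ereal (norm (iterate P m n z))) \<longlongrightarrow> \<infinity>) sequentially"
      using z(2) by (simp add: basin_infinity_def tendsto_PInfty_eq_at_top)
    hence "limsup (\<lambda>n. ereal (norm (iterate P m n z))) = \<infinity>" by (rule lim_imp_Limsup[rotated]) simp
    thus False using z(1) by (simp add: filled_julia_def)
  qed
  hence "closure (filled_julia P m) \<inter> basin_infinity P m = {}"
    using open_Int_closure_eq_empty[OF open_basin_infinity[OF assms], of m "filled_julia P m"] by blast
  thus ?thesis unfolding julia_def frontier_def by blast
qed

section \<open>Root counts translated into the four assertions\<close>

theorem theorem1p6:
  fixes P :: "nat \<Rightarrow> complex poly"
    and \<phi> :: "nat \<Rightarrow> complex \<Rightarrow> complex"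
    and p :: "nat \<Rightarrow> complex"
    and d :: enat and N :: nat
    and deg :: "nat \<Rightarrow> nat"
    and A :: "nat \<Rightarrow> real set"
    and d' :: nat and K M :: real
    and m :: nat
  assumes "formal_orbit_portrait d N deg A" and "N \<ge> 2"
    and "bounded_poly_seq d' K M P"
    and "realizes P \<phi> p deg A"
  shows
    "\<comment> \<open>(1)\<close>
     ((\<forall>S\<in>sectors P \<phi> p A m.
         critical_sector (P (Suc m)) S \<longleftrightarrow> critical_arc deg A m (sector_arc P \<phi> m S)) \<and>
      (\<forall>S\<in>sectors P \<phi> p A m. critical_sector (P (Suc m)) S \<longrightarrow>
         angular_width P \<phi> m S > 1 / real (deg (Suc m))) \<and>
      (\<Sum>S\<in>{S \<in> sectors P \<phi> p A m. \<not> critical_sector (P (Suc m)) S}. angular_width P \<phi> m S)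
         < 1 / real (deg (Suc m))) \<and>
     \<comment> \<open>(2)\<close>
     (poly (P (Suc m)) (p m) = p (Suc m) \<and>
      (\<exists>U V g \<sigma>.
         open U \<and> p m \<in> U \<and> open V \<and> p (Suc m) \<in> V \<and>
         homeomorphism U V (poly (P (Suc m))) g \<and> g holomorphic_on V \<and>
         bij_betw \<sigma> (sectors P \<phi> p A m) (sectors P \<phi> p A (Suc m)) \<and>
         (\<forall>S\<in>sectors P \<phi> p A m. poly (P (Suc m)) ` (S \<inter> U) = \<sigma> S \<inter> V) \<and>
         (\<forall>S1\<in>sectors P \<phi> p A m. \<forall>S2\<in>sectors P \<phi> p A m. \<forall>S3\<in>sectors P \<phi> p A m.
            ccw_around (p m) S1 S2 S3 \<longleftrightarrow> ccw_around (p (Suc m)) (\<sigma> S1) (\<sigma> S2) (\<sigma> S3)))) \<and>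
     \<comment> \<open>(3)\<close>
     (\<forall>S\<in>sectors P \<phi> p A m.
        (\<not> critical_sector (P (Suc m)) S \<longrightarrow>
           (\<exists>S'\<in>sectors P \<phi> p A (Suc m). \<exists>g. homeomorphism S S' (poly (P (Suc m))) g)) \<and>
        (critical_sector (P (Suc m)) S \<longrightarrow> poly (P (Suc m)) ` S = UNIV)) \<and>
     \<comment> \<open>(4)\<close>
     (\<forall>S\<in>sectors P \<phi> p A m. critical_sector (P (Suc m)) S \<longrightarrow>
        (\<exists>!J. critical_value_arc deg A m (sector_arc P \<phi> m S) J) \<and>
        (\<forall>J. critical_value_arc deg A m (sector_arc P \<phi> m S) J \<longrightarrow>
           (\<exists>S'\<in>sectors P \<phi> p A (Suc m).
              sector_arc P \<phi> (Suc m) S' = J \<and>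
              critical_value_sector (P (Suc m)) S' \<and>
              (\<exists>c\<in>S. critical_point (P (Suc m)) c \<and> poly (P (Suc m)) c \<in> S') \<and>
              (\<forall>k. 2 \<le> k \<and> k \<le> deg (Suc m) \<and>
                   arc_covers (deg (Suc m)) (sector_arc P \<phi> m S) J k \<longrightarrow>
                 (\<forall>w\<in>S'. covers_point (P (Suc m)) S w k) \<and>
                 (\<forall>w. w \<notin> S' \<longrightarrow> covers_point (P (Suc m)) S w (k - 1))))))"
proof -
  have basin: "basin_chart (basin_infinity P n) (\<phi> n)" for n
    using assms(3,4) open_basin_infinity bounded_compl_basin_infinity
    unfolding basin_chart_def realizes_def boettcher_maps_def by blast
  have angle: "angle_set (A n)" for n
    using assms(1,2) unfolding angle_set_def formal_orbit_portrait_def by auto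
  have land: "\<theta> \<in> A n \<longleftrightarrow> (ray_param P \<phi> n \<theta> \<longlongrightarrow> p n) (at_right 1)" if "\<theta> \<in> {0..<1}" for \<theta> n
    using assms(4) that unfolding realizes_def ray_lands_at_def by blast
  have rpe: "ray_param P \<phi> n \<theta> = (\<lambda>R. inv_into (basin_infinity P n) (\<phi> n) (of_real R * circle_exp \<theta>))" for n \<theta>
    by (rule ext) (simp add: ray_param_def)
  have chart: "portrait_chart (basin_infinity P n) (\<phi> n) (A n) (p n)" for n
  proof (intro portrait_chart.intro portrait_chart_axioms.intro basin angle)
    show "p n \<notin> basin_infinity P n"
      using assms(4) julia_disjoint_basin[OF assms(3)] unfolding realizes_def by blast
    fix a assume a: "a \<in> A n"
    hence "a \<in> {0..<1}" using angle[of n] angle_set.A_subset by blast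
    thus "((\<lambda>R. inv_into (basin_infinity P n) (\<phi> n) (of_real R * circle_exp a)) \<longlongrightarrow> p n) (at_right 1)"
      using land a rpe by metis
  qed
  have deg: "degree (P (Suc m)) = deg (Suc m)" using assms(4) unfolding realizes_def by simp
  have step: "angle_step (A m) (A (Suc m)) (degree (P (Suc m)))"
    using assms(1) angle unfolding angle_step_def angle_step_axioms_def deg formal_orbit_portrait_def by auto
  interpret portrait_step "basin_infinity P m" "\<phi> m" "A m" "p m"
    "basin_infinity P (Suc m)" "\<phi> (Suc m)" "A (Suc m)" "p (Suc m)" "P (Suc m)"
  proof (intro portrait_step.intro portrait_step_axioms.intro chart step)
    show "poly (P (Suc m)) z \<in> basin_infinity P (Suc m) \<longleftrightarrow> z \<in> basin_infinity P m" for z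
      by (rule poly_in_basin_iff)
    show "\<phi> (Suc m) (poly (P (Suc m)) z) = \<phi> m z ^ degree (P (Suc m))" if "z \<in> basin_infinity P m" for z
      using assms(4) that unfolding realizes_def boettcher_maps_def by blast
    show "poly (P (Suc m)) (p m) = p (Suc m)" using assms(4) unfolding realizes_def is_orbit_def by blast
    show "t \<in> A m" if "t \<in> {0..<1}"
      "((\<lambda>R. inv_into (basin_infinity P m) (\<phi> m) (of_real R * circle_exp t)) \<longlongrightarrow> p m) (at_right 1)" for t
      using land[OF that(1)] that(2) rpe by metis
  qed
  let ?f = "P (Suc m)"
  have ext: "external_ray P \<phi> n \<theta> =
      (\<lambda>R. inv_into (basin_infinity P n) (\<phi> n) (of_real R * circle_exp \<theta>)) ` {1<..}" for n \<theta>
    unfolding external_ray_def rpe ..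
  have sec: "sectors P \<phi> p A m = X.sec ` A m"
    unfolding sectors_def ext X.components_eq[unfolded X.web_def] ..
  have sec': "sectors P \<phi> p A (Suc m) = Y.sec ` A (Suc m)"
    unfolding sectors_def ext Y.components_eq[unfolded Y.web_def] ..
  have sarc: "sector_arc P \<phi> m (X.sec a) = X.arc_from a" if "a \<in> A m" for a
    unfolding sector_arc_def ext by (rule X.sec_angles[OF that])
  have sarc': "sector_arc P \<phi> (Suc m) (Y.sec a) = Y.arc_from a" if "a \<in> A (Suc m)" for a
    unfolding sector_arc_def ext by (rule Y.sec_angles[OF that])
  have width: "angular_width P \<phi> m (X.sec a) = X.gap a" if "a \<in> A m" for a
    unfolding angular_width_def sarc[OF that] by (rule X.arc_length_arc_from[OF that])
  have crit: "critical_sector ?f (X.sec a) \<longleftrightarrow> S.extra a \<ge> 1" if a: "a \<in> A m" for a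
  proof (cases "S.extra a \<ge> 1")
    case True
    thus ?thesis using critical_point_over_value_sector[OF a] unfolding critical_sector_def by blast
  next
    case False
    hence "S.extra a = 0" by simp
    thus ?thesis using noncritical_sec[OF a] unfolding critical_sector_def by auto
  qed
  have carc: "critical_arc deg A m (X.arc_from a) \<longleftrightarrow> S.extra a \<ge> 1" if a: "a \<in> A m" for a
    using a S.gap_gt_iff[OF a] S.not_inj_on_arc[OF a] X.arc_length_arc_from[OF a]
    unfolding critical_arc_def X.complementary_arcs_eq deg by auto
  have cvarc: "critical_value_arc deg A m (X.arc_from a) J \<longleftrightarrow> J = Y.arc_from (S.im a)"
    if a: "a \<in> A m" and e: "S.extra a \<ge> 1" for a J
  proof
    let ?J = "Y.arc_from (S.im a)"
    assume "critical_value_arc deg A m (X.arc_from a) J"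
    then obtain c k where c: "c \<in> A (Suc m)" "J = Y.arc_from c"
      and k: "2 \<le> k" "arc_covers (deg (Suc m)) (X.arc_from a) J k"
        "\<And>J'. J' \<in> complementary_arcs (A (Suc m)) - {J} \<Longrightarrow> arc_covers (deg (Suc m)) (X.arc_from a) J' (k - 1)"
      unfolding critical_value_arc_def Y.complementary_arcs_eq by blast
    show "J = ?J"
    \<comment> \<open>Any other arc is covered \<open>S.extra a\<close> times. The arc at
      \<open>S.im a\<close> would then have to be covered one time fewer, although it is covered one
      time more.\<close>
    proof (rule ccontr)
      assume ne: "J \<noteq> ?J"
      hence "k = S.extra a"
        using k(2) S.arc_covers_arc[OF a c(1)] c(2) unfolding deg by (auto split: if_splits)
      moreover have "?J \<in> complementary_arcs (A (Suc m)) - {J}"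
        unfolding Y.complementary_arcs_eq using S.im_in[OF a] ne by blast
      hence "k - 1 = S.extra a + 1"
        using k(3) S.arc_covers_arc[OF a S.im_in[OF a]] unfolding deg by auto
      ultimately show False by simp
    qed
  next
    assume J: "J = Y.arc_from (S.im a)"
    have "arc_covers (deg (Suc m)) (X.arc_from a) J' (S.extra a)"
      if J': "J' \<in> complementary_arcs (A (Suc m)) - {J}" for J'
    proof -
      obtain c where "c \<in> A (Suc m)" "J' = Y.arc_from c" "c \<noteq> S.im a"
        using J' J unfolding Y.complementary_arcs_eq by blast
      thus ?thesis using S.arc_covers_arc[OF a] unfolding deg by simp
    qed
    moreover have "arc_covers (deg (Suc m)) (X.arc_from a) J (S.extra a + 1)"
      using S.arc_covers_arc[OF a S.im_in[OF a]] J unfolding deg by simp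
    moreover have "S.extra a + 1 \<le> deg (Suc m)" using S.extra_less[OF a] unfolding deg by simp
    moreover have "J \<in> complementary_arcs (A (Suc m))"
      unfolding Y.complementary_arcs_eq J using S.im_in[OF a] by blast
    ultimately show "critical_value_arc deg A m (X.arc_from a) J"
      unfolding critical_value_arc_def using carc[OF a] e
      by (intro conjI exI[of _ "S.extra a + 1"] ballI) simp_all
  qed
  have part1: "(\<forall>S\<in>sectors P \<phi> p A m.
         critical_sector ?f S \<longleftrightarrow> critical_arc deg A m (sector_arc P \<phi> m S)) \<and>
      (\<forall>S\<in>sectors P \<phi> p A m. critical_sector ?f S \<longrightarrow> angular_width P \<phi> m S > 1 / real (deg (Suc m))) \<and>
      (\<Sum>S\<in>{S \<in> sectors P \<phi> p A m. \<not> critical_sector ?f S}. angular_width P \<phi> m S) < 1 / real (deg (Suc m))"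
  proof (intro conjI)
    have "{S \<in> sectors P \<phi> p A m. \<not> critical_sector ?f S} = X.sec ` {a\<in>A m. S.extra a = 0}"
      unfolding sec using crit by auto
    hence "(\<Sum>S\<in>{S \<in> sectors P \<phi> p A m. \<not> critical_sector ?f S}. angular_width P \<phi> m S) =
        (\<Sum>a\<in>{a\<in>A m. S.extra a = 0}. angular_width P \<phi> m (X.sec a))"
      using sum.reindex[OF inj_on_subset[OF X.inj_on_sec], of "{a\<in>A m. S.extra a = 0}"] by simp
    also have "\<dots> = (\<Sum>a\<in>{a\<in>A m. S.extra a = 0}. X.gap a)" using width by (intro sum.cong) auto
    also have "\<dots> < 1 / real (deg (Suc m))" using S.noncritical_width unfolding deg .
    finally show "(\<Sum>S\<in>{S \<in> sectors P \<phi> p A m. \<not> critical_sector ?f S}. angular_width P \<phi> m S)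
        < 1 / real (deg (Suc m))" .
  qed (use crit carc sarc width S.gap_gt_iff in \<open>auto simp: sec deg\<close>)
  have part2: "\<exists>U V g \<sigma>.
         open U \<and> p m \<in> U \<and> open V \<and> p (Suc m) \<in> V \<and>
         homeomorphism U V (poly ?f) g \<and> g holomorphic_on V \<and>
         bij_betw \<sigma> (sectors P \<phi> p A m) (sectors P \<phi> p A (Suc m)) \<and>
         (\<forall>S\<in>sectors P \<phi> p A m. poly ?f ` (S \<inter> U) = \<sigma> S \<inter> V) \<and>
         (\<forall>S1\<in>sectors P \<phi> p A m. \<forall>S2\<in>sectors P \<phi> p A m. \<forall>S3\<in>sectors P \<phi> p A m.
            ccw_around (p m) S1 S2 S3 \<longleftrightarrow> ccw_around (p (Suc m)) (\<sigma> S1) (\<sigma> S2) (\<sigma> S3))"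
  proof -
    obtain U V g where U: "open U" "p m \<in> U" "open V" "p (Suc m) \<in> V" "homeomorphism U V (poly ?f) g"
        "g holomorphic_on V"
      and eq: "\<And>a. a \<in> A m \<Longrightarrow> poly ?f ` (X.sec a \<inter> U) = Y.sec (S.im a) \<inter> V"
      using local_homeomorphism by metis
    \<comment> \<open>Sectors are identified with their initial angles, and \<sigma> is the angle
      map in this indexing.\<close>
    define \<sigma> where "\<sigma> = (\<lambda>S. Y.sec (S.im (inv_into (A m) X.sec S)))"
    have \<sigma>: "\<sigma> (X.sec a) = Y.sec (S.im a)" if "a \<in> A m" for a
      unfolding \<sigma>_def using inv_into_f_f[OF X.inj_on_sec that] by simp
    have "bij_betw (inv_into (A m) X.sec) (X.sec ` A m) (A m)"
      using X.inj_on_sec by (intro bij_betw_inv_into) (simp add: bij_betw_def)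
    moreover have "bij_betw Y.sec (A (Suc m)) (Y.sec ` A (Suc m))" using Y.inj_on_sec by (simp add: bij_betw_def)
    ultimately have "bij_betw (Y.sec \<circ> S.im \<circ> inv_into (A m) X.sec) (X.sec ` A m) (Y.sec ` A (Suc m))"
      using S.bij by (blast intro: bij_betw_trans)
    hence "bij_betw \<sigma> (sectors P \<phi> p A m) (sectors P \<phi> p A (Suc m))"
      unfolding sec sec' \<sigma>_def by (simp add: o_def)
    moreover have "\<forall>S\<in>sectors P \<phi> p A m. poly ?f ` (S \<inter> U) = \<sigma> S \<inter> V"
      unfolding sec using eq \<sigma> by simp
    moreover have "\<forall>S1\<in>sectors P \<phi> p A m. \<forall>S2\<in>sectors P \<phi> p A m. \<forall>S3\<in>sectors P \<phi> p A m.
            ccw_around (p m) S1 S2 S3 \<longleftrightarrow> ccw_around (p (Suc m)) (\<sigma> S1) (\<sigma> S2) (\<sigma> S3)"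
      unfolding sec using ccw_around_iff[OF U eq] \<sigma> by simp
    ultimately show ?thesis using U by blast
  qed
  have part3: "\<forall>S\<in>sectors P \<phi> p A m.
        (\<not> critical_sector ?f S \<longrightarrow> (\<exists>S'\<in>sectors P \<phi> p A (Suc m). \<exists>g. homeomorphism S S' (poly ?f) g)) \<and>
        (critical_sector ?f S \<longrightarrow> poly ?f ` S = UNIV)"
    unfolding sec sec' using crit homeomorphism_sec image_sec S.im_in by fastforce
  show ?thesis
  proof (intro conjI[OF part1] conjI[OF conjI[OF f_p part2]] conjI[OF part3] ballI impI, goal_cases)
    case (1 S)
    then have cs: "critical_sector ?f S" and "S \<in> sectors P \<phi> p A m" by blast+
    then obtain a where a: "a \<in> A m" and S: "S = X.sec a" unfolding sec by blast
    have e: "S.extra a \<ge> 1" using cs crit[OF a] S by blast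
    let ?J = "Y.arc_from (S.im a)" and ?S' = "Y.sec (S.im a)"
    have cv: "critical_value_arc deg A m (sector_arc P \<phi> m S) J \<longleftrightarrow> J = ?J" for J
      unfolding S sarc[OF a] by (rule cvarc[OF a e])
    obtain c where c: "c \<in> S" "critical_point ?f c" "poly ?f c \<in> ?S'"
      using critical_point_over_value_sector[OF a e] S by blast
    have cov: "(\<forall>w\<in>?S'. covers_point ?f S w k) \<and> (\<forall>w. w \<notin> ?S' \<longrightarrow> covers_point ?f S w (k - 1))"
      if "arc_covers (deg (Suc m)) (sector_arc P \<phi> m S) ?J k" for k
    proof -
      have "k = S.extra a + 1"
        using that S.arc_covers_arc[OF a S.im_in[OF a]] unfolding S sarc[OF a] deg by simp
      thus ?thesis using root_count_sec[OF a] S by (simp add: covers_point_iff_root_count[OF degree_pos])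
    qed
    have "?S' \<in> sectors P \<phi> p A (Suc m)" unfolding sec' using S.im_in[OF a] by blast
    moreover have "sector_arc P \<phi> (Suc m) ?S' = ?J" by (rule sarc'[OF S.im_in[OF a]])
    moreover have "critical_value_sector ?f ?S'" unfolding critical_value_sector_def using c by blast
    ultimately show ?case
      unfolding cv using c cov by blast
  qed
qed

end
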